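(* Let $p>1$ and let $q\in L^1(0,1)$ be real-valued. For $n\in\mathbb{N}$ let $\lambda_n$ be the $n$th eigenvalue of the Dirichlet $p$-Laplacian problem $$-\left(y'^{(p-1)}\right)'=(p-1)(\lambda-q(x))y^{(p-1)}\ \text{ on }(0,1),\qquad y(0)=y(1)=0.$$ Then, as $n\to\infty$, $$\lambda_n^{1/p}=n\widehat{\pi}+\frac{1}{p(n\widehat{\pi})^{p-1}}\int_0^1 q(t)\,dt+o\!\left(\frac{1}{n^{p-1}}\right).$$ Furthermore, the functions $$F_n(x):=p(n\widehat{\pi})^p\left(n\,\ell_{j_n(x)}^{(n)}-1\right)+\int_0^1 q(t)\,dt,\qquad x\in(0,1),$$ converge to $q$ pointwise almost everywhere on $(0,1)$ and in $L^1(0,1)$ as $n\to\infty$.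
   Context: For a real-valued $f$, $f^{(p-1)}:=|f|^{p-1}\operatorname{sgn} f$. A solution $y$ of the equation is a function with $y$ and $y'^{(p-1)}$ absolutely continuous on $[0,1]$ satisfying the equation a.e. $\widehat{\pi}:=\dfrac{2\pi}{p\sin(\pi/p)}$. The $n$th eigenvalue $\lambda_n$ ($n\ge1$) is the one whose associated eigenfunction has exactly $n-1$ zeros in $(0,1)$; $\lambda_n>0$ for all large $n$. Nodal data: let $0=x_0^{(n)}<x_1^{(n)}<\dots<x_{n-1}^{(n)}<x_n^{(n)}=1$ be all the zeros in $[0,1]$ of the eigenfunction associated with $\lambda_n$. The nodal lengths are $\ell_i^{(n)}=x_{i+1}^{(n)}-x_i^{(n)}$, $0\le i\le n-1$, and for $x\in(0,1)$, $j_n(x)=\max\{i: x_i^{(n)}\le x\}$. *)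

theory Defs
  imports "HOL-Analysis.Analysis" "HOL-Library.Landau_Symbols"
begin

definition signed_powr :: "real \<Rightarrow> real \<Rightarrow> real"
  where "signed_powr u r = \<bar>u\<bar> powr r * sgn u"

text \<open>The intervals in the family may be listed in any order; degenerate intervals are harmless.\<close>

definition abs_continuous_on :: "real \<Rightarrow> real \<Rightarrow> (real \<Rightarrow> real) \<Rightarrow> bool"
  where "abs_continuous_on lo hi f \<longleftrightarrow>
    (\<forall>\<epsilon>>0. \<exists>\<delta>>0. \<forall>(m::nat) (a::nat \<Rightarrow> real) b.
       (\<forall>i<m. lo \<le> a i \<and> a i \<le> b i \<and> b i \<le> hi) \<longrightarrow>
       disjoint_family_on (\<lambda>i. {a i<..<b i}) {..<m} \<longrightarrow>
       (\<Sum>i<m. b i - a i) < \<delta> \<longrightarrow>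
       (\<Sum>i<m. \<bar>f (b i) - f (a i)\<bar>) < \<epsilon>)"

definition pi_hat :: "real \<Rightarrow> real"
  where "pi_hat p = 2 * pi / (p * sin (pi / p))"

text \<open>Absolute continuity of the signed power of the derivative presupposes that the derivative
  \<open>v\<close> exists at every point of the closed unit interval (one-sidedly at the end points).\<close>

definition p_laplace_solution ::
  "real \<Rightarrow> (real \<Rightarrow> real) \<Rightarrow> real \<Rightarrow> (real \<Rightarrow> real) \<Rightarrow> bool"
  where "p_laplace_solution p q \<mu> y \<longleftrightarrow>
    abs_continuous_on 0 1 y \<and>
    (\<exists>v. (\<forall>x\<in>{0..1}. (y has_real_derivative v x) (at x within {0..1})) \<and>
         abs_continuous_on 0 1 (\<lambda>x. signed_powr (v x) (p - 1)) \<and>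
         (AE x in lebesgue. x \<in> {0<..<1} \<longrightarrow>
            (\<exists>d. ((\<lambda>t. signed_powr (v t) (p - 1)) has_real_derivative d) (at x) \<and>
                 - d = (p - 1) * (\<mu> - q x) * signed_powr (y x) (p - 1))))"

definition dirichlet_eigenfunction ::
  "real \<Rightarrow> (real \<Rightarrow> real) \<Rightarrow> real \<Rightarrow> (real \<Rightarrow> real) \<Rightarrow> bool"
  where "dirichlet_eigenfunction p q \<mu> y \<longleftrightarrow>
    p_laplace_solution p q \<mu> y \<and> y 0 = 0 \<and> y 1 = 0 \<and> (\<exists>x\<in>{0..1}. y x \<noteq> 0)"

text \<open>\<open>\<mu>\<close> is the \<open>n\<close>th eigenvalue, with associated eigenfunction \<open>y\<close>
  (meaningful for \<open>n \<ge> 1\<close>).\<close>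

definition nth_eigenpair ::
  "real \<Rightarrow> (real \<Rightarrow> real) \<Rightarrow> nat \<Rightarrow> real \<Rightarrow> (real \<Rightarrow> real) \<Rightarrow> bool"
  where "nth_eigenpair p q n \<mu> y \<longleftrightarrow>
    dirichlet_eigenfunction p q \<mu> y \<and>
    finite {x\<in>{0<..<1}. y x = 0} \<and> card {x\<in>{0<..<1}. y x = 0} = n - 1"

definition nodes :: "(real \<Rightarrow> real) \<Rightarrow> real list"
  where "nodes y = sorted_list_of_set {x\<in>{0..1}. y x = 0}"

definition nodal_length :: "(real \<Rightarrow> real) \<Rightarrow> nat \<Rightarrow> real"
  where "nodal_length y i = nodes y ! Suc i - nodes y ! i"

definition nodal_index :: "(real \<Rightarrow> real) \<Rightarrow> real \<Rightarrow> nat"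
  where "nodal_index y x = Max {i. i < length (nodes y) \<and> nodes y ! i \<le> x}"

definition nodal_approx ::
  "real \<Rightarrow> (real \<Rightarrow> real) \<Rightarrow> nat \<Rightarrow> (real \<Rightarrow> real) \<Rightarrow> real \<Rightarrow> real"
  where "nodal_approx p q n y x =
    p * (real n * pi_hat p) powr p * (real n * nodal_length y (nodal_index y x) - 1)
      + (LINT t:{0<..<1}|lebesgue. q t)"

end

theory Submission
  imports Defs
begin

text \<open>On a nodal interval the Riccati variable \<open>r = (y' / (k y))^(p-1)\<close> (signed power), with
  \<open>k = \<lambda>^(1/p)\<close>, runs from \<open>+\<infinity>\<close> to \<open>-\<infinity>\<close>, and \<open>W = 1 / (1 + \<bar>r\<bar>^(p/(p-1)))\<close> is the \<open>p\<close>-th power of the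
  generalised sine along the Pruefer angle. Integrating the derivative of the generalised arctangent of
  \<open>r\<close> gives the length of the interval as \<open>pi_hat p / k + k^(-p) \<integral> q W\<close>; integrating that of \<open>r W\<close> shows
  that \<open>W\<close> has mean close to \<open>1 / p\<close> on it. Hence \<open>p n \<integral> q W\<close> over the nodal interval containing \<open>x\<close>
  tends to \<open>q x\<close> at every Lebesgue point and in \<open>L\<^sup>1\<close>, which yields both the eigenvalue and the nodal
  asymptotics.\<close>

section \<open>Absolute continuity and the fundamental theorem of calculus\<close>

text \<open>Both expansions rest on exact identities. The nodal lengths add up to 1, so
  \<open>n pi_hat p / k = 1 - k^(-p) D\<close>, where \<open>D\<close> is the integral of
  \<open>q W\<close> over the unit interval. Eliminating \<open>k\<close> from the length of a nodal
  interval makes the approximating function equal to \<open>c (A - p D)\<close> plus the integral of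
  \<open>q\<close>, where \<open>A\<close> is the step function with value \<open>p n\<close> times
  the integral of \<open>q W\<close> over each cell and \<open>c = (n pi_hat p / k)^p\<close> tends
  to 1. What remains is real analysis: \<open>A\<close> tends to \<open>q\<close>. For this the
  integral of \<open>W\<close> over a cell of length about \<open>1/n\<close> must be known up to
  \<open>o(1/n)\<close>. After normalisation the integrand produced by \<open>r W\<close> is
  \<open>p W - 1\<close> times the one produced by the arctangent, and \<open>r W\<close> vanishes
  at both nodes; so the error is \<open>O(k^(-p))\<close>, and \<open>n k^(-p)\<close> tends to 0
  because \<open>p > 1\<close>. Since \<open>q\<close> is only integrable, the equation holds almost
  everywhere, \<open>r\<close> is handled by absolute continuity on compact pieces between nodes,
  and the averages converge without a rate.\<close>

lemma abs_continuous_on_finite_sum: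
  assumes "abs_continuous_on lo hi f" "\<epsilon> > 0"
  obtains \<delta> where "\<delta> > 0"
    "\<And>P l r. finite P \<Longrightarrow> (\<And>i. i \<in> P \<Longrightarrow> lo \<le> l i \<and> l i \<le> r i \<and> r i \<le> hi) \<Longrightarrow>
       disjoint_family_on (\<lambda>i. {l i<..<r i}) P \<Longrightarrow> (\<Sum>i\<in>P. r i - l i) < \<delta> \<Longrightarrow>
       (\<Sum>i\<in>P. \<bar>f (r i) - f (l i)\<bar>) < \<epsilon>"
proof -
  from assms obtain \<delta> where "\<delta> > 0" and \<delta>: "\<And>(m::nat) (a::nat \<Rightarrow> real) b.
       (\<forall>i<m. lo \<le> a i \<and> a i \<le> b i \<and> b i \<le> hi) \<Longrightarrow>
       disjoint_family_on (\<lambda>i. {a i<..<b i}) {..<m} \<Longrightarrow>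
       (\<Sum>i<m. b i - a i) < \<delta> \<Longrightarrow> (\<Sum>i<m. \<bar>f (b i) - f (a i)\<bar>) < \<epsilon>"
    unfolding abs_continuous_on_def by meson
  show ?thesis
  proof (rule that[OF \<open>\<delta> > 0\<close>])
    fix P :: "'a set" and l r
    assume P: "finite P" "\<And>i. i \<in> P \<Longrightarrow> lo \<le> l i \<and> l i \<le> r i \<and> r i \<le> hi"
      "disjoint_family_on (\<lambda>i. {l i<..<r i}) P" "(\<Sum>i\<in>P. r i - l i) < \<delta>"
    \<comment> \<open>The definition numbers the intervals, whereas a tagged division is a set of
      pairs; an enumeration of \<open>P\<close> connects the two.\<close>
    obtain h where h: "bij_betw h {..<card P} P"
      using ex_bij_betw_nat_finite[OF P(1)] by (auto simp: atLeast0LessThan)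
    have sum_h: "(\<Sum>i<card P. g (h i)) = (\<Sum>i\<in>P. g i)" for g :: "'a \<Rightarrow> real"
      by (rule sum.reindex_bij_betw[OF h])
    have "(\<Sum>i<card P. \<bar>f ((r \<circ> h) i) - f ((l \<circ> h) i)\<bar>) < \<epsilon>"
    proof (rule \<delta>)
      show "\<forall>i<card P. lo \<le> (l \<circ> h) i \<and> (l \<circ> h) i \<le> (r \<circ> h) i \<and> (r \<circ> h) i \<le> hi"
        using P(2) bij_betwE[OF h] by auto
      show "disjoint_family_on (\<lambda>i. {(l \<circ> h) i<..<(r \<circ> h) i}) {..<card P}"
        unfolding disjoint_family_on_def
      proof (intro ballI impI)
        fix i j assume "i \<in> {..<card P}" "j \<in> {..<card P}" "i \<noteq> j"
        then have "h i \<in> P" "h j \<in> P" "h i \<noteq> h j"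
          using h by (auto simp: bij_betw_def inj_on_def)
        then show "{(l \<circ> h) i<..<(r \<circ> h) i} \<inter> {(l \<circ> h) j<..<(r \<circ> h) j} = {}"
          using P(3) by (auto simp: disjoint_family_on_def)
      qed
      show "(\<Sum>i<card P. (r \<circ> h) i - (l \<circ> h) i) < \<delta>"
        using P(4) sum_h[of "\<lambda>i. r i - l i"] by simp
    qed
    then show "(\<Sum>i\<in>P. \<bar>f (r i) - f (l i)\<bar>) < \<epsilon>"
      using sum_h[of "\<lambda>i. \<bar>f (r i) - f (l i)\<bar>"] by simp
  qed
qed

lemma abs_continuous_on_subinterval:
  assumes "abs_continuous_on lo hi f" "lo \<le> lo'" "hi' \<le> hi"
  shows "abs_continuous_on lo' hi' f"
  unfolding abs_continuous_on_def
proof (intro allI impI)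
  fix \<epsilon> :: real assume "\<epsilon> > 0"
  then obtain \<delta> where "\<delta> > 0" and \<delta>: "\<forall>(m::nat) (a::nat \<Rightarrow> real) b.
       (\<forall>i<m. lo \<le> a i \<and> a i \<le> b i \<and> b i \<le> hi) \<longrightarrow>
       disjoint_family_on (\<lambda>i. {a i<..<b i}) {..<m} \<longrightarrow>
       (\<Sum>i<m. b i - a i) < \<delta> \<longrightarrow>
       (\<Sum>i<m. \<bar>f (b i) - f (a i)\<bar>) < \<epsilon>"
    using assms(1) unfolding abs_continuous_on_def by meson
  have "lo \<le> x \<and> x \<le> y \<and> y \<le> hi" if "lo' \<le> x \<and> x \<le> y \<and> y \<le> hi'" for x y
    using that assms by linarith
  with \<open>\<delta> > 0\<close> \<delta> show "\<exists>\<delta>>0. \<forall>(m::nat) (a::nat \<Rightarrow> real) b.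
       (\<forall>i<m. lo' \<le> a i \<and> a i \<le> b i \<and> b i \<le> hi') \<longrightarrow>
       disjoint_family_on (\<lambda>i. {a i<..<b i}) {..<m} \<longrightarrow>
       (\<Sum>i<m. b i - a i) < \<delta> \<longrightarrow>
       (\<Sum>i<m. \<bar>f (b i) - f (a i)\<bar>) < \<epsilon>"
    by blast
qed

lemma abs_continuous_on_imp_continuous_on:
  assumes "abs_continuous_on lo hi f"
  shows "continuous_on {lo..hi} f"
  unfolding continuous_on_iff
proof (intro ballI allI impI)
  fix x e :: real assume x: "x \<in> {lo..hi}" and "e > 0"
  obtain \<delta> where "\<delta> > 0" and \<delta>: "\<And>P l r. finite (P :: unit set) \<Longrightarrow>
       (\<And>i. i \<in> P \<Longrightarrow> lo \<le> l i \<and> l i \<le> r i \<and> r i \<le> hi) \<Longrightarrow>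
       disjoint_family_on (\<lambda>i. {l i<..<r i}) P \<Longrightarrow> (\<Sum>i\<in>P. r i - l i) < \<delta> \<Longrightarrow>
       (\<Sum>i\<in>P. \<bar>f (r i) - f (l i)\<bar>) < e"
    by (rule abs_continuous_on_finite_sum[OF assms \<open>e > 0\<close>, where 'a = unit]) blast
  have "dist (f z) (f x) < e" if "z \<in> {lo..hi}" "dist z x < \<delta>" for z
    using \<delta>[of "{()}" "\<lambda>_. min x z" "\<lambda>_. max x z"] that x
    by (cases "x \<le> z") (auto simp: disjoint_family_on_def dist_real_def min_def max_def)
  with \<open>\<delta> > 0\<close> show "\<exists>d>0. \<forall>x'\<in>{lo..hi}. dist x' x < d \<longrightarrow> dist (f x') (f x) < e"
    by blast
qed

text \<open>Absolute continuity is inherited through increments alone. This handles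
  \<open>G (riccati K x)\<close> in one stroke, without separate product, quotient and composition
  rules; taking \<open>\<delta>\<close> below \<open>e\<close> as well pays for the summand
  \<open>\<bar>t - s\<bar>\<close>.\<close>

lemma abs_continuous_on_dominated:
  assumes g: "abs_continuous_on lo hi g" and "C \<ge> 0"
    and le: "\<And>s t. s \<in> {lo..hi} \<Longrightarrow> t \<in> {lo..hi} \<Longrightarrow>
      \<bar>f t - f s\<bar> \<le> C * (\<bar>g t - g s\<bar> + \<bar>t - s\<bar>)"
  shows "abs_continuous_on lo hi f"
  unfolding abs_continuous_on_def
proof (intro allI impI)
  fix \<epsilon> :: real assume "\<epsilon> > 0"
  define e where "e = \<epsilon> / (2 * (C + 1))"
  have "e > 0" using \<open>\<epsilon> > 0\<close> \<open>C \<ge> 0\<close> by (simp add: e_def)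
  then obtain \<delta> where "\<delta> > 0" and \<delta>: "\<And>(m::nat) (a::nat \<Rightarrow> real) b.
       (\<forall>i<m. lo \<le> a i \<and> a i \<le> b i \<and> b i \<le> hi) \<Longrightarrow>
       disjoint_family_on (\<lambda>i. {a i<..<b i}) {..<m} \<Longrightarrow>
       (\<Sum>i<m. b i - a i) < \<delta> \<Longrightarrow> (\<Sum>i<m. \<bar>g (b i) - g (a i)\<bar>) < e"
    using g unfolding abs_continuous_on_def by meson
  show "\<exists>\<delta>>0. \<forall>(m::nat) (a::nat \<Rightarrow> real) b.
       (\<forall>i<m. lo \<le> a i \<and> a i \<le> b i \<and> b i \<le> hi) \<longrightarrow>
       disjoint_family_on (\<lambda>i. {a i<..<b i}) {..<m} \<longrightarrow>
       (\<Sum>i<m. b i - a i) < \<delta> \<longrightarrow> (\<Sum>i<m. \<bar>f (b i) - f (a i)\<bar>) < \<epsilon>"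
  proof (intro exI[of _ "min \<delta> e"] conjI allI impI)
    show "min \<delta> e > 0" using \<open>\<delta> > 0\<close> \<open>e > 0\<close> by simp
    fix m :: nat and a b :: "nat \<Rightarrow> real"
    assume ab: "\<forall>i<m. lo \<le> a i \<and> a i \<le> b i \<and> b i \<le> hi"
      and disj: "disjoint_family_on (\<lambda>i. {a i<..<b i}) {..<m}"
      and small: "(\<Sum>i<m. b i - a i) < min \<delta> e"
    have "(\<Sum>i<m. \<bar>f (b i) - f (a i)\<bar>) \<le> (\<Sum>i<m. C * (\<bar>g (b i) - g (a i)\<bar> + (b i - a i)))"
    proof (rule sum_mono)
      fix i assume "i \<in> {..<m}"
      then have "lo \<le> a i" "a i \<le> b i" "b i \<le> hi" using ab by auto
      then show "\<bar>f (b i) - f (a i)\<bar> \<le> C * (\<bar>g (b i) - g (a i)\<bar> + (b i - a i))"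
        using le[of "a i" "b i"] by auto
    qed
    also have "\<dots> = C * ((\<Sum>i<m. \<bar>g (b i) - g (a i)\<bar>) + (\<Sum>i<m. b i - a i))"
      by (simp flip: sum_distrib_left sum.distrib)
    also have "\<dots> \<le> C * (e + e)"
      using \<delta>[OF ab disj] small \<open>C \<ge> 0\<close> by (intro mult_left_mono add_mono) auto
    also have "\<dots> < \<epsilon>"
      using \<open>\<epsilon> > 0\<close> \<open>C \<ge> 0\<close> unfolding e_def by (simp add: divide_simps)
    finally show "(\<Sum>i<m. \<bar>f (b i) - f (a i)\<bar>) < \<epsilon>" .
  qed
qed

text \<open>Outer regularity, phrased with \<open>measure\<close> so that the total length of
  disjoint intervals inside \<open>U\<close> can be compared with the \<open>\<delta>\<close> of
  absolute continuity.\<close>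

lemma negligible_open_superset:
  fixes N :: "'a::euclidean_space set"
  assumes "negligible N" "\<delta> > 0"
  obtains U where "open U" "N \<subseteq> U" "U \<in> lmeasurable" "measure lebesgue U < \<delta>"
proof -
  have N: "N \<in> sets lebesgue" "emeasure lebesgue N = 0"
    using assms(1) by (auto simp: negligible_iff_null_sets)
  obtain U where U: "open U" "N \<subseteq> U" "U - N \<in> lmeasurable"
    "emeasure lebesgue (U - N) < ennreal \<delta>"
    using sets_lebesgue_outer_open[OF N(1) assms(2)] by metis
  have "measure lebesgue (U - N) < \<delta>"
    using U(3,4) assms(2) by (simp add: emeasure_eq_measure2 ennreal_less_iff)
  moreover have "U \<in> lmeasurable" "measure lebesgue U = measure lebesgue (U - N)"
    using measure_negligible_symdiff[of "U - N" U] U(2,3) assms(1)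
      lmeasurable_negligible_symdiff[of "U - N" U]
    by (auto simp: double_diff Un_absorb2)
  ultimately show ?thesis using that U by auto
qed

text \<open>Henstock gauge: tags in the exceptional set contribute little by absolute continuity, because
  their intervals lie in an open set of small measure; for the other tags one uses the derivative.\<close>

theorem abs_continuous_on_has_integral:
  assumes "a \<le> b" and ac: "abs_continuous_on a b f" and N: "negligible N"
    and deriv: "\<And>x. x \<in> {a..b} - N \<Longrightarrow> (f has_real_derivative g x) (at x within {a..b})"
  shows "(g has_integral (f b - f a)) {a..b}"
proof -
  \<comment> \<open>Zeroing the derivative on \<open>N\<close> kills the Riemann-sum term at
    exceptional tags and leaves only the increment of \<open>f\<close> there; the values of
    \<open>g\<close> on the negligible set are restored at the end.\<close>
  define h where "h x = (if x \<in> N then 0 else g x)" for x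
  have "(h has_integral (f b - f a)) {a..b}"
    unfolding has_integral_real
  proof (intro allI impI)
    fix e :: real assume "e > 0"
    \<comment> \<open>An error of \<open>e1\<close> per unit length adds up to at most
      \<open>e / 2\<close> over \<open>{a..b}\<close>; the \<open>+ 1\<close> covers the case
      \<open>a = b\<close>.\<close>
    define e1 where "e1 = e / (2 * (b - a + 1))"
    have "e1 > 0" using \<open>e > 0\<close> \<open>a \<le> b\<close> by (simp add: e1_def)
    have "\<exists>d>0. \<forall>t\<in>{a..b}. \<bar>t - x\<bar> < d \<longrightarrow> \<bar>f t - f x - g x * (t - x)\<bar> \<le> e1 * \<bar>t - x\<bar>"
      if "x \<in> {a..b} - N" for x
      using deriv[OF that] \<open>e1 > 0\<close>
      unfolding has_field_derivative_def has_derivative_within_alt by (auto simp: mult.commute)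
    then obtain d where d: "\<And>x. x \<in> {a..b} - N \<Longrightarrow> d x > 0"
      "\<And>x t. x \<in> {a..b} - N \<Longrightarrow> t \<in> {a..b} \<Longrightarrow> \<bar>t - x\<bar> < d x \<Longrightarrow>
        \<bar>f t - f x - g x * (t - x)\<bar> \<le> e1 * \<bar>t - x\<bar>"
      by metis
    have "e / 2 > 0" using \<open>e > 0\<close> by simp
    then obtain \<delta> where "\<delta> > 0" and \<delta>: "\<And>P l r. finite (P :: (real \<times> real set) set) \<Longrightarrow>
       (\<And>i. i \<in> P \<Longrightarrow> a \<le> l i \<and> l i \<le> r i \<and> r i \<le> b) \<Longrightarrow>
       disjoint_family_on (\<lambda>i. {l i<..<r i}) P \<Longrightarrow> (\<Sum>i\<in>P. r i - l i) < \<delta> \<Longrightarrow>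
       (\<Sum>i\<in>P. \<bar>f (r i) - f (l i)\<bar>) < e / 2"
      by (rule abs_continuous_on_finite_sum[OF ac, where 'a = "real \<times> real set"]) blast
    obtain U where U: "open U" "N \<subseteq> U" "U \<in> lmeasurable" "measure lebesgue U < \<delta>"
      using negligible_open_superset[OF N \<open>\<delta> > 0\<close>] by metis
    define D where "D x = (if x \<in> N then U else if x \<in> {a..b} then ball x (d x) else ball x 1)" for x
    have "gauge D"
      unfolding gauge_def D_def using U d(1) by auto
    moreover have "norm ((\<Sum>(x, k)\<in>T. measure lborel k *\<^sub>R h x) - (f b - f a)) < e"
      if T: "T tagged_division_of {a..b}" and fine: "D fine T" for T
    proof -
      have fin: "finite T" using tagged_division_ofD(1)[OF T] .
      have k: "\<exists>u v. k = {u..v} \<and> a \<le> u \<and> u \<le> v \<and> v \<le> b \<and> x \<in> {u..v} \<and> {u..v} \<subseteq> D x"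
        if xk: "(x, k) \<in> T" for x k
      proof -
        have "x \<in> k" "k \<subseteq> {a..b}"
          using tagged_division_ofD(2,3)[OF T that] by auto
        moreover have "k \<subseteq> D x" using fineD[OF fine that] .
        moreover obtain u v where "k = {u..v}"
          using tagged_division_ofD(4)[OF T xk] by auto
        ultimately show ?thesis by (intro exI[of _ u] exI[of _ v]) auto
      qed
      define r where "r z = f (Sup (snd z)) - f (Inf (snd z))" for z :: "real \<times> real set"
      define c where "c z = measure lborel (snd z) * h (fst z)" for z :: "real \<times> real set"
      have "(\<Sum>(x, k)\<in>T. measure lborel k *\<^sub>R h x) = sum c T"
        by (simp add: c_def case_prod_unfold)
      moreover have "f b - f a = sum r T"
        using additive_tagged_division_1[OF \<open>a \<le> b\<close> T, of f] by (simp add: r_def case_prod_unfold)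
      ultimately have "(\<Sum>(x, k)\<in>T. measure lborel k *\<^sub>R h x) - (f b - f a) = (\<Sum>z\<in>T. c z - r z)"
        by (simp add: sum_subtractf)
      also have "\<bar>\<dots>\<bar> \<le> (\<Sum>z\<in>T. \<bar>c z - r z\<bar>)" by (rule sum_abs)
      also have "\<dots> = (\<Sum>z\<in>{z \<in> T. fst z \<in> N}. \<bar>c z - r z\<bar>) + (\<Sum>z\<in>{z \<in> T. fst z \<notin> N}. \<bar>c z - r z\<bar>)"
        using fin by (subst sum.union_disjoint[symmetric]) (auto intro!: sum.cong)
      also have "(\<Sum>z\<in>{z \<in> T. fst z \<in> N}. \<bar>c z - r z\<bar>)
          = (\<Sum>z\<in>{z \<in> T. fst z \<in> N}. \<bar>f (Sup (snd z)) - f (Inf (snd z))\<bar>)"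
        by (intro sum.cong) (auto simp: c_def r_def h_def)
      also have "\<dots> < e / 2"
      proof (rule \<delta>)
        let ?P = "{z \<in> T. fst z \<in> N}" and ?I = "\<lambda>z. {Inf (snd z)<..<Sup (snd z)}"
        show "finite ?P" using fin by simp
        show "a \<le> Inf (snd z) \<and> Inf (snd z) \<le> Sup (snd z) \<and> Sup (snd z) \<le> b" if "z \<in> ?P" for z
          using k[of "fst z" "snd z"] that by auto
        have int: "?I z = interior (snd z)" if "z \<in> T" for z
          using k[of "fst z" "snd z"] that by (auto simp: interior_atLeastAtMost_real)
        show disj: "disjoint_family_on ?I ?P"
          unfolding disjoint_family_on_def
        proof (intro ballI impI)
          fix z z' assume z: "z \<in> ?P" "z' \<in> ?P" "z \<noteq> z'"
          then have "interior (snd z) \<inter> interior (snd z') = {}"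
            using tagged_division_ofD(5)[OF T, of "fst z" "snd z" "fst z'" "snd z'"] by auto
          then show "?I z \<inter> ?I z' = {}" using int z by auto
        qed
        have "(\<Sum>z\<in>?P. Sup (snd z) - Inf (snd z)) = (\<Sum>z\<in>?P. measure lebesgue (?I z))"
          using k by (intro sum.cong) fastforce+
        also have "\<dots> = measure lebesgue (\<Union>z\<in>?P. ?I z)"
          using fin disj emeasure_lborel_box_finite[where 'a = real, unfolded box_real]
          by (intro measure_finite_Union[symmetric]) (auto simp: less_top[symmetric])
        also have "\<dots> \<le> measure lebesgue U"
        proof (rule measure_mono_fmeasurable)
          show "(\<Union>z\<in>?P. ?I z) \<subseteq> U"
            using k unfolding D_def by fastforce
        qed (use U fin in auto)
        finally show "(\<Sum>z\<in>?P. Sup (snd z) - Inf (snd z)) < \<delta>" using U by simp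
      qed
      also have "(\<Sum>z\<in>{z \<in> T. fst z \<notin> N}. \<bar>c z - r z\<bar>) \<le> (\<Sum>z\<in>{z \<in> T. fst z \<notin> N}. e1 * measure lborel (snd z))"
      proof (rule sum_mono)
        fix z assume z: "z \<in> {z \<in> T. fst z \<notin> N}"
        define x where "x = fst z"
        from z k[of "fst z" "snd z"] obtain u v where uv: "snd z = {u..v}" "a \<le> u" "u \<le> v" "v \<le> b"
          "x \<in> {u..v}" "{u..v} \<subseteq> D x" by (auto simp: x_def)
        have x: "x \<in> {a..b} - N" using z uv by (auto simp: x_def)
        then have "{u..v} \<subseteq> ball x (d x)" using uv by (auto simp: D_def)
        moreover have "u \<in> {u..v}" "v \<in> {u..v}" using uv by auto
        ultimately have "u \<in> ball x (d x)" "v \<in> ball x (d x)" by blast+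
        then have "\<bar>u - x\<bar> < d x" "\<bar>v - x\<bar> < d x" by (auto simp: dist_real_def)
        then have 1: "\<bar>f u - f x - g x * (u - x)\<bar> \<le> e1 * \<bar>u - x\<bar>" "\<bar>f v - f x - g x * (v - x)\<bar> \<le> e1 * \<bar>v - x\<bar>"
          using d(2)[OF x, of u] d(2)[OF x, of v] uv by simp_all
        \<comment> \<open>Straddling: both end points are compared with the tag, which lies between
          them, so the two distances add up to the length of the interval.\<close>
        have "c z - r z = (f u - f x - g x * (u - x)) - (f v - f x - g x * (v - x))"
          using z uv by (simp add: c_def r_def h_def x_def algebra_simps)
        then have "\<bar>c z - r z\<bar> \<le> e1 * \<bar>u - x\<bar> + e1 * \<bar>v - x\<bar>" using 1 by linarith
        also have "\<dots> = e1 * measure lborel (snd z)"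
          using uv by (simp add: algebra_simps)
        finally show "\<bar>c z - r z\<bar> \<le> e1 * measure lborel (snd z)" .
      qed
      also have "\<dots> \<le> (\<Sum>z\<in>T. e1 * measure lborel (snd z))"
        using fin \<open>e1 > 0\<close> by (intro sum_mono2) auto
      also have "\<dots> = e1 * (b - a)"
        using additive_content_tagged_division[of T a b] T \<open>a \<le> b\<close>
        unfolding sum_distrib_left[symmetric] by (simp add: case_prod_unfold)
      also have "\<dots> \<le> e / 2"
        using \<open>e > 0\<close> \<open>a \<le> b\<close> by (simp add: e1_def field_simps)
      finally show ?thesis by simp
    qed
    ultimately show "\<exists>\<gamma>. gauge \<gamma> \<and> (\<forall>D. D tagged_division_of {a..b} \<and> \<gamma> fine D \<longrightarrow>
        norm ((\<Sum>(x, k)\<in>D. measure lborel k *\<^sub>R h x) - (f b - f a)) < e)"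
      by (intro exI[of _ D] conjI allI impI) (simp_all only:)
  qed
  moreover have "g x = h x" if "x \<in> {a..b} - N" for x
    using that by (simp add: h_def)
  ultimately show ?thesis
    using has_integral_spike[OF N] by metis
qed

section \<open>Signed powers and the generalised arctangent\<close>

lemma signed_powr_0 [simp]: "signed_powr 0 r = 0"
  by (simp add: signed_powr_def)

lemma signed_powr_eq_0_iff [simp]: "signed_powr u r = 0 \<longleftrightarrow> u = 0"
  by (simp add: signed_powr_def sgn_if)

lemma abs_signed_powr: "\<bar>signed_powr u r\<bar> = \<bar>u\<bar> powr r"
  by (simp add: signed_powr_def abs_mult sgn_if)

lemma signed_powr_pos: "u > 0 \<Longrightarrow> signed_powr u r = u powr r"
  by (simp add: signed_powr_def)

lemma sgn_signed_powr: "sgn (signed_powr u r) = sgn u"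
  by (simp add: signed_powr_def sgn_mult) (simp add: sgn_if)

lemma signed_powr_signed_powr_inverse:
  assumes "r \<noteq> 0" shows "signed_powr (signed_powr u r) (1 / r) = u"
  using assms unfolding signed_powr_def[of "signed_powr u r"] abs_signed_powr sgn_signed_powr
  by (simp add: powr_powr abs_mult_sgn)

lemma mult_signed_powr: "u * signed_powr u r = \<bar>u\<bar> powr (r + 1)"
  by (cases "u = 0") (auto simp: signed_powr_def powr_add sgn_if)

lemma continuous_on_signed_powr [continuous_intros]:
  assumes "r > 0" "continuous_on S f" shows "continuous_on S (\<lambda>x. signed_powr (f x) r)"
proof -
  have *: "(\<lambda>x. signed_powr (f x) r) = (\<lambda>x. max (f x) 0 powr r - max (- f x) 0 powr r)"
    using assms(1) by (auto simp: signed_powr_def fun_eq_iff max_def sgn_if)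
  show ?thesis
    unfolding * using assms by (intro continuous_intros continuous_on_powr') auto
qed

lemma has_real_derivative_signed_powr:
  assumes "u \<noteq> 0"
  shows "((\<lambda>u. signed_powr u r) has_real_derivative r * \<bar>u\<bar> powr (r - 1)) (at u)"
proof (cases "u > 0")
  case True
  have "((\<lambda>u. u powr r) has_real_derivative r * \<bar>u\<bar> powr (r - 1)) (at u)"
    using True by (auto intro!: derivative_eq_intros)
  then show ?thesis
    by (rule has_field_derivative_transform_within_open[where S = "{0<..}"])
      (use True in \<open>auto simp: signed_powr_def\<close>)
next
  case False
  have "((\<lambda>u. - ((- u) powr r)) has_real_derivative r * \<bar>u\<bar> powr (r - 1)) (at u)"
    using False assms by (auto intro!: derivative_eq_intros)
  then show ?thesis
    by (rule has_field_derivative_transform_within_open[where S = "{..<0}"])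
      (use False assms in \<open>auto simp: signed_powr_def\<close>)
qed

text \<open>The point 0 is the delicate one and is where \<open>s > 1\<close> enters. It cannot be
  avoided, since the Riccati variable passes through 0 inside every nodal interval.\<close>

lemma has_real_derivative_abs_powr:
  assumes "s > 1"
  shows "((\<lambda>u. \<bar>u\<bar> powr s) has_real_derivative s * signed_powr u (s - 1)) (at u)"
proof (cases u "0::real" rule: linorder_cases)
  case greater
  have "((\<lambda>u. u powr s) has_real_derivative s * signed_powr u (s - 1)) (at u)"
    using greater by (auto intro!: derivative_eq_intros simp: signed_powr_def)
  then show ?thesis
    by (rule has_field_derivative_transform_within_open[where S = "{0<..}"])
      (use greater in \<open>auto simp: signed_powr_def\<close>)
next
  case less
  have "((\<lambda>u. (- u) powr s) has_real_derivative s * signed_powr u (s - 1)) (at u)"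
    using less by (auto intro!: derivative_eq_intros simp: signed_powr_def)
  then show ?thesis
    by (rule has_field_derivative_transform_within_open[where S = "{..<0}"])
      (use less in \<open>auto simp: signed_powr_def\<close>)
next
  case equal
  have "((\<lambda>h. \<bar>h\<bar> powr (s - 1)) \<longlongrightarrow> \<bar>0::real\<bar> powr (s - 1)) (at 0)"
    using assms by (intro tendsto_intros) auto
  then have "((\<lambda>h. \<bar>h\<bar> powr (s - 1)) \<longlongrightarrow> (0::real)) (at 0)" by simp
  then have "((\<lambda>h. \<bar>h\<bar> powr s / h) \<longlongrightarrow> (0::real)) (at 0)"
    by (rule Lim_null_comparison[rotated])
      (auto simp: eventually_at_filter powr_diff abs_mult field_simps)
  then show ?thesis using equal by (simp add: has_field_derivative_iff)
qed

text \<open>The Beta function at \<open>a\<close>, \<open>1 - a\<close> is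
  \<open>Gamma a * Gamma (1 - a)\<close> over \<open>Gamma 1 = 1\<close>; Euler's reflection formula
  is taken over the complex numbers and pulled back.\<close>

lemma Beta_reflection:
  assumes "0 < a" "a < 1"
  shows "Beta a (1 - a) = pi / sin (pi * a :: real)"
proof -
  have "complex_of_real (Gamma a * Gamma (1 - a)) = Gamma (of_real a) * Gamma (1 - of_real a)"
    by (simp flip: Gamma_complex_of_real)
  also have "\<dots> = of_real (pi / sin (pi * a))"
    by (simp add: Gamma_reflection_complex sin_of_real flip: of_real_mult)
  finally show ?thesis
    by (simp add: Beta_def of_real_eq_iff del: of_real_mult of_real_divide)
qed

text \<open>Substituting \<open>t = u\<^sup>s / (1 + u\<^sup>s)\<close> in the incomplete Beta integral gives \<open>s F\<close>.\<close>

lemma generalised_arctan: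
  assumes s: "s > 1"
  obtains F where "\<And>u. (F has_real_derivative 1 / (1 + \<bar>u\<bar> powr s)) (at u)"
    "(F \<longlongrightarrow> pi / s / sin (pi / s)) at_top" "(F \<longlongrightarrow> - (pi / s / sin (pi / s))) at_bot"
proof -
  define g where "g u = 1 / (1 + \<bar>u\<bar> powr s)" for u :: real
  have g_cont: "isCont g u" for u
    unfolding g_def using s by (intro continuous_intros) (auto simp: add_nonneg_eq_0_iff)
  obtain F0 where F0: "\<And>x. (F0 has_real_derivative g x) (at x)"
    using einterval_antiderivative[of "-\<infinity>" \<infinity> g] g_cont
    by (auto simp: has_real_derivative_iff_has_vector_derivative)
  define F where "F u = F0 u - F0 0" for u
  have F: "(F has_real_derivative g x) (at x)" for x
    unfolding F_def by (auto intro!: derivative_eq_intros F0)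
  have [simp]: "F 0 = 0" by (simp add: F_def)
  \<comment> \<open>Oddness transfers the limit at \<open>at_top\<close> to \<open>at_bot\<close>,
    so the substitution is carried out for positive arguments only.\<close>
  have F_odd: "F (- u) = - F u" for u
  proof -
    have "((\<lambda>u. F u + F (- u)) has_real_derivative 0) (at x)" for x
      by (rule derivative_eq_intros F DERIV_chain2[OF F] refl)+ (simp add: g_def)
    from DERIV_isconst_all[of "\<lambda>u. F u + F (- u)" u 0] this show ?thesis by simp
  qed
  \<comment> \<open>Beta integrand with parameters \<open>1 / s\<close> and
    \<open>1 - 1 / s\<close>. Both exponents are negative, so \<open>J\<close> is differentiated
    only inside \<open>{0..1}\<close> and is merely continuous up to the ends.\<close>
  define f where "f t = t powr (1 / s - 1) * (1 - t) powr ((1 - 1 / s) - 1)" for t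
  have ab: "1 / s > 0" "1 - 1 / s > 0" using s by auto
  have f_int: "f integrable_on {0..1}"
    unfolding f_def using integrable_Beta'[OF ab] .
  define J where "J t = integral {0..t} f" for t
  have J_cont: "continuous_on {0..1} J"
    unfolding J_def using f_int by (rule indefinite_integral_continuous_1)
  have J1: "J 1 = s * (pi / s / sin (pi / s))"
    using has_integral_Beta_real[OF ab] Beta_reflection[OF ab(1)] s
    unfolding J_def f_def by (simp add: integral_unique)
  have J_deriv: "(J has_real_derivative f t) (at t)" if "0 < t" "t < 1" for t
  proof -
    have cont: "isCont f t" unfolding f_def using that by (intro continuous_intros) auto
    have "(J has_vector_derivative f t) (at t within {0..1} - {})"
      unfolding J_def
      by (rule integral_has_vector_derivative_continuous_at[OF f_int])
        (use that continuous_at_imp_continuous_at_within[OF cont] in simp_all)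
    then have "(J has_real_derivative f t) (at t within {0..1})"
      by (simp only: Diff_empty has_real_derivative_iff_has_vector_derivative)
    then show ?thesis
      by (simp only: at_within_Icc_at[OF that])
  qed
  define \<tau> where "\<tau> u = u powr s / (1 + u powr s)" for u :: real
  have \<tau>_deriv: "(\<tau> has_real_derivative s * u powr (s - 1) / (1 + u powr s)\<^sup>2) (at u)" if "u > 0" for u
  proof -
    have "1 + u powr s \<noteq> 0" by (simp add: add_nonneg_eq_0_iff)
    then show ?thesis unfolding \<tau>_def using that
      by (auto intro!: derivative_eq_intros simp: field_simps power2_eq_square)
  qed
  have \<tau>_range: "0 < \<tau> u" "\<tau> u < 1" if "u > 0" for u
    using that by (auto simp: \<tau>_def field_simps add_pos_pos)
  have F_eq: "s * F u = J (\<tau> u)" if u: "u > 0" for u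
  proof -
    \<comment> \<open>\<open>D\<close> vanishes at 0 and has zero derivative for positive arguments;
      continuity at 0 bridges the singularity of \<open>f\<close>.\<close>
    define D where "D x = s * F x - J (\<tau> x)" for x
    have "D u = D 0"
    proof (rule DERIV_isconst_end[of 0 u D])
      have "continuous_on {0..u} F"
        using F by (auto intro: DERIV_isCont continuous_at_imp_continuous_on)
      moreover have "continuous_on {0..u} (\<lambda>x. J (\<tau> x))"
      proof (rule continuous_on_compose2[OF J_cont])
        show "continuous_on {0..u} \<tau>"
          unfolding \<tau>_def using s
          by (intro continuous_intros continuous_on_powr') (auto simp: add_nonneg_eq_0_iff)
        show "\<tau> ` {0..u} \<subseteq> {0..1}"
          using \<tau>_range by (force simp: \<tau>_def le_less)
      qed
      ultimately show "continuous_on {0..u} D"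
        unfolding D_def by (intro continuous_intros)
      fix x assume x: "0 < x" "x < u"
      \<comment> \<open>Here \<open>\<tau> x = x powr s / T\<close> and
        \<open>1 - \<tau> x = 1 / T\<close>. The powers of \<open>T\<close> in
        \<open>f (\<tau> x)\<close> multiply to \<open>T\<close>, and against the factor
        \<open>1 / T\<^sup>2\<close> of the derivative of \<open>\<tau>\<close> exactly
        \<open>1 / T = g x\<close> survives.\<close>
      define T where "T = 1 + x powr s"
      have T: "T > 0" by (simp add: T_def add_pos_nonneg)
      have "1 - \<tau> x = T powr (- 1)" using T by (simp add: \<tau>_def T_def powr_minus field_simps)
      then have "(1 - \<tau> x) powr (- 1 / s) = T powr (1 / s)"
        by (simp only: powr_powr) simp
      moreover have "\<tau> x powr (1 / s - 1) = x powr (1 - s) * T powr (1 - 1 / s)"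
      proof -
        have "\<tau> x = x powr s * T powr (- 1)" using T by (simp add: \<tau>_def T_def powr_minus field_simps)
        then have "\<tau> x powr (1 / s - 1) = (x powr s) powr (1 / s - 1) * (T powr (- 1)) powr (1 / s - 1)"
          by (simp only: powr_mult powr_ge_zero)
        moreover have "s * (1 / s - 1) = 1 - s" using s by (simp add: field_simps)
        ultimately show ?thesis by (simp only: powr_powr) simp
      qed
      ultimately have "f (\<tau> x) = x powr (1 - s) * (T powr (1 - 1 / s) * T powr (1 / s))"
        by (simp add: f_def)
      also have "\<dots> = x powr (1 - s) * T"
        using T by (simp flip: powr_add)
      finally have "f (\<tau> x) * (s * x powr (s - 1) / T\<^sup>2) = s * (x powr (1 - s) * x powr (s - 1)) / T"
        using T by (simp add: power2_eq_square field_simps)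
      also have "\<dots> = s * g x"
        using x by (simp add: g_def T_def flip: powr_add)
      finally have eq: "f (\<tau> x) * (s * x powr (s - 1) / T\<^sup>2) = s * g x" .
      have "((\<lambda>x. J (\<tau> x)) has_real_derivative f (\<tau> x) * (s * x powr (s - 1) / T\<^sup>2)) (at x)"
        using x \<tau>_range unfolding T_def by (intro DERIV_chain2[OF J_deriv] \<tau>_deriv) auto
      then show "(D has_real_derivative 0) (at x)"
        unfolding D_def eq by (auto intro!: derivative_eq_intros F)
    qed (use u in simp)
    then show ?thesis using s by (simp add: D_def \<tau>_def J_def)
  qed
  have "((\<lambda>u. J (\<tau> u)) \<longlongrightarrow> J 1) at_top"
  proof (rule continuous_on_tendsto_compose[OF J_cont])
    have "filterlim (\<lambda>u::real. 1 + u powr s) at_top at_top"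
      using s by (intro filterlim_tendsto_add_at_top[OF tendsto_const] real_powr_at_top) auto
    then have "((\<lambda>u::real. 1 - inverse (1 + u powr s)) \<longlongrightarrow> 1 - 0) at_top"
      by (intro tendsto_diff tendsto_const tendsto_inverse_0_at_top)
    moreover have "1 - inverse (1 + u powr s) = \<tau> u" for u
    proof -
      have "1 + u powr s \<noteq> 0" by (simp add: add_nonneg_eq_0_iff)
      then show ?thesis by (simp add: \<tau>_def field_simps)
    qed
    ultimately show "(\<tau> \<longlongrightarrow> 1) at_top" by simp
    show "\<forall>\<^sub>F u in at_top. \<tau> u \<in> {0..1}"
      using eventually_gt_at_top[of 0] by eventually_elim (use \<tau>_range in \<open>auto simp: less_imp_le\<close>)
  qed simp
  then have "((\<lambda>u. J (\<tau> u) / s) \<longlongrightarrow> J 1 / s) at_top"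
    by (intro tendsto_divide tendsto_const) (use s in auto)
  then have "((\<lambda>u. J (\<tau> u) / s) \<longlongrightarrow> pi / s / sin (pi / s)) at_top"
    using s by (simp add: J1 mult.commute)
  moreover have "\<forall>\<^sub>F u in at_top. J (\<tau> u) / s = F u"
    using eventually_gt_at_top[of 0] by eventually_elim (use s in \<open>simp flip: F_eq\<close>)
  ultimately have top: "(F \<longlongrightarrow> pi / s / sin (pi / s)) at_top"
    by (rule Lim_transform_eventually)
  have "((\<lambda>u. - F (- u)) \<longlongrightarrow> - (pi / s / sin (pi / s))) at_bot"
    by (intro tendsto_minus filterlim_compose[OF top] filterlim_uminus_at_top_at_bot)
  then have "(F \<longlongrightarrow> - (pi / s / sin (pi / s))) at_bot"
    by (simp add: F_odd)
  with F top show ?thesis using that unfolding g_def by blast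
qed

text \<open>This is \<open>r W\<close> as a function of \<open>r\<close>. Its equal limits make the
  transported integral 0, and for \<open>s = p / (p - 1)\<close> its derivative times
  \<open>p - 1\<close> is \<open>(p W - 1) W\<close>: this factor is the source of the mean
  \<open>1 / p\<close>.\<close>

lemma rational_bump:
  fixes s :: real
  assumes "s > 1"
  defines "N \<equiv> \<lambda>u. u / (1 + \<bar>u\<bar> powr s)"
  shows "(N has_real_derivative (1 - (s - 1) * \<bar>u\<bar> powr s) / (1 + \<bar>u\<bar> powr s)\<^sup>2) (at u)"
    and "(N \<longlongrightarrow> 0) at_top" and "(N \<longlongrightarrow> 0) at_bot"
proof -
  have pos: "1 + \<bar>u\<bar> powr s > 0" for u :: real by (simp add: add_pos_nonneg)
  have "(N has_real_derivative ((1 + \<bar>u\<bar> powr s) - u * (s * signed_powr u (s - 1))) / (1 + \<bar>u\<bar> powr s)\<^sup>2) (at u)"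
    unfolding N_def using pos[of u]
    by (intro DERIV_cong[OF DERIV_divide[OF DERIV_ident
          DERIV_add[OF DERIV_const has_real_derivative_abs_powr[OF assms(1)]]]])
      (auto simp: power2_eq_square)
  moreover have "u * (s * signed_powr u (s - 1)) = s * \<bar>u\<bar> powr s"
    using mult_signed_powr[of u "s - 1"] by (simp add: mult.left_commute[of u])
  ultimately have "(N has_real_derivative (1 + \<bar>u\<bar> powr s - s * \<bar>u\<bar> powr s) / (1 + \<bar>u\<bar> powr s)\<^sup>2) (at u)"
    by (simp only:)
  then show "(N has_real_derivative (1 - (s - 1) * \<bar>u\<bar> powr s) / (1 + \<bar>u\<bar> powr s)\<^sup>2) (at u)"
    by (simp add: algebra_simps)
  have le: "norm (N u) \<le> \<bar>u\<bar> powr (1 - s)" if "u \<noteq> 0" for u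
  proof -
    have "\<bar>u\<bar> = \<bar>u\<bar> powr (1 - s) * \<bar>u\<bar> powr s"
      using that by (simp flip: powr_add)
    also have "\<dots> \<le> \<bar>u\<bar> powr (1 - s) * (1 + \<bar>u\<bar> powr s)"
      by (intro mult_left_mono) auto
    finally show ?thesis using pos[of u] by (simp add: N_def field_simps)
  qed
  have lim: "((\<lambda>u::real. \<bar>u\<bar> powr (1 - s)) \<longlongrightarrow> 0) F" if "filterlim abs at_top F" for F
    using assms(1) by (intro tendsto_neg_powr that) auto
  show "(N \<longlongrightarrow> 0) at_top"
  proof (rule Lim_null_comparison)
    show "\<forall>\<^sub>F u in at_top. norm (N u) \<le> \<bar>u\<bar> powr (1 - s)"
      using eventually_gt_at_top[of 0] by eventually_elim (rule le, simp)
  qed (intro lim filterlim_abs_real)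
  have "filterlim (\<lambda>u. - u :: real) at_top at_bot"
    by (rule filterlim_uminus_at_top_at_bot)
  then have "filterlim (\<lambda>u. \<bar>- u\<bar> :: real) at_top at_bot"
    by (rule filterlim_compose[OF filterlim_abs_real])
  then have abs_bot: "filterlim (abs :: real \<Rightarrow> real) at_top at_bot" by simp
  show "(N \<longlongrightarrow> 0) at_bot"
  proof (rule Lim_null_comparison)
    show "\<forall>\<^sub>F u in at_bot. norm (N u) \<le> \<bar>u\<bar> powr (1 - s)"
      using eventually_gt_at_bot[of 0] by eventually_elim (rule le, simp)
  qed (intro lim abs_bot)
qed

section \<open>The Riccati variable on a nodal interval\<close>

text \<open>First-order form of the equation: \<open>w\<close> stands for the signed power of
  \<open>y'\<close>. The first equation then holds at every point, and the lack of regularity of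
  \<open>q\<close> is confined to the set \<open>N\<close> where the second may fail.\<close>

locale p_laplace_system =
  fixes p :: real and q :: "real \<Rightarrow> real" and \<mu> :: real and y w :: "real \<Rightarrow> real" and N :: "real set"
  assumes p: "p > 1"
    and q: "q absolutely_integrable_on {0..1}"
    and y_deriv: "\<And>x. x \<in> {0..1} \<Longrightarrow>
      (y has_real_derivative signed_powr (w x) (1 / (p - 1))) (at x within {0..1})"
    and w_ac: "abs_continuous_on 0 1 w"
    and N: "negligible N"
    and w_deriv: "\<And>x. x \<in> {0..1} - N \<Longrightarrow>
      (w has_real_derivative - ((p - 1) * (\<mu> - q x) * signed_powr (y x) (p - 1))) (at x within {0..1})"
begin

text \<open>Hoelder conjugate of \<open>p\<close>: \<open>\<bar>w\<bar> powr conj_exp\<close> is the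
  \<open>p\<close>-th power of \<open>\<bar>y'\<bar>\<close>.\<close>

definition conj_exp :: real where "conj_exp = p / (p - 1)"

lemma conj_exp_gt_1: "conj_exp > 1"
  using p by (simp add: conj_exp_def field_simps)

lemma w_continuous: "continuous_on {0..1} w"
  by (rule abs_continuous_on_imp_continuous_on[OF w_ac])

lemma y_continuous: "continuous_on {0..1} y"
  unfolding continuous_on_eq_continuous_within using y_deriv DERIV_continuous by blast

lemma q_subinterval: "q absolutely_integrable_on {a..b}" if "0 \<le> a" "b \<le> 1"
  by (rule absolutely_integrable_on_subinterval[OF q]) (use that in auto)

lemma potential_integrable: "(\<lambda>x. \<mu> - q x) absolutely_integrable_on {a..b}" if "0 \<le> a" "b \<le> 1"
  by (intro set_integral_diff(1) q_subinterval that) (auto intro: absolutely_integrable_continuous_real)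

text \<open>Uniqueness for zero initial data on a short interval. Signed powers are not Lipschitz in
  general, but homogeneity replaces this: with \<open>M\<close> the maximum of
  \<open>\<bar>w\<bar>\<close>, one integration gives
  \<open>\<bar>y\<bar> \<le> M powr (1 / (p - 1)) * (b - a)\<close>, the next one gives
  \<open>M \<le> L * M\<close>, and \<open>small\<close> says \<open>L < 1\<close>.\<close>

lemma zero_of_double_zero:
  assumes ab: "0 \<le> a" "a < b" "b \<le> 1" and c: "c \<in> {a..b}" "y c = 0" "w c = 0"
    and small: "(b - a) powr (p - 1) * ((p - 1) * integral {a..b} (\<lambda>x. \<bar>\<mu> - q x\<bar>)) < 1"
    and x: "x \<in> {a..b}"
  shows "y x = 0"
proof -
  define r where "r = 1 / (p - 1)"
  have r: "r > 0" using p by (simp add: r_def)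
  have sub: "{a..b} \<subseteq> {0..1}" using ab by auto
  have "continuous_on {a..b} (\<lambda>x. \<bar>w x\<bar>)"
    by (intro continuous_intros continuous_on_subset[OF w_continuous sub])
  then obtain z where z: "z \<in> {a..b}" "\<And>t. t \<in> {a..b} \<Longrightarrow> \<bar>w t\<bar> \<le> \<bar>w z\<bar>"
    using continuous_attains_sup[of "{a..b}" "\<lambda>x. \<bar>w x\<bar>"] ab by auto
  define M where "M = \<bar>w z\<bar>"
  have y_le: "\<bar>y t\<bar> \<le> M powr r * (b - a)" if t: "t \<in> {a..b}" for t
  proof -
    have "norm (y t - y c) \<le> M powr r * norm (t - c)"
    proof (rule field_differentiable_bound[of "{a..b}"])
      fix u assume u: "u \<in> {a..b}"
      show "(y has_field_derivative signed_powr (w u) r) (at u within {a..b})"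
        using u sub unfolding r_def by (intro DERIV_subset[OF y_deriv]) auto
      show "norm (signed_powr (w u) r) \<le> M powr r"
        using z(2)[OF u] r by (simp add: abs_signed_powr M_def powr_mono2)
    qed (use t c in auto)
    also have "\<dots> \<le> M powr r * (b - a)"
      using t c by (intro mult_left_mono) auto
    finally show ?thesis using c by simp
  qed
  define Q where "Q = integral {a..b} (\<lambda>x. \<bar>\<mu> - q x\<bar>)"
  define L where "L = (b - a) powr (p - 1) * ((p - 1) * Q)"
  have abs_int: "(\<lambda>x. \<bar>\<mu> - q x\<bar>) integrable_on {a'..b'}" if "0 \<le> a'" "b' \<le> 1" for a' b'
    using potential_integrable[OF that] by (simp add: absolutely_integrable_on_def)
  have "\<bar>w v - w u\<bar> \<le> L * M" if uv: "a \<le> u" "u \<le> v" "v \<le> b" for u v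
  proof -
    let ?g = "\<lambda>x. - ((p - 1) * (\<mu> - q x) * signed_powr (y x) (p - 1))"
    have "(?g has_integral (w v - w u)) {u..v}"
    proof (rule abs_continuous_on_has_integral[OF \<open>u \<le> v\<close> _ N])
      show "abs_continuous_on u v w"
        by (rule abs_continuous_on_subinterval[OF w_ac]) (use uv ab in auto)
      show "(w has_real_derivative ?g x) (at x within {u..v})" if "x \<in> {u..v} - N" for x
        by (rule DERIV_subset[OF w_deriv]) (use that uv ab in auto)
    qed
    then have "w v - w u = integral {u..v} ?g" "?g integrable_on {u..v}"
      by (auto simp: has_integral_iff)
    then have "\<bar>w v - w u\<bar> \<le> integral {u..v} (\<lambda>x. (p - 1) * ((b - a) powr (p - 1) * M) * \<bar>\<mu> - q x\<bar>)"
      unfolding real_norm_def[symmetric]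
    proof (simp only:, intro integral_norm_bound_integral)
      show "(\<lambda>x. (p - 1) * ((b - a) powr (p - 1) * M) * norm (\<mu> - q x)) integrable_on {u..v}"
        unfolding real_norm_def using uv ab by (intro integrable_on_mult_right abs_int) auto
      fix x assume x: "x \<in> {u..v}"
      have "\<bar>y x\<bar> powr (p - 1) \<le> (M powr r * (b - a)) powr (p - 1)"
        using y_le[of x] x uv p by (intro powr_mono2) auto
      also have "\<dots> = M * (b - a) powr (p - 1)"
        using p ab by (simp add: powr_mult powr_powr r_def M_def)
      finally have "(p - 1) * \<bar>\<mu> - q x\<bar> * \<bar>y x\<bar> powr (p - 1)
          \<le> (p - 1) * \<bar>\<mu> - q x\<bar> * (M * (b - a) powr (p - 1))"
        using p by (intro mult_left_mono) auto
      then show "norm (?g x) \<le> (p - 1) * ((b - a) powr (p - 1) * M) * norm (\<mu> - q x)"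
        using p by (simp add: abs_mult abs_signed_powr mult_ac)
    qed auto
    also have "\<dots> = (p - 1) * ((b - a) powr (p - 1) * M) * integral {u..v} (\<lambda>x. \<bar>\<mu> - q x\<bar>)"
      by simp
    also have "\<dots> \<le> (p - 1) * ((b - a) powr (p - 1) * M) * Q"
      unfolding Q_def using p uv ab abs_int
      by (intro mult_left_mono integral_subset_le) (auto simp: M_def)
    finally show ?thesis by (simp add: L_def mult_ac)
  qed
  from this[of c z] this[of z c] have "M \<le> L * M"
    using c z by (cases "c \<le> z") (auto simp: M_def)
  moreover have "L < 1" using small by (simp add: L_def Q_def)
  ultimately have "M \<le> 0"
    by (smt (verit) mult_less_cancel_right2)
  then have "M = 0" by (simp add: M_def)
  then show ?thesis using y_le[OF x] r by simp
qed

text \<open>A double zero would make \<open>y\<close> vanish on a whole interval around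
  \<open>c\<close>, contradicting the finiteness of the zero set.\<close>

lemma simple_zero:
  assumes c: "c \<in> {0..1}" "y c = 0" and fin: "finite {x \<in> {0..1}. y x = 0}"
  shows "w c \<noteq> 0"
proof
  assume "w c = 0"
  define Q where "Q = integral {0..1} (\<lambda>x. \<bar>\<mu> - q x\<bar>)"
  have abs_int: "(\<lambda>x. \<bar>\<mu> - q x\<bar>) integrable_on {a'..b'}" if "0 \<le> a'" "b' \<le> 1" for a' b'
    using potential_integrable[OF that] by (simp add: absolutely_integrable_on_def)
  have "Q \<ge> 0" unfolding Q_def by (intro integral_nonneg abs_int) auto
  \<comment> \<open>Chosen so that \<open>h powr (p - 1)\<close> times \<open>(p - 1) * Q\<close> is
    \<open>(p - 1) * Q / ((p - 1) * Q + 1)\<close>, which is below 1.\<close>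
  define h where "h = (1 / ((p - 1) * Q + 1)) powr (1 / (p - 1))"
  have pQ: "(p - 1) * Q + 1 > 0" using \<open>Q \<ge> 0\<close> p by (intro add_nonneg_pos mult_nonneg_nonneg) auto
  then have "h > 0" by (auto simp: h_def)
  define a where "a = max 0 (c - h / 2)"
  define b where "b = min 1 (c + h / 2)"
  have ab: "0 \<le> a" "a < b" "b \<le> 1" "c \<in> {a..b}" "b - a \<le> h"
    using c \<open>h > 0\<close> by (auto simp: a_def b_def min_def max_def)
  have "(b - a) powr (p - 1) * ((p - 1) * integral {a..b} (\<lambda>x. \<bar>\<mu> - q x\<bar>)) \<le> h powr (p - 1) * ((p - 1) * Q)"
    unfolding Q_def using ab p abs_int
    by (intro mult_mono powr_mono2 mult_nonneg_nonneg integral_nonneg integral_subset_le) auto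
  also have "\<dots> = (p - 1) * Q / ((p - 1) * Q + 1)"
    using pQ p by (simp add: h_def powr_powr)
  also have "\<dots> < 1" using pQ by simp
  finally have "{a..b} \<subseteq> {x \<in> {0..1}. y x = 0}"
    using zero_of_double_zero[OF ab(1-4) c(2) \<open>w c = 0\<close>] ab by auto
  then have "finite {a..b}" using fin finite_subset by blast
  then show False using ab using infinite_Icc by blast
qed

definition riccati :: "real \<Rightarrow> real \<Rightarrow> real"
  where "riccati K x = w x / (K powr (p - 1) * signed_powr (y x) (p - 1))"

text \<open>Written without \<open>riccati\<close> so that it is continuous across simple zeros of
  \<open>y\<close>, where its value is 0. There division by zero makes \<open>riccati K x\<close>
  equal to 0, and the expression \<open>1 / (1 + \<bar>riccati K x\<bar> powr conj_exp)\<close>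
  would give 1.\<close>

definition weight :: "real \<Rightarrow> real \<Rightarrow> real"
  where "weight K x = K powr p * \<bar>y x\<bar> powr p / (K powr p * \<bar>y x\<bar> powr p + \<bar>w x\<bar> powr conj_exp)"

lemma abs_riccati_powr:
  assumes "K > 0" "y x \<noteq> 0"
  shows "\<bar>riccati K x\<bar> powr conj_exp = \<bar>w x\<bar> powr conj_exp / (K powr p * \<bar>y x\<bar> powr p)"
proof -
  have "(p - 1) * conj_exp = p" using p by (simp add: conj_exp_def)
  then show ?thesis
    using assms by (simp add: riccati_def abs_mult abs_signed_powr powr_divide powr_mult powr_powr)
qed

lemma weight_riccati:
  assumes "K > 0" "y x \<noteq> 0"
  shows "weight K x = 1 / (1 + \<bar>riccati K x\<bar> powr conj_exp)"
proof -
  have "K powr p * \<bar>y x\<bar> powr p > 0" using assms by simp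
  then show ?thesis
    unfolding weight_def abs_riccati_powr[OF assms]
    using assms by (simp add: divide_simps)
qed

text \<open>Quotient rule together with \<open>w y' = \<bar>w\<bar> powr conj_exp\<close>, which
  turns the second term into a power of the Riccati variable itself; the equation closes up, with
  \<open>q\<close> entering only additively.\<close>

lemma riccati_deriv:
  assumes ab: "0 \<le> a" "b \<le> 1" and pos: "\<And>x. x \<in> {a..b} \<Longrightarrow> y x > 0" and K: "K > 0"
    and x: "x \<in> {a..b} - N"
  shows "(riccati K has_real_derivative
    - ((p - 1) * (K * \<bar>riccati K x\<bar> powr conj_exp + (\<mu> - q x) * K powr (1 - p)))) (at x within {a..b})"
proof -
  define Y where "Y = y x"
  have Y: "Y > 0" using pos x by (simp add: Y_def)
  have sub: "{a..b} \<subseteq> {0..1}" using ab by auto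
  let ?y' = "signed_powr (w x) (1 / (p - 1))"
  let ?z = "\<lambda>t. K powr (p - 1) * signed_powr (y t) (p - 1)"
  have z: "?z x \<noteq> 0" using K Y by (simp add: Y_def)
  have "((\<lambda>t. signed_powr (y t) (p - 1)) has_real_derivative
      ((p - 1) * \<bar>y x\<bar> powr (p - 1 - 1)) * ?y') (at x within {a..b})"
    using x sub Y unfolding Y_def
    by (intro DERIV_chain2[OF has_real_derivative_signed_powr] DERIV_subset[OF y_deriv sub]) auto
  then have "(?z has_real_derivative K powr (p - 1) * (((p - 1) * \<bar>y x\<bar> powr (p - 1 - 1)) * ?y'))
      (at x within {a..b})"
    by (rule DERIV_cmult)
  moreover have "(w has_real_derivative - ((p - 1) * (\<mu> - q x) * signed_powr (y x) (p - 1))) (at x within {a..b})"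
    using x sub by (intro DERIV_subset[OF w_deriv sub]) auto
  ultimately have D: "(riccati K has_real_derivative
      ((- ((p - 1) * (\<mu> - q x) * signed_powr (y x) (p - 1))) * ?z x
        - w x * (K powr (p - 1) * (((p - 1) * \<bar>y x\<bar> powr (p - 1 - 1)) * ?y'))) / (?z x * ?z x))
      (at x within {a..b})"
    unfolding riccati_def[abs_def] using z by (intro DERIV_divide) auto
  have sY: "signed_powr (y x) (p - 1) = Y powr (p - 1)" "\<bar>y x\<bar> = Y"
    using Y by (simp_all add: Y_def signed_powr_pos)
  have wy: "w x * ?y' = \<bar>w x\<bar> powr conj_exp"
    using mult_signed_powr[of "w x" "1 / (p - 1)"] p by (simp add: conj_exp_def field_simps)
  have e1: "Y powr (p - 1) * Y powr (p - 1) = Y powr (p - 2) * Y powr p"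
    by (simp flip: powr_add)
  have ne: "Y powr (p - 1) > 0" "Y powr (p - 2) > 0" "Y powr p > 0" "K powr (p - 1) > 0" "K powr p > 0" "K powr (1 - p) > 0"
    using Y K by auto
  have K1: "K powr p = K * K powr (p - 1)" using K by (simp add: powr_diff)
  have K2: "K powr (1 - p) = 1 / K powr (p - 1)" using K by (simp add: powr_diff)
  have "((- ((p - 1) * (\<mu> - q x) * signed_powr (y x) (p - 1))) * ?z x
        - w x * (K powr (p - 1) * (((p - 1) * \<bar>y x\<bar> powr (p - 1 - 1)) * ?y'))) / (?z x * ?z x)
      = - ((p - 1) * (\<mu> - q x) * Y powr (p - 1)) / (K powr (p - 1) * Y powr (p - 1))
        - (w x * ?y') * (K powr (p - 1) * (p - 1) * Y powr (p - 2))
          / ((K powr (p - 1) * K powr (p - 1)) * (Y powr (p - 1) * Y powr (p - 1)))"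
    using ne unfolding sY by (simp add: field_simps)
  also have "\<dots> = - ((p - 1) * (\<mu> - q x) / K powr (p - 1))
        - \<bar>w x\<bar> powr conj_exp * (p - 1) / (K powr (p - 1) * Y powr p)"
    using ne unfolding wy e1 by (simp add: field_simps)
  also have "\<dots> = - ((p - 1) * (K * \<bar>riccati K x\<bar> powr conj_exp + (\<mu> - q x) * K powr (1 - p)))"
    using ne K Y unfolding K2 abs_riccati_powr[OF K Y[unfolded Y_def, THEN less_imp_neq, symmetric]] sY K1
    by (simp add: field_simps)
  finally show ?thesis using D by simp
qed

text \<open>\<open>riccati K\<close> is \<open>w\<close> times a function \<open>z\<close> that is
  continuously differentiable on the compact interval, where \<open>y\<close> stays away from 0. The
  increments therefore have the shape that \<open>abs_continuous_on_dominated\<close> asks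
  for.\<close>

lemma riccati_increment_bound:
  assumes ab: "0 \<le> a" "b \<le> 1" and pos: "\<And>x. x \<in> {a..b} \<Longrightarrow> y x > 0" and K: "K > 0"
  obtains C where "C \<ge> 0" "\<And>s t. s \<in> {a..b} \<Longrightarrow> t \<in> {a..b} \<Longrightarrow>
      \<bar>riccati K t - riccati K s\<bar> \<le> C * (\<bar>w t - w s\<bar> + \<bar>t - s\<bar>)"
proof -
  have sub: "{a..b} \<subseteq> {0..1}" using ab by auto
  define z where "z t = 1 / (K powr (p - 1) * signed_powr (y t) (p - 1))" for t
  define d where "d t = - (K powr (p - 1) * ((p - 1) * \<bar>y t\<bar> powr (p - 1 - 1) * signed_powr (w t) (1 / (p - 1))))
      / (K powr (p - 1) * signed_powr (y t) (p - 1))\<^sup>2" for t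
  have y_cont: "continuous_on {a..b} y" and w_cont: "continuous_on {a..b} w"
    using continuous_on_subset[OF y_continuous sub] continuous_on_subset[OF w_continuous sub] by auto
  have z_cont: "continuous_on {a..b} z"
    unfolding z_def using p pos K by (intro continuous_intros y_cont) (auto simp: less_imp_neq[symmetric])
  have d_cont: "continuous_on {a..b} d"
    unfolding d_def using p pos K
    by (intro continuous_intros y_cont w_cont) (auto simp: less_imp_neq[symmetric])
  have z_deriv: "(z has_real_derivative d t) (at t within {a..b})" if t: "t \<in> {a..b}" for t
  proof -
    have "((\<lambda>t. signed_powr (y t) (p - 1)) has_real_derivative
        ((p - 1) * \<bar>y t\<bar> powr (p - 1 - 1)) * signed_powr (w t) (1 / (p - 1))) (at t within {a..b})"
      using t sub pos[OF t]
      by (intro DERIV_chain2[OF has_real_derivative_signed_powr] DERIV_subset[OF y_deriv sub]) auto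
    from DERIV_inverse'[OF DERIV_cmult[OF this, of "K powr (p - 1)"]] show ?thesis
      using pos[OF t] K unfolding z_def[abs_def] d_def
      by (simp add: divide_inverse power2_eq_square mult_ac less_imp_neq[symmetric])
  qed
  have bdd: "\<exists>B. \<forall>t\<in>{a..b}. \<bar>f t\<bar> \<le> B" if "continuous_on {a..b} f" for f :: "real \<Rightarrow> real"
    using compact_imp_bounded[OF compact_continuous_image[OF that compact_Icc]] by (auto simp: bounded_iff)
  obtain B1 where B1: "\<And>t. t \<in> {a..b} \<Longrightarrow> \<bar>w t\<bar> \<le> B1" using bdd[OF w_cont] by blast
  obtain B2 where B2: "\<And>t. t \<in> {a..b} \<Longrightarrow> \<bar>z t\<bar> \<le> B2" using bdd[OF z_cont] by blast
  obtain B3 where B3: "\<And>t. t \<in> {a..b} \<Longrightarrow> \<bar>d t\<bar> \<le> B3" using bdd[OF d_cont] by blast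
  define C where "C = \<bar>B1 * B3\<bar> + \<bar>B2\<bar>"
  show ?thesis
  proof (rule that[of C])
    fix s t assume st: "s \<in> {a..b}" "t \<in> {a..b}"
    have z_lip: "\<bar>z t - z s\<bar> \<le> B3 * \<bar>t - s\<bar>"
      using field_differentiable_bound[of "{a..b}" z d B3 t s] z_deriv B3 st by auto
    have "riccati K t - riccati K s = w t * (z t - z s) + z s * (w t - w s)"
      by (simp add: riccati_def z_def algebra_simps diff_divide_distrib)
    also have "\<bar>\<dots>\<bar> \<le> \<bar>w t\<bar> * \<bar>z t - z s\<bar> + \<bar>z s\<bar> * \<bar>w t - w s\<bar>"
      by (metis abs_mult abs_triangle_ineq)
    also have "\<dots> \<le> \<bar>B1\<bar> * (\<bar>B3\<bar> * \<bar>t - s\<bar>) + \<bar>B2\<bar> * \<bar>w t - w s\<bar>"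
    proof (intro add_mono mult_mono)
      show "\<bar>z t - z s\<bar> \<le> \<bar>B3\<bar> * \<bar>t - s\<bar>"
        by (rule order_trans[OF z_lip]) (intro mult_right_mono, auto)
    qed (use B1[OF st(2)] B2[OF st(1)] in auto)
    also have "\<dots> \<le> C * (\<bar>w t - w s\<bar> + \<bar>t - s\<bar>)"
      unfolding C_def by (simp add: algebra_simps abs_mult)
    finally show "\<bar>riccati K t - riccati K s\<bar> \<le> C * (\<bar>w t - w s\<bar> + \<bar>t - s\<bar>)" .
  qed (simp add: C_def)
qed

text \<open>A bounded \<open>G'\<close> makes \<open>G\<close> Lipschitz, so
  \<open>G (riccati K x)\<close> is absolutely continuous and the fundamental theorem applies. The
  order \<open>a\<close> before \<open>b\<close> on the right absorbs the minus sign of the Riccati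
  equation.\<close>

lemma riccati_transport:
  assumes ab: "0 \<le> a" "a \<le> b" "b \<le> 1" and pos: "\<And>x. x \<in> {a..b} \<Longrightarrow> y x > 0" and K: "K > 0"
    and G: "\<And>u. (G has_real_derivative G' u) (at u)" "\<And>u. \<bar>G' u\<bar> \<le> B"
  shows "((\<lambda>x. (p - 1) * (G' (riccati K x) * (K * \<bar>riccati K x\<bar> powr conj_exp + (\<mu> - q x) * K powr (1 - p))))
    has_integral (G (riccati K a) - G (riccati K b))) {a..b}"
proof -
  let ?g = "\<lambda>x. (p - 1) * (G' (riccati K x) * (K * \<bar>riccati K x\<bar> powr conj_exp + (\<mu> - q x) * K powr (1 - p)))"
  obtain C where C: "C \<ge> 0" "\<And>s t. s \<in> {a..b} \<Longrightarrow> t \<in> {a..b} \<Longrightarrow>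
      \<bar>riccati K t - riccati K s\<bar> \<le> C * (\<bar>w t - w s\<bar> + \<bar>t - s\<bar>)"
    using riccati_increment_bound[OF ab(1,3) pos K] by metis
  have "B \<ge> 0" using G(2)[of 0] by linarith
  have "((\<lambda>x. - ?g x) has_integral (G (riccati K b) - G (riccati K a))) {a..b}"
  proof (rule abs_continuous_on_has_integral[OF ab(2) _ N])
    show "abs_continuous_on a b (\<lambda>x. G (riccati K x))"
    proof (rule abs_continuous_on_dominated)
      show "abs_continuous_on a b w"
        by (rule abs_continuous_on_subinterval[OF w_ac]) (use ab in auto)
      show "B * C \<ge> 0" using \<open>B \<ge> 0\<close> C(1) by simp
      fix s t assume st: "s \<in> {a..b}" "t \<in> {a..b}"
      have "\<bar>G (riccati K t) - G (riccati K s)\<bar> \<le> B * \<bar>riccati K t - riccati K s\<bar>"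
        using field_differentiable_bound[of UNIV G G' B "riccati K t" "riccati K s"] G by auto
      also have "\<dots> \<le> B * (C * (\<bar>w t - w s\<bar> + \<bar>t - s\<bar>))"
        by (rule mult_left_mono[OF C(2)[OF st] \<open>B \<ge> 0\<close>])
      finally show "\<bar>G (riccati K t) - G (riccati K s)\<bar> \<le> B * C * (\<bar>w t - w s\<bar> + \<bar>t - s\<bar>)"
        by (simp add: mult.assoc)
    qed
    fix x assume x: "x \<in> {a..b} - N"
    show "((\<lambda>x. G (riccati K x)) has_real_derivative - ?g x) (at x within {a..b})"
      using DERIV_chain2[OF G(1) riccati_deriv[OF ab(1,3) pos K x]]
      by (simp add: mult_ac)
  qed
  from has_integral_neg[OF this] show ?thesis by simp
qed

text \<open>Transport over a full nodal interval, where only the limits of \<open>G\<close> survive.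
  The decay demanded of \<open>G'\<close> compensates the growth of
  \<open>\<bar>riccati K x\<bar> powr conj_exp\<close>: the integrand is a bounded function plus a
  bounded multiple of \<open>\<mu> - q x\<close>, hence integrable up to the nodes.\<close>

lemma riccati_integral_pos:
  assumes ab: "0 \<le> \<alpha>" "\<alpha> < \<beta>" "\<beta> \<le> 1" and y0: "y \<alpha> = 0" "y \<beta> = 0" and w0: "w \<alpha> \<noteq> 0" "w \<beta> \<noteq> 0"
    and pos: "\<And>x. x \<in> {\<alpha><..<\<beta>} \<Longrightarrow> y x > 0" and K: "K > 0"
    and G: "\<And>u. (G has_real_derivative G' u) (at u)" "\<And>u. isCont G' u"
      "\<And>u. \<bar>G' u\<bar> * (1 + \<bar>u\<bar> powr conj_exp) \<le> B"
    and lim: "(G \<longlongrightarrow> l1) at_top" "(G \<longlongrightarrow> l2) at_bot"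
  shows "((\<lambda>x. (p - 1) * (G' (riccati K x) * (K * \<bar>riccati K x\<bar> powr conj_exp + (\<mu> - q x) * K powr (1 - p))))
    has_integral (l1 - l2)) {\<alpha>..\<beta>}"
proof -
  let ?r = "1 / (p - 1)"
  let ?I = "{\<alpha><..<\<beta>}"
  define g where "g x = (p - 1) * (G' (riccati K x) * (K * \<bar>riccati K x\<bar> powr conj_exp + (\<mu> - q x) * K powr (1 - p)))" for x
  have r: "?r > 0" using p by simp
  have sub: "{\<alpha>..\<beta>} \<subseteq> {0..1}" "?I \<subseteq> {0..1}" using ab by auto
  have tend: "((\<lambda>x. f x) \<longlongrightarrow> f \<alpha>) (at_right \<alpha>)" "((\<lambda>x. f x) \<longlongrightarrow> f \<beta>) (at_left \<beta>)"
    if "continuous_on {\<alpha>..\<beta>} f" for f :: "real \<Rightarrow> real"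
    using continuous_on_Icc_at_rightD[OF that ab(2)] continuous_on_Icc_at_leftD[OF that ab(2)] by blast+
  have y_tend: "(y \<longlongrightarrow> 0) (at_right \<alpha>)" "(y \<longlongrightarrow> 0) (at_left \<beta>)"
    using tend[OF continuous_on_subset[OF y_continuous sub(1)]] y0 by auto
  have w_tend: "(w \<longlongrightarrow> w \<alpha>) (at_right \<alpha>)" "(w \<longlongrightarrow> w \<beta>) (at_left \<beta>)"
    using tend[OF continuous_on_subset[OF w_continuous sub(1)]] by auto
  have ev: "\<forall>\<^sub>F x in at_right \<alpha>. x \<in> ?I" "\<forall>\<^sub>F x in at_left \<beta>. x \<in> ?I"
    using eventually_at_right_real[OF ab(2)] eventually_at_left_real[OF ab(2)] by auto
  \<comment> \<open>The right difference quotients of \<open>y\<close> are nonnegative because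
    \<open>y > 0\<close> inside; \<open>w0\<close> makes the inequality strict. The sign decides
    that the Riccati variable starts at plus infinity.\<close>
  have w\<alpha>: "w \<alpha> > 0"
  proof -
    have "(y has_real_derivative signed_powr (w \<alpha>) ?r) (at \<alpha> within {\<alpha>..\<beta>})"
      using ab by (intro DERIV_subset[OF y_deriv sub(1)]) auto
    then have "((\<lambda>x. (y x - y \<alpha>) / (x - \<alpha>)) \<longlongrightarrow> signed_powr (w \<alpha>) ?r) (at_right \<alpha>)"
      using ab by (simp add: has_field_derivative_iff at_within_Icc_at_right)
    moreover have "\<forall>\<^sub>F x in at_right \<alpha>. 0 \<le> (y x - y \<alpha>) / (x - \<alpha>)"
      using ev(1) by eventually_elim (use pos y0 in \<open>auto simp: less_imp_le\<close>)
    ultimately have "signed_powr (w \<alpha>) ?r \<ge> 0"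
      by (rule tendsto_lowerbound) simp
    then have "sgn (signed_powr (w \<alpha>) ?r) \<ge> 0" by (simp only: sgn_if split: if_split) auto
    then have "sgn (w \<alpha>) \<ge> 0" by (simp only: sgn_signed_powr)
    then show ?thesis using w0(1) by (auto simp: sgn_if split: if_splits)
  qed
  have w\<beta>: "w \<beta> < 0"
  proof -
    have "(y has_real_derivative signed_powr (w \<beta>) ?r) (at \<beta> within {\<alpha>..\<beta>})"
      using ab by (intro DERIV_subset[OF y_deriv sub(1)]) auto
    then have "((\<lambda>x. (y x - y \<beta>) / (x - \<beta>)) \<longlongrightarrow> signed_powr (w \<beta>) ?r) (at_left \<beta>)"
      using ab by (simp add: has_field_derivative_iff at_within_Icc_at_left)
    moreover have "\<forall>\<^sub>F x in at_left \<beta>. (y x - y \<beta>) / (x - \<beta>) \<le> 0"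
      using ev(2) by eventually_elim (use pos y0 in \<open>auto simp: divide_nonneg_neg less_imp_le\<close>)
    ultimately have "signed_powr (w \<beta>) ?r \<le> 0"
      by (rule tendsto_upperbound) simp
    then have "sgn (signed_powr (w \<beta>) ?r) \<le> 0" by (simp only: sgn_if split: if_split) auto
    then have "sgn (w \<beta>) \<le> 0" by (simp only: sgn_signed_powr)
    then show ?thesis using w0(2) by (auto simp: sgn_if split: if_splits)
  qed
  define z where "z x = K powr (p - 1) * signed_powr (y x) (p - 1)" for x
  have z_cont: "continuous_on {\<alpha>..\<beta>} z"
    unfolding z_def using p by (intro continuous_intros continuous_on_subset[OF y_continuous sub(1)]) auto
  have z_pos: "z x > 0" if "x \<in> ?I" for x
    using pos[OF that] K by (simp add: z_def signed_powr_pos)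
  have "filterlim (\<lambda>x. inverse (z x)) at_top (at_right \<alpha>)"
    using tend(1)[OF z_cont] y0 eventually_mono[OF ev(1) z_pos]
    by (intro filterlim_inverse_at_top) (auto simp: z_def[of \<alpha>])
  then have "filterlim (\<lambda>x. w x * inverse (z x)) at_top (at_right \<alpha>)"
    by (rule filterlim_tendsto_pos_mult_at_top[OF w_tend(1) w\<alpha>])
  then have \<rho>\<alpha>: "filterlim (riccati K) at_top (at_right \<alpha>)"
    by (simp add: riccati_def[abs_def] z_def divide_inverse)
  have "filterlim (\<lambda>x. inverse (z x)) at_top (at_left \<beta>)"
    using tend(2)[OF z_cont] y0 eventually_mono[OF ev(2) z_pos]
    by (intro filterlim_inverse_at_top) (auto simp: z_def[of \<beta>])
  then have "filterlim (\<lambda>x. w x * inverse (z x)) at_bot (at_left \<beta>)"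
    by (rule filterlim_tendsto_neg_mult_at_bot[OF w_tend(2) w\<beta>])
  then have \<rho>\<beta>: "filterlim (riccati K) at_bot (at_left \<beta>)"
    by (simp add: riccati_def[abs_def] z_def divide_inverse)
  have \<rho>_cont: "continuous_on ?I (riccati K)"
    unfolding riccati_def[abs_def] using z_pos p
    by (intro continuous_intros continuous_on_subset[OF w_continuous sub(2)]
        continuous_on_subset[OF y_continuous sub(2)]) (force simp: z_def)+
  have G'_cont: "continuous_on ?I (\<lambda>x. G' (riccati K x))"
    by (rule continuous_on_compose2[OF _ \<rho>_cont, of UNIV]) (auto intro: continuous_at_imp_continuous_on G(2))
  have G'_bd: "\<bar>G' u\<bar> \<le> B" "\<bar>G' u * \<bar>u\<bar> powr conj_exp\<bar> \<le> B" for u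
    using G(3)[of u] by (auto simp: algebra_simps abs_mult)
      (smt (verit) abs_ge_zero mult_nonneg_nonneg powr_ge_zero)
  have prod_int: "(\<lambda>x. f x * k x) absolutely_integrable_on ?I"
    if "continuous_on ?I f" "\<And>x. \<bar>f x\<bar> \<le> B" "k absolutely_integrable_on ?I" for f k :: "real \<Rightarrow> real"
    using that by (intro absolutely_integrable_bounded_measurable_product_real)
      (auto simp: bounded_iff intro!: continuous_imp_measurable_on_sets_lebesgue)
  have "(\<lambda>x. (p - 1) * ((G' (riccati K x) * \<bar>riccati K x\<bar> powr conj_exp) * K
      + G' (riccati K x) * ((\<mu> - q x) * K powr (1 - p)))) absolutely_integrable_on ?I"
  proof (rule set_integrable_mult_right, rule set_integral_add(1), goal_cases)
    case 1
    have "continuous_on ?I (\<lambda>x. G' (riccati K x) * \<bar>riccati K x\<bar> powr conj_exp)"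
      using conj_exp_gt_1 by (intro continuous_intros G'_cont \<rho>_cont continuous_on_powr') auto
    moreover have "(\<lambda>x. K) absolutely_integrable_on ?I"
      by (simp add: absolutely_integrable_on_def integrable_on_const)
    ultimately show ?case by (intro prod_int G'_bd)
  next
    case 2
    have "(\<lambda>x. (\<mu> - q x) * K powr (1 - p)) absolutely_integrable_on ?I"
      by (intro set_integrable_mult_left set_integrable_subset[OF potential_integrable[of \<alpha> \<beta>]])
        (use ab in auto)
    then show ?case by (rule prod_int[OF G'_cont G'_bd(1)])
  qed
  then have "g absolutely_integrable_on ?I"
    by (simp add: g_def[abs_def] algebra_simps)
  then have g_int: "g integrable_on {\<alpha>..\<beta>}"
    by (auto simp: absolutely_integrable_on_def integrable_on_Icc_iff_Ioo)
  \<comment> \<open>\<open>J\<close> is continuous up to the nodes, and on compact pieces between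
    them its increments are those of \<open>- G (riccati K x)\<close>. Letting one end run to a
    node, with \<open>m\<close> fixed, identifies both boundary values.\<close>
  define J where "J x = integral {\<alpha>..x} g" for x
  have J_cont: "continuous_on {\<alpha>..\<beta>} J"
    unfolding J_def by (rule indefinite_integral_continuous_1[OF g_int])
  have J_diff: "J b - J a = G (riccati K a) - G (riccati K b)" if "\<alpha> < a" "a \<le> b" "b < \<beta>" for a b
  proof -
    have "(g has_integral (G (riccati K a) - G (riccati K b))) {a..b}"
      unfolding g_def using that ab G'_bd(1) K by (intro riccati_transport G(1) pos) auto
    moreover have "integral {\<alpha>..a} g + integral {a..b} g = integral {\<alpha>..b} g"
      using that by (intro Henstock_Kurzweil_Integration.integral_combine integrable_on_subinterval[OF g_int]) auto
    ultimately show ?thesis by (simp add: J_def integral_unique)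
  qed
  define m where "m = (\<alpha> + \<beta>) / 2"
  have m: "\<alpha> < m" "m < \<beta>" using ab by (auto simp: m_def)
  have "((\<lambda>x. J m + G (riccati K m) - G (riccati K x)) \<longlongrightarrow> J m + G (riccati K m) - l2) (at_left \<beta>)"
    by (intro tendsto_intros filterlim_compose[OF lim(2) \<rho>\<beta>])
  moreover have "\<forall>\<^sub>F x in at_left \<beta>. J m + G (riccati K m) - G (riccati K x) = J x"
    using eventually_at_left_real[OF m(2)]
  proof eventually_elim
    case (elim x)
    then show ?case using J_diff[of m x] m by simp
  qed
  ultimately have "(J \<longlongrightarrow> J m + G (riccati K m) - l2) (at_left \<beta>)"
    by (rule Lim_transform_eventually)
  then have 1: "J \<beta> = J m + G (riccati K m) - l2"
    using tend(2)[OF J_cont] tendsto_unique trivial_limit_at_left_real by blast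
  have "((\<lambda>x. J m + G (riccati K m) - G (riccati K x)) \<longlongrightarrow> J m + G (riccati K m) - l1) (at_right \<alpha>)"
    by (intro tendsto_intros filterlim_compose[OF lim(1) \<rho>\<alpha>])
  moreover have "\<forall>\<^sub>F x in at_right \<alpha>. J m + G (riccati K m) - G (riccati K x) = J x"
    using eventually_at_right_real[OF m(1)]
  proof eventually_elim
    case (elim x)
    then show ?case using J_diff[of x m] m by simp
  qed
  ultimately have "(J \<longlongrightarrow> J m + G (riccati K m) - l1) (at_right \<alpha>)"
    by (rule Lim_transform_eventually)
  then have 2: "J \<alpha> = J m + G (riccati K m) - l1"
    using tend(1)[OF J_cont] tendsto_unique trivial_limit_at_right_real by blast
  have "J \<beta> - J \<alpha> = integral {\<alpha>..\<beta>} g" by (simp add: J_def)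
  with 1 2 show ?thesis using g_int unfolding g_def by (simp add: has_integral_iff)
qed

lemma negated: "p_laplace_system p q \<mu> (\<lambda>x. - y x) (\<lambda>x. - w x) N"
proof
  fix x :: real
  have odd: "signed_powr (- u) r = - signed_powr u r" for u r
    by (simp add: signed_powr_def)
  show "((\<lambda>x. - y x) has_real_derivative signed_powr (- w x) (1 / (p - 1))) (at x within {0..1})"
    if "x \<in> {0..1}" using DERIV_minus[OF y_deriv[OF that]] by (simp add: odd)
  show "((\<lambda>x. - w x) has_real_derivative - ((p - 1) * (\<mu> - q x) * signed_powr (- y x) (p - 1)))
      (at x within {0..1})"
    if "x \<in> {0..1} - N" using DERIV_minus[OF w_deriv[OF that]] by (simp add: odd)
  have "\<bar>- a - - b\<bar> = \<bar>a - b\<bar>" for a b :: real by simp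
  then show "abs_continuous_on 0 1 (\<lambda>x. - w x)"
    using w_ac unfolding abs_continuous_on_def by simp
qed (fact p q N)+

text \<open>Two choices of \<open>G\<close> in the transport formula: the generalised arctangent,
  whose limits differ by a multiple of \<open>pi_hat p\<close>, and the function of
  \<open>rational_bump\<close>, whose limits agree.\<close>

lemma nodal_integrals_pos:
  assumes ab: "0 \<le> \<alpha>" "\<alpha> < \<beta>" "\<beta> \<le> 1" and y0: "y \<alpha> = 0" "y \<beta> = 0" and w0: "w \<alpha> \<noteq> 0" "w \<beta> \<noteq> 0"
    and pos: "\<And>x. x \<in> {\<alpha><..<\<beta>} \<Longrightarrow> y x > 0" and K: "K > 0"
  shows "((\<lambda>x. K * (1 - weight K x) + (\<mu> - q x) * K powr (1 - p) * weight K x) has_integral pi_hat p) {\<alpha>..\<beta>}"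
    (is "(?f has_integral _) _")
    and "((\<lambda>x. (p * weight K x - 1) * (K * (1 - weight K x) + (\<mu> - q x) * K powr (1 - p) * weight K x))
      has_integral 0) {\<alpha>..\<beta>}"
proof -
  define X where "X x = \<bar>riccati K x\<bar> powr conj_exp" for x
  define M where "M x = (\<mu> - q x) * K powr (1 - p)" for x
  have W: "weight K x = 1 / (1 + X x)" if "x \<in> {\<alpha><..<\<beta>}" for x
    using weight_riccati[OF K, of x] pos[OF that] by (simp add: X_def)
  have X: "1 + X x > 0" for x by (simp add: X_def add_pos_nonneg)
  have f: "?f x = (K * X x + M x) / (1 + X x)" if "x \<in> {\<alpha><..<\<beta>}" for x
  proof -
    have "K * (1 - 1 / (1 + X x)) = K * X x / (1 + X x)" using X[of x] by (simp add: field_simps)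
    then show ?thesis unfolding W[OF that] M_def[symmetric] by (simp add: add_divide_distrib)
  qed
  note integral = riccati_integral_pos[OF ab y0 w0 pos K, folded X_def M_def]
  have c1: "conj_exp - 1 = 1 / (p - 1)" using p by (simp add: conj_exp_def field_simps)
  define l where "l = pi / conj_exp / sin (pi / conj_exp)"
  obtain F where F: "\<And>u. (F has_real_derivative 1 / (1 + \<bar>u\<bar> powr conj_exp)) (at u)"
    "(F \<longlongrightarrow> l) at_top" "(F \<longlongrightarrow> - l) at_bot"
    using generalised_arctan[OF conj_exp_gt_1] unfolding l_def by metis
  have "((\<lambda>x. (p - 1) * (1 / (1 + X x) * (K * X x + M x))) has_integral l - (- l)) {\<alpha>..\<beta>}"
    unfolding X_def
  proof (rule integral[unfolded X_def, OF _ F(1) _ _ F(2,3)])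
    show "isCont (\<lambda>u. 1 / (1 + \<bar>u\<bar> powr conj_exp)) u" for u
      using conj_exp_gt_1 by (intro continuous_intros) (auto simp: add_nonneg_eq_0_iff)
    show "\<bar>1 / (1 + \<bar>u\<bar> powr conj_exp)\<bar> * (1 + \<bar>u\<bar> powr conj_exp) \<le> 1" for u
      by (simp add: add_nonneg_eq_0_iff)
  qed
  from has_integral_mult_right[OF this, of "1 / (p - 1)"]
  have "((\<lambda>x. 1 / (p - 1) * ((p - 1) * (1 / (1 + X x) * (K * X x + M x)))) has_integral
      1 / (p - 1) * (l - - l)) {\<alpha>..\<beta>}" .
  moreover have "1 / (p - 1) * ((p - 1) * (1 / (1 + X x) * Z)) = Z / (1 + X x)" for x Z
    using p by simp
  moreover have "1 / (p - 1) * (l - - l) = 2 * l / (p - 1)" by simp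
  ultimately have "((\<lambda>x. (K * X x + M x) / (1 + X x)) has_integral 2 * l / (p - 1)) {\<alpha>..\<beta>}"
    by (simp only:)
  moreover have "2 * l / (p - 1) = pi_hat p"
  proof -
    \<comment> \<open>The two angles are supplementary, so their sines agree; this turns the
      constant of \<open>generalised_arctan\<close> into \<open>pi_hat p\<close>.\<close>
    have "pi / conj_exp = pi - pi / p" using p by (simp add: conj_exp_def field_simps)
    then have "sin (pi / conj_exp) = sin (pi / p)" by simp
    then have "2 * l / (p - 1) = 2 * (pi / conj_exp / (p - 1)) / sin (pi / p)" by (simp add: l_def)
    also have "pi / conj_exp / (p - 1) = pi / p" using p by (simp add: conj_exp_def)
    finally show ?thesis by (simp add: pi_hat_def)
  qed
  \<comment> \<open>The open interval leaves out the two nodes, where \<open>weight\<close> is not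
    given by the formula in \<open>riccati\<close>.\<close>
  ultimately have "((\<lambda>x. (K * X x + M x) / (1 + X x)) has_integral pi_hat p) {\<alpha><..<\<beta>}"
    by (simp add: has_integral_Icc_iff_Ioo)
  then have "(?f has_integral pi_hat p) {\<alpha><..<\<beta>}"
    by (rule has_integral_eq[rotated]) (simp add: f)
  then show "(?f has_integral pi_hat p) {\<alpha>..\<beta>}"
    by (simp add: has_integral_Icc_iff_Ioo)
  let ?g' = "\<lambda>u. (1 - (conj_exp - 1) * \<bar>u\<bar> powr conj_exp) / (1 + \<bar>u\<bar> powr conj_exp)\<^sup>2"
  have "((\<lambda>x. (p - 1) * ((1 - (conj_exp - 1) * X x) / (1 + X x)\<^sup>2 * (K * X x + M x))) has_integral 0 - 0) {\<alpha>..\<beta>}"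
    unfolding X_def
  proof (rule integral[unfolded X_def, OF _ rational_bump(1)[OF conj_exp_gt_1] _ _ rational_bump(2,3)[OF conj_exp_gt_1]])
    show "isCont ?g' u" for u
      using conj_exp_gt_1 by (intro continuous_intros) (auto simp: add_nonneg_eq_0_iff)
    fix u :: real
    define Z where "Z = \<bar>u\<bar> powr conj_exp"
    have Z: "Z \<ge> 0" "1 + Z > 0" by (auto simp: Z_def add_pos_nonneg)
    have "\<bar>1 - (conj_exp - 1) * Z\<bar> \<le> conj_exp * (1 + Z)"
      using Z(1) conj_exp_gt_1 mult_nonneg_nonneg[of "conj_exp - 1" Z] by (simp add: abs_le_iff algebra_simps)
    then show "\<bar>?g' u\<bar> * (1 + \<bar>u\<bar> powr conj_exp) \<le> conj_exp"
      using Z(2) unfolding Z_def[symmetric] by (simp add: power2_eq_square divide_le_eq abs_mult)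
  qed
  then have "((\<lambda>x. (p - 1) * ((1 - (conj_exp - 1) * X x) / (1 + X x)\<^sup>2 * (K * X x + M x))) has_integral 0) {\<alpha><..<\<beta>}"
    by (simp add: has_integral_Icc_iff_Ioo)
  then have "((\<lambda>x. (p * weight K x - 1) * ?f x) has_integral 0) {\<alpha><..<\<beta>}"
  proof (rule has_integral_eq[rotated])
    fix x assume x: "x \<in> {\<alpha><..<\<beta>}"
    have "(p - 1) * (1 - (conj_exp - 1) * X x) = p - 1 - X x"
      using p unfolding c1 by (simp add: field_simps)
    then have "(p - 1) * ((1 - (conj_exp - 1) * X x) / (1 + X x)\<^sup>2 * (K * X x + M x))
        = (p - 1 - X x) / (1 + X x)\<^sup>2 * (K * X x + M x)"
      by (metis times_divide_eq_right mult.assoc)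
    also have "\<dots> = (p * weight K x - 1) * ?f x"
    proof -
      have e: "p * weight K x - 1 = (p - 1 - X x) / (1 + X x)"
        using X[of x] unfolding W[OF x] by (simp add: field_simps)
      show ?thesis unfolding f[OF x] e by (simp add: power2_eq_square)
    qed
    finally show "(p - 1) * ((1 - (conj_exp - 1) * X x) / (1 + X x)\<^sup>2 * (K * X x + M x)) = (p * weight K x - 1) * ?f x" .
  qed
  then show "((\<lambda>x. (p * weight K x - 1) * ?f x) has_integral 0) {\<alpha>..\<beta>}"
    by (simp add: has_integral_Icc_iff_Ioo)
qed

text \<open>By connectedness \<open>y\<close> keeps one sign between its zeros. The negative case is
  the positive one for \<open>- y\<close>, which solves the same equation and has the same
  weight.\<close>

lemma nodal_integrals:
  assumes ab: "0 \<le> \<alpha>" "\<alpha> < \<beta>" "\<beta> \<le> 1" and y0: "y \<alpha> = 0" "y \<beta> = 0" and w0: "w \<alpha> \<noteq> 0" "w \<beta> \<noteq> 0"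
    and ne: "\<And>x. x \<in> {\<alpha><..<\<beta>} \<Longrightarrow> y x \<noteq> 0" and K: "K > 0"
  shows "((\<lambda>x. K * (1 - weight K x) + (\<mu> - q x) * K powr (1 - p) * weight K x) has_integral pi_hat p) {\<alpha>..\<beta>}"
    and "((\<lambda>x. (p * weight K x - 1) * (K * (1 - weight K x) + (\<mu> - q x) * K powr (1 - p) * weight K x))
      has_integral 0) {\<alpha>..\<beta>}"
proof -
  let ?I = "{\<alpha><..<\<beta>}"
  have conn: "connected (y ` ?I)"
    using ab by (intro connected_continuous_image continuous_on_subset[OF y_continuous]) auto
  have "0 \<notin> y ` ?I" using ne by auto
  then consider "\<forall>x\<in>?I. y x > 0" | "\<forall>x\<in>?I. y x < 0"
    using conn unfolding connected_iff_interval by (metis image_eqI linorder_neqE_linordered_idom order_less_imp_le)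
  then have "((\<lambda>x. K * (1 - weight K x) + (\<mu> - q x) * K powr (1 - p) * weight K x) has_integral pi_hat p) {\<alpha>..\<beta>} \<and>
    ((\<lambda>x. (p * weight K x - 1) * (K * (1 - weight K x) + (\<mu> - q x) * K powr (1 - p) * weight K x))
      has_integral 0) {\<alpha>..\<beta>}"
  proof cases
    case 1 then show ?thesis using nodal_integrals_pos[OF ab y0 w0 _ K] by auto
  next
    case 2
    interpret neg: p_laplace_system p q \<mu> "\<lambda>x. - y x" "\<lambda>x. - w x" N by (rule negated)
    have "neg.weight = weight" by (simp add: fun_eq_iff neg.weight_def weight_def)
    then show ?thesis using neg.nodal_integrals_pos[OF ab _ _ _ _ _ K] y0 w0 2 by auto
  qed
  then show "((\<lambda>x. K * (1 - weight K x) + (\<mu> - q x) * K powr (1 - p) * weight K x) has_integral pi_hat p) {\<alpha>..\<beta>}"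
    "((\<lambda>x. (p * weight K x - 1) * (K * (1 - weight K x) + (\<mu> - q x) * K powr (1 - p) * weight K x))
      has_integral 0) {\<alpha>..\<beta>}" by auto
qed

end

section \<open>Lebesgue points and averages over partitions\<close>

text \<open>Differentiation along intervals \<open>{x..x + h}\<close> is applied to \<open>f\<close>
  and to its reflection, and the two estimates are added. Both sides are needed because a nodal
  interval contains \<open>x\<close> at an uncontrolled position.\<close>

lemma lebesgue_differentiation_two_sided:
  fixes f :: "real \<Rightarrow> real"
  assumes f: "\<And>a b. f integrable_on {a..b}"
  obtains N where "negligible N"
    "\<And>x e. x \<notin> N \<Longrightarrow> e > 0 \<Longrightarrow> \<exists>d>0. \<forall>a b. a \<le> x \<and> x \<le> b \<and> b - a < d \<longrightarrow>
      \<bar>integral {a..b} f - f x * (b - a)\<bar> \<le> e * (b - a)"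
proof -
  have aux: "\<exists>N. negligible N \<and> (\<forall>x e. x \<notin> N \<longrightarrow> e > 0 \<longrightarrow>
      (\<exists>d>0. \<forall>h. 0 \<le> h \<and> h < d \<longrightarrow> \<bar>integral {x..x + h} g - g x * h\<bar> \<le> e * h))"
    if g: "\<And>a b. g integrable_on {a..b}" for g :: "real \<Rightarrow> real"
  proof -
    obtain N where N: "negligible N"
      "\<And>x e. x \<notin> N \<Longrightarrow> 0 < e \<Longrightarrow> \<exists>d>0. \<forall>h. 0 < h \<and> h < d \<longrightarrow>
        norm (integral (cbox x (x + h *\<^sub>R One)) g /\<^sub>R h ^ DIM(real) - g x) < e"
      by (rule integrable_ccontinuous_explicit[of g]) (use g in auto)
    show ?thesis
    proof (intro exI[of _ N] conjI allI impI N(1))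
      fix x e :: real assume "x \<notin> N" "e > 0"
      then obtain d where "d > 0" and d: "\<And>h. 0 < h \<Longrightarrow> h < d \<Longrightarrow> \<bar>integral {x..x + h} g / h - g x\<bar> < e"
        using N(2)[of x e] by (auto simp: divide_inverse mult.commute)
      have "\<bar>integral {x..x + h} g - g x * h\<bar> \<le> e * h" if "0 \<le> h" "h < d" for h
      proof (cases "h = 0")
        case False
        then have h: "h > 0" using that by simp
        have "integral {x..x + h} g - g x * h = (integral {x..x + h} g / h - g x) * h"
          using h by (simp add: field_simps)
        then show ?thesis using d[OF h that(2)] h by (simp add: abs_mult)
      qed simp
      with \<open>d > 0\<close> show "\<exists>d>0. \<forall>h. 0 \<le> h \<and> h < d \<longrightarrow> \<bar>integral {x..x + h} g - g x * h\<bar> \<le> e * h"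
        by blast
    qed
  qed
  obtain N1 where N1: "negligible N1" "\<And>x e. x \<notin> N1 \<Longrightarrow> e > 0 \<Longrightarrow>
      \<exists>d>0. \<forall>h. 0 \<le> h \<and> h < d \<longrightarrow> \<bar>integral {x..x + h} f - f x * h\<bar> \<le> e * h"
    using aux[OF f] by blast
  have "(\<lambda>x. f (- x)) integrable_on {a..b}" for a b
    using f[of "- b" "- a"] Henstock_Kurzweil_Integration.integrable_reflect_real[where f = f and a = "- b" and b = "- a"]
    by (simp only: minus_minus)
  from aux[OF this] obtain N2 where N2: "negligible N2" "\<And>x e. x \<notin> N2 \<Longrightarrow> e > 0 \<Longrightarrow>
      \<exists>d>0. \<forall>h. 0 \<le> h \<and> h < d \<longrightarrow> \<bar>integral {x..x + h} (\<lambda>x. f (- x)) - f (- x) * h\<bar> \<le> e * h"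
    by blast
  have "negligible (uminus ` N2)"
    by (rule negligible_differentiable_image_negligible[OF _ N2(1)]) (auto intro!: derivative_intros)
  then have "negligible (N1 \<union> uminus ` N2)" using N1(1) by simp
  then show ?thesis
  proof (rule that)
    fix x e :: real assume x: "x \<notin> N1 \<union> uminus ` N2" and "e > 0"
    then have "- x \<notin> N2" by force
    with N2(2)[of "- x" e] \<open>e > 0\<close> obtain d2 where "d2 > 0" and
      d2: "\<And>h. 0 \<le> h \<Longrightarrow> h < d2 \<Longrightarrow> \<bar>integral {- x..- x + h} (\<lambda>x. f (- x)) - f x * h\<bar> \<le> e * h"
      by auto
    from N1(2)[of x e] x \<open>e > 0\<close> obtain d1 where "d1 > 0" and
      d1: "\<And>h. 0 \<le> h \<Longrightarrow> h < d1 \<Longrightarrow> \<bar>integral {x..x + h} f - f x * h\<bar> \<le> e * h"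
      by auto
    have "\<bar>integral {a..b} f - f x * (b - a)\<bar> \<le> e * (b - a)"
      if "a \<le> x" "x \<le> b" "b - a < min d1 d2" for a b
    proof -
      have "\<bar>integral {x..b} f - f x * (b - x)\<bar> \<le> e * (b - x)"
        using d1[of "b - x"] that by simp
      moreover have "\<bar>integral {a..x} f - f x * (x - a)\<bar> \<le> e * (x - a)"
        using d2[of "x - a"] that Henstock_Kurzweil_Integration.integral_reflect_real[where f = f and a = a and b = x] by simp
      moreover have "integral {a..x} f + integral {x..b} f = integral {a..b} f"
        using that f by (intro Henstock_Kurzweil_Integration.integral_combine) auto
      moreover have "f x * (b - a) = f x * (b - x) + f x * (x - a)" "e * (b - a) = e * (b - x) + e * (x - a)"
        by (simp_all add: algebra_simps)
      ultimately show ?thesis by linarith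
    qed
    with \<open>d1 > 0\<close> \<open>d2 > 0\<close> show "\<exists>d>0. \<forall>a b. a \<le> x \<and> x \<le> b \<and> b - a < d \<longrightarrow>
        \<bar>integral {a..b} f - f x * (b - a)\<bar> \<le> e * (b - a)"
      by (intro exI[of _ "min d1 d2"]) auto
  qed
qed

text \<open>Differentiate the integral of \<open>\<bar>g t - r\<bar>\<close> for the countably many
  rational \<open>r\<close>, then pick \<open>r\<close> within \<open>e / 3\<close> of
  \<open>g x\<close>. The absolute value inside the integral is what permits averages against a
  weight that varies over the cell.\<close>

lemma lebesgue_points:
  fixes g :: "real \<Rightarrow> real"
  assumes g: "g absolutely_integrable_on UNIV"
  obtains N where "negligible N"
    "\<And>x e. x \<notin> N \<Longrightarrow> e > 0 \<Longrightarrow> \<exists>d>0. \<forall>a b. a \<le> x \<and> x \<le> b \<and> b - a < d \<longrightarrow>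
      integral {a..b} (\<lambda>t. \<bar>g t - g x\<bar>) \<le> e * (b - a)"
proof -
  have abs_int: "(\<lambda>t. \<bar>g t - r\<bar>) integrable_on {a..b}" for a b r
  proof -
    have "(\<lambda>t. g t - r) absolutely_integrable_on {a..b}"
      by (intro set_integral_diff(1) set_integrable_subset[OF g])
        (auto intro: absolutely_integrable_continuous_real)
    then show ?thesis by (simp add: absolutely_integrable_on_def)
  qed
  have "\<exists>N. negligible N \<and> (\<forall>x e. x \<notin> N \<longrightarrow> e > 0 \<longrightarrow> (\<exists>d>0. \<forall>a b. a \<le> x \<and> x \<le> b \<and> b - a < d \<longrightarrow>
      \<bar>integral {a..b} (\<lambda>t. \<bar>g t - r\<bar>) - \<bar>g x - r\<bar> * (b - a)\<bar> \<le> e * (b - a)))" for r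
    using lebesgue_differentiation_two_sided[OF abs_int[of r]] by metis
  then obtain N where N: "\<And>r. negligible (N r)"
    "\<And>r x e. x \<notin> N r \<Longrightarrow> e > 0 \<Longrightarrow> \<exists>d>0. \<forall>a b. a \<le> x \<and> x \<le> b \<and> b - a < d \<longrightarrow>
      \<bar>integral {a..b} (\<lambda>t. \<bar>g t - r\<bar>) - \<bar>g x - r\<bar> * (b - a)\<bar> \<le> e * (b - a)"
    by metis
  have "negligible (\<Union>r\<in>\<rat>. N r)"
    using N(1) countable_rat by (intro negligible_countable_Union) auto
  then show ?thesis
  proof (rule that)
    fix x e :: real assume x: "x \<notin> (\<Union>r\<in>\<rat>. N r)" and "e > 0"
    obtain r where "r \<in> \<rat>" "g x - e / 3 < r" "r < g x + e / 3"
      using Rats_dense_in_real[of "g x - e / 3" "g x + e / 3"] \<open>e > 0\<close> by auto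
    then have r: "r \<in> \<rat>" "\<bar>g x - r\<bar> < e / 3" by (auto simp only: abs_less_iff)
    obtain d where "d > 0" and d: "\<And>a b. a \<le> x \<Longrightarrow> x \<le> b \<Longrightarrow> b - a < d \<Longrightarrow>
      \<bar>integral {a..b} (\<lambda>t. \<bar>g t - r\<bar>) - \<bar>g x - r\<bar> * (b - a)\<bar> \<le> e / 3 * (b - a)"
    proof -
      have "x \<notin> N r" "e / 3 > 0" using x r(1) \<open>e > 0\<close> by auto
      from N(2)[OF this] show ?thesis using that by blast
    qed
    have "integral {a..b} (\<lambda>t. \<bar>g t - g x\<bar>) \<le> e * (b - a)" if "a \<le> x" "x \<le> b" "b - a < d" for a b
    proof -
      have "integral {a..b} (\<lambda>t. \<bar>g t - g x\<bar>) \<le> integral {a..b} (\<lambda>t. \<bar>g t - r\<bar> + \<bar>g x - r\<bar>)"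
        by (intro integral_le integrable_add abs_int integrable_on_const) auto
      also have "\<dots> = integral {a..b} (\<lambda>t. \<bar>g t - r\<bar>) + \<bar>g x - r\<bar> * (b - a)"
        using that by (subst Henstock_Kurzweil_Integration.integral_add) (auto intro: abs_int)
      also have "\<dots> \<le> (\<bar>g x - r\<bar> * (b - a) + e / 3 * (b - a)) + \<bar>g x - r\<bar> * (b - a)"
        using d[OF that] by linarith
      also have "\<dots> \<le> (e / 3 * (b - a) + e / 3 * (b - a)) + e / 3 * (b - a)"
        using r that by (intro add_mono mult_right_mono) auto
      finally show ?thesis by simp
    qed
    with \<open>d > 0\<close> show "\<exists>d>0. \<forall>a b. a \<le> x \<and> x \<le> b \<and> b - a < d \<longrightarrow>
      integral {a..b} (\<lambda>t. \<bar>g t - g x\<bar>) \<le> e * (b - a)" by blast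
  qed
qed

text \<open>Cells are half-open on the right to agree with \<open>nodal_index\<close>, which picks
  the last node not exceeding \<open>x\<close>. On an increasing partition the value at the right
  end is thus 0.\<close>

definition step_fun :: "nat \<Rightarrow> (nat \<Rightarrow> real) \<Rightarrow> (nat \<Rightarrow> real) \<Rightarrow> real \<Rightarrow> real"
  where "step_fun n X c x = (\<Sum>i<n. c i * indicator {X i..<X (Suc i)} x)"

context
  fixes n :: nat and X :: "nat \<Rightarrow> real" and l r :: real
  assumes ends: "X 0 = l" "X n = r" and incr: "\<And>i. i < n \<Longrightarrow> X i < X (Suc i)"
begin

lemma partition_mono: "i \<le> j \<Longrightarrow> j \<le> n \<Longrightarrow> X i \<le> X j"
proof (induction j rule: dec_induct)
  case (step j)
  then show ?case using incr[of j] by simp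
qed simp

lemma partition_bounds: "i \<le> n \<Longrightarrow> l \<le> X i \<and> X i \<le> r"
  using partition_mono[of 0 i] partition_mono[of i n] ends by auto

lemma partition_cell_unique:
  assumes "i < n" "j < n" "x \<in> {X i..<X (Suc i)}" "x \<in> {X j..<X (Suc j)}"
  shows "i = j"
proof -
  have False if "i < j" "i < n" "j < n" "x < X (Suc i)" "X j \<le> x" for i j
    using partition_mono[of "Suc i" j] that by auto
  from this[of i j] this[of j i] show ?thesis using assms by (cases i j rule: linorder_cases) auto
qed

lemma partition_cell_exists:
  assumes "l \<le> x" "x < r"
  obtains i where "i < n" "x \<in> {X i..<X (Suc i)}"
proof -
  define i where "i = Max {i. i \<le> n \<and> X i \<le> x}"
  have fin: "finite {i. i \<le> n \<and> X i \<le> x}" by simp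
  have "0 \<in> {i. i \<le> n \<and> X i \<le> x}" using ends assms by auto
  then have "i \<in> {i. i \<le> n \<and> X i \<le> x}" unfolding i_def using fin by (intro Max_in) auto
  then have i: "i \<le> n" "X i \<le> x" by auto
  then have "i < n" using assms ends by (metis leD le_neq_implies_less)
  moreover have "x < X (Suc i)"
  proof (rule ccontr)
    assume "\<not> x < X (Suc i)"
    then have "Suc i \<in> {i. i \<le> n \<and> X i \<le> x}" using \<open>i < n\<close> by auto
    then have "Suc i \<le> i" unfolding i_def using fin by (intro Max_ge)
    then show False by simp
  qed
  ultimately show ?thesis using that i by auto
qed

lemma step_fun_eq:
  assumes "i < n" "x \<in> {X i..<X (Suc i)}"
  shows "step_fun n X c x = c i"
proof -
  have "step_fun n X c x = (\<Sum>j<n. if j = i then c i else 0)"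
    unfolding step_fun_def
  proof (intro sum.cong refl)
    fix j assume "j \<in> {..<n}"
    then have "x \<in> {X j..<X (Suc j)} \<longleftrightarrow> j = i"
      using assms partition_cell_unique[OF assms(1) _ assms(2), of j] by auto
    then show "c j * indicator {X j..<X (Suc j)} x = (if j = i then c i else 0)"
      by (simp add: indicator_def)
  qed
  then show ?thesis using assms by simp
qed

lemma step_fun_has_integral:
  "(step_fun n X c has_integral (\<Sum>i<n. c i * (X (Suc i) - X i))) {l..r}"
  unfolding step_fun_def
proof (intro has_integral_sum has_integral_mult_right)
  fix i assume "i \<in> {..<n}"
  then have i: "l \<le> X i" "X i < X (Suc i)" "X (Suc i) \<le> r"
    using partition_bounds[of i] partition_bounds[of "Suc i"] incr by auto
  have "((\<lambda>_. 1::real) has_integral (X (Suc i) - X i)) {X i..X (Suc i)}"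
    using has_integral_const_real[of "1::real" "X i" "X (Suc i)"] i by simp
  then have "((\<lambda>x. if x \<in> {X i..X (Suc i)} then 1::real else 0) has_integral (X (Suc i) - X i)) {l..r}"
    using i by (subst has_integral_restrict) auto
  then show "(indicator {X i..<X (Suc i)} has_integral (X (Suc i) - X i)) {l..r}"
    by (rule has_integral_spike_finite[of "{X (Suc i)}", rotated 2]) (auto simp: indicator_def)
qed simp

lemma step_fun_absolutely_integrable: "step_fun n X c absolutely_integrable_on {l..r}"
proof -
  have "step_fun n X c integrable_on {l..r}" using step_fun_has_integral by blast
  moreover have "step_fun n X (\<lambda>i. \<bar>c i\<bar>) integrable_on {l..r}" using step_fun_has_integral by blast
  ultimately show ?thesis
  proof (rule absolutely_integrable_integrable_bound[rotated])
    fix x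
    show "norm (step_fun n X c x) \<le> step_fun n X (\<lambda>i. \<bar>c i\<bar>) x"
      unfolding step_fun_def by (rule order_trans[OF norm_sum]) (simp add: abs_mult)
  qed
qed

lemma integral_partition:
  fixes f :: "real \<Rightarrow> real"
  assumes "f integrable_on {l..r}"
  shows "(\<Sum>i<n. integral {X i..X (Suc i)} f) = integral {l..r} f"
proof -
  have "(\<Sum>i<k. integral {X i..X (Suc i)} f) = integral {l..X k} f" if "k \<le> n" for k
    using that
  proof (induction k)
    case 0 then show ?case using ends by simp
  next
    case (Suc k)
    have "integral {l..X k} f + integral {X k..X (Suc k)} f = integral {l..X (Suc k)} f"
      using Suc.prems partition_bounds[of k] partition_bounds[of "Suc k"] incr[of k]
      by (intro Henstock_Kurzweil_Integration.integral_combine integrable_on_subinterval[OF assms]) auto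
    then show ?case using Suc by simp
  qed
  from this[of n] show ?thesis using ends by simp
qed

end

lemma dominated_convergence_const_ae:
  fixes f :: "nat \<Rightarrow> real \<Rightarrow> real"
  assumes N: "negligible N" and int: "\<And>k. f k integrable_on {a..b}"
    and bound: "\<And>k x. x \<in> {a..b} \<Longrightarrow> \<bar>f k x\<bar> \<le> B"
    and lim: "\<And>x. x \<in> {a..b} - N \<Longrightarrow> (\<lambda>k. f k x) \<longlonglongrightarrow> 0"
  shows "(\<lambda>k. integral {a..b} (f k)) \<longlonglongrightarrow> 0"
proof -
  define g where "g k x = (if x \<in> N then 0 else f k x)" for k x
  have "(\<lambda>k. integral {a..b} (g k)) \<longlonglongrightarrow> integral {a..b} (\<lambda>_. 0)"
  proof (rule dominated_convergence(2))
    show "g k integrable_on {a..b}" for k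
      by (rule integrable_spike[OF int N]) (auto simp: g_def)
    show "(\<lambda>_. \<bar>B\<bar>) integrable_on {a..b}" by (simp add: integrable_on_const)
    show "norm (g k x) \<le> \<bar>B\<bar>" if "x \<in> {a..b}" for k x
      using bound[OF that, of k] by (auto simp: g_def)
    show "(\<lambda>k. g k x) \<longlonglongrightarrow> 0" if "x \<in> {a..b}" for x
      using lim[of x] that by (cases "x \<in> N") (auto simp: g_def)
  qed
  moreover have "integral {a..b} (g k) = integral {a..b} (f k)" for k
    by (rule integral_spike[OF N]) (auto simp: g_def)
  ultimately show ?thesis by simp
qed

text \<open>The real-analysis core, detached from the equation. \<open>mass\<close> is scaled by
  \<open>n\<close> because the averages multiply a cell integral by \<open>n\<close>. Indices below
  \<open>n0\<close> are left out since low eigenvalues need not be positive.\<close>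

locale weighted_partitions =
  fixes p :: real and X :: "nat \<Rightarrow> nat \<Rightarrow> real" and W :: "nat \<Rightarrow> real \<Rightarrow> real"
    and \<epsilon> :: "nat \<Rightarrow> real" and n0 :: nat
  assumes p: "p > 0"
    and X_0: "n \<ge> n0 \<Longrightarrow> X n 0 = 0" and X_n: "n \<ge> n0 \<Longrightarrow> X n n = 1"
    and X_incr: "n \<ge> n0 \<Longrightarrow> i < n \<Longrightarrow> X n i < X n (Suc i)"
    and W_cont: "n \<ge> n0 \<Longrightarrow> continuous_on {0..1} (W n)"
    and W_nonneg: "n \<ge> n0 \<Longrightarrow> x \<in> {0..1} \<Longrightarrow> 0 \<le> W n x"
    and W_le_1: "n \<ge> n0 \<Longrightarrow> x \<in> {0..1} \<Longrightarrow> W n x \<le> 1"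
    and mesh: "n \<ge> n0 \<Longrightarrow> i < n \<Longrightarrow> \<bar>real n * (X n (Suc i) - X n i) - 1\<bar> \<le> \<epsilon> n"
    and mass: "n \<ge> n0 \<Longrightarrow> i < n \<Longrightarrow>
      \<bar>real n * (X n (Suc i) - X n i - p * integral {X n i..X n (Suc i)} (W n))\<bar> \<le> \<epsilon> n"
    and \<epsilon>_tendsto: "\<epsilon> \<longlonglongrightarrow> 0"
begin

text \<open>Close to the mean of \<open>g\<close> over the cell: the cell has length about
  \<open>1 / n\<close>, and \<open>p * W n\<close> has mean about 1 on it.\<close>

definition coef :: "nat \<Rightarrow> (real \<Rightarrow> real) \<Rightarrow> nat \<Rightarrow> real"
  where "coef n g i = p * real n * integral {X n i..X n (Suc i)} (\<lambda>t. g t * W n t)"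

definition avg :: "nat \<Rightarrow> (real \<Rightarrow> real) \<Rightarrow> real \<Rightarrow> real"
  where "avg n g = step_fun n (X n) (coef n g)"

lemma n_pos: "n \<ge> n0 \<Longrightarrow> n > 0"
  using X_0[of n] X_n[of n] by (cases n) auto

lemma cell_bounds:
  assumes "n \<ge> n0" "i < n"
  shows "0 \<le> X n i" "X n i < X n (Suc i)" "X n (Suc i) \<le> 1"
  using partition_bounds[where X = "X n" and n = n, OF X_0[OF assms(1)] X_n[OF assms(1)] X_incr[OF assms(1)]] X_incr[OF assms] assms
  by (metis Suc_leI less_imp_le)+

lemma cell_subset: "n \<ge> n0 \<Longrightarrow> i < n \<Longrightarrow> {X n i..X n (Suc i)} \<subseteq> {0..1}"
  using cell_bounds by auto

lemma cell_exists:
  assumes "n \<ge> n0" "x \<in> {0..1}" "x \<noteq> 1"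
  shows "\<exists>i<n. x \<in> {X n i..<X n (Suc i)}"
  using partition_cell_exists[where X = "X n" and n = n,
      OF X_0[OF assms(1)] X_n[OF assms(1)] X_incr[OF assms(1)], of x] assms(2,3)
  by (metis atLeastAtMost_iff le_neq_trans)

lemma weighted_integrable:
  assumes "n \<ge> n0" "g absolutely_integrable_on {0..1}"
  shows "(\<lambda>t. g t * W n t) absolutely_integrable_on {0..1}"
proof -
  have "(\<lambda>t. W n t * g t) absolutely_integrable_on {0..1}"
  proof (rule absolutely_integrable_bounded_measurable_product_real)
    show "W n \<in> borel_measurable (lebesgue_on {0..1})"
      by (rule continuous_imp_measurable_on_sets_lebesgue[OF W_cont[OF assms(1)]]) simp
    show "bounded (W n ` {0..1})"
      using W_nonneg[OF assms(1)] W_le_1[OF assms(1)] by (auto simp: bounded_iff intro!: exI[of _ 1])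
  qed (use assms in auto)
  then show ?thesis by (simp add: mult.commute)
qed

lemma cell_integrable:
  assumes "n \<ge> n0" "i < n" "g absolutely_integrable_on {0..1}"
  shows "g integrable_on {X n i..X n (Suc i)}" "(\<lambda>t. \<bar>g t\<bar>) integrable_on {X n i..X n (Suc i)}"
    "(\<lambda>t. g t * W n t) integrable_on {X n i..X n (Suc i)}"
  using set_integrable_subset[OF assms(3) _ cell_subset[OF assms(1,2)]]
    set_integrable_subset[OF weighted_integrable[OF assms(1,3)] _ cell_subset[OF assms(1,2)]]
  by (auto simp: absolutely_integrable_on_def)

lemma cell_integral_bound:
  assumes n: "n \<ge> n0" "i < n" and g: "g absolutely_integrable_on {0..1}"
  shows "\<bar>integral {X n i..X n (Suc i)} (\<lambda>t. g t * W n t)\<bar> \<le> integral {X n i..X n (Suc i)} (\<lambda>t. \<bar>g t\<bar>)"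
  unfolding real_norm_def[symmetric]
proof (rule integral_norm_bound_integral)
  fix x assume "x \<in> {X n i..X n (Suc i)}"
  then have "x \<in> {0..1}" using cell_subset[OF n] by auto
  then have "\<bar>g x\<bar> * \<bar>W n x\<bar> \<le> \<bar>g x\<bar> * 1"
    using W_nonneg[OF n(1)] W_le_1[OF n(1)] by (intro mult_left_mono) auto
  then show "norm (g x * W n x) \<le> norm (g x)" by (simp add: abs_mult)
qed (use cell_integrable[OF n g] in auto)

lemma avg_absolutely_integrable: "n \<ge> n0 \<Longrightarrow> avg n g absolutely_integrable_on {0..1}"
  unfolding avg_def by (rule step_fun_absolutely_integrable) (auto intro: X_0 X_n X_incr)

lemma avg_cell: "n \<ge> n0 \<Longrightarrow> i < n \<Longrightarrow> x \<in> {X n i..<X n (Suc i)} \<Longrightarrow> avg n g x = coef n g i"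
  unfolding avg_def by (rule step_fun_eq) (auto intro: X_0 X_n X_incr)

lemma avg_at_1: "n \<ge> n0 \<Longrightarrow> avg n g 1 = 0"
  unfolding avg_def step_fun_def using cell_bounds by (intro sum.neutral) (force simp: indicator_def)

lemma avg_add:
  assumes n: "n \<ge> n0" and g: "g absolutely_integrable_on {0..1}" and h: "h absolutely_integrable_on {0..1}"
  shows "avg n (\<lambda>t. g t + h t) x = avg n g x + avg n h x"
proof -
  have "coef n (\<lambda>t. g t + h t) i = coef n g i + coef n h i" if "i < n" for i
    unfolding coef_def distrib_left[symmetric] distrib_right
    by (subst Henstock_Kurzweil_Integration.integral_add) (auto intro: cell_integrable n g h that)
  then show ?thesis
    unfolding avg_def step_fun_def by (simp add: distrib_right sum.distrib)
qed

lemma integral_avg: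
  assumes n: "n \<ge> n0"
  shows "integral {0..1} (avg n g) =
    (\<Sum>i<n. p * (real n * (X n (Suc i) - X n i)) * integral {X n i..X n (Suc i)} (\<lambda>t. g t * W n t))"
proof -
  have "integral {0..1} (avg n g) = (\<Sum>i<n. coef n g i * (X n (Suc i) - X n i))"
    unfolding avg_def using X_0[OF n] X_n[OF n] X_incr[OF n]
    by (intro integral_unique step_fun_has_integral) auto
  then show ?thesis by (simp add: coef_def mult_ac)
qed

lemma integral_cells:
  fixes f :: "real \<Rightarrow> real"
  assumes "n \<ge> n0" "f integrable_on {0..1}"
  shows "(\<Sum>i<n. integral {X n i..X n (Suc i)} f) = integral {0..1} f"
  using X_0[OF assms(1)] X_n[OF assms(1)] X_incr[OF assms(1)] assms(2) by (intro integral_partition) auto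

text \<open>Uniform boundedness on \<open>L^1\<close>, from \<open>W n \<le> 1\<close> and the fact
  that \<open>n\<close> times a cell length is at most \<open>1 + \<epsilon> n\<close>. It makes the
  unbounded part of \<open>g\<close> negligible after truncation.\<close>

lemma avg_contraction:
  assumes n: "n \<ge> n0" and g: "g absolutely_integrable_on {0..1}"
  shows "integral {0..1} (\<lambda>x. \<bar>avg n g x\<bar>) \<le> p * (1 + \<epsilon> n) * integral {0..1} (\<lambda>x. \<bar>g x\<bar>)"
proof -
  have int: "((\<lambda>x. \<bar>avg n g x\<bar>) has_integral (\<Sum>i<n. \<bar>coef n g i\<bar> * (X n (Suc i) - X n i))) {0..1}"
  proof -
    have eq: "\<bar>avg n g x\<bar> = step_fun n (X n) (\<lambda>i. \<bar>coef n g i\<bar>) x" if x: "x \<in> {0..1} - {1}" for x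
    proof -
      obtain i where i: "i < n" "x \<in> {X n i..<X n (Suc i)}"
        using cell_exists[OF n, of x] x by blast
      show ?thesis unfolding avg_cell[OF n i]
        using X_0[OF n] X_n[OF n] X_incr[OF n] i by (intro step_fun_eq[symmetric]) auto
    qed
    have step: "(step_fun n (X n) (\<lambda>i. \<bar>coef n g i\<bar>) has_integral (\<Sum>i<n. \<bar>coef n g i\<bar> * (X n (Suc i) - X n i))) {0..1}"
      using X_0[OF n] X_n[OF n] X_incr[OF n] by (intro step_fun_has_integral) auto
    show ?thesis by (rule has_integral_spike_finite[of "{1}", OF _ eq step]) auto
  qed
  have "(\<Sum>i<n. \<bar>coef n g i\<bar> * (X n (Suc i) - X n i))
      \<le> (\<Sum>i<n. p * (1 + \<epsilon> n) * integral {X n i..X n (Suc i)} (\<lambda>t. \<bar>g t\<bar>))"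
  proof (rule sum_mono)
    fix i assume "i \<in> {..<n}"
    then have i: "i < n" by simp
    let ?G = "integral {X n i..X n (Suc i)} (\<lambda>t. g t * W n t)"
    have "\<bar>coef n g i\<bar> * (X n (Suc i) - X n i) = p * (real n * (X n (Suc i) - X n i)) * \<bar>?G\<bar>"
      using p by (simp add: coef_def abs_mult)
    also have "\<dots> \<le> p * (1 + \<epsilon> n) * integral {X n i..X n (Suc i)} (\<lambda>t. \<bar>g t\<bar>)"
      using mesh[OF n i] cell_integral_bound[OF n i g] cell_bounds[OF n i] p
      by (intro mult_mono) auto
    finally show "\<bar>coef n g i\<bar> * (X n (Suc i) - X n i) \<le> p * (1 + \<epsilon> n) * integral {X n i..X n (Suc i)} (\<lambda>t. \<bar>g t\<bar>)" .
  qed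
  also have "\<dots> = p * (1 + \<epsilon> n) * integral {0..1} (\<lambda>t. \<bar>g t\<bar>)"
    unfolding sum_distrib_left[symmetric] using g
    by (subst integral_cells[OF n]) (auto simp: absolutely_integrable_on_def)
  finally show ?thesis using int by (simp add: integral_unique)
qed

text \<open>Integrating the step function multiplies each cell integral by \<open>n\<close> times
  the cell length, which \<open>mesh\<close> compares with 1.\<close>

lemma integral_avg_error:
  assumes n: "n \<ge> n0" and g: "g absolutely_integrable_on {0..1}"
  shows "\<bar>integral {0..1} (avg n g) - p * integral {0..1} (\<lambda>t. g t * W n t)\<bar>
    \<le> p * \<epsilon> n * integral {0..1} (\<lambda>x. \<bar>g x\<bar>)"
proof -
  let ?G = "\<lambda>i. integral {X n i..X n (Suc i)} (\<lambda>t. g t * W n t)"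
  have "integral {0..1} (\<lambda>t. g t * W n t) = (\<Sum>i<n. ?G i)"
    using weighted_integrable[OF n g] by (subst integral_cells[OF n]) (auto simp: absolutely_integrable_on_def)
  then have eq: "integral {0..1} (avg n g) - p * integral {0..1} (\<lambda>t. g t * W n t)
      = (\<Sum>i<n. p * (real n * (X n (Suc i) - X n i) - 1) * ?G i)"
    unfolding integral_avg[OF n] by (simp add: sum_distrib_left sum_subtractf[symmetric] algebra_simps)
  have "\<bar>integral {0..1} (avg n g) - p * integral {0..1} (\<lambda>t. g t * W n t)\<bar>
      \<le> (\<Sum>i<n. \<bar>p * (real n * (X n (Suc i) - X n i) - 1) * ?G i\<bar>)"
    unfolding eq by (rule sum_abs)
  also have "\<dots> \<le> (\<Sum>i<n. p * \<epsilon> n * integral {X n i..X n (Suc i)} (\<lambda>t. \<bar>g t\<bar>))"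
  proof (rule sum_mono)
    fix i assume "i \<in> {..<n}"
    then have i: "i < n" by simp
    have "\<epsilon> n \<ge> 0" using mesh[OF n i] by linarith
    then show "\<bar>p * (real n * (X n (Suc i) - X n i) - 1) * ?G i\<bar> \<le> p * \<epsilon> n * integral {X n i..X n (Suc i)} (\<lambda>t. \<bar>g t\<bar>)"
      unfolding abs_mult using mesh[OF n i] cell_integral_bound[OF n i g] p
      by (intro mult_mono) auto
  qed
  also have "\<dots> = p * \<epsilon> n * integral {0..1} (\<lambda>t. \<bar>g t\<bar>)"
    unfolding sum_distrib_left[symmetric] using g
    by (subst integral_cells[OF n]) (auto simp: absolutely_integrable_on_def)
  finally show ?thesis .
qed

text \<open>Write \<open>g\<close> as \<open>(g - c) + c\<close>. The constant part contributes
  \<open>c\<close> times \<open>p n\<close> times the integral of \<open>W n\<close>, minus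
  \<open>c\<close>; this is \<open>c\<close> times a difference of two quantities bounded by
  \<open>mesh\<close> and by \<open>mass\<close>, hence the factor 2.\<close>

lemma avg_error:
  assumes n: "n \<ge> n0" and i: "i < n" and g: "g absolutely_integrable_on {0..1}"
  shows "\<bar>coef n g i - c\<bar> \<le> p * real n * integral {X n i..X n (Suc i)} (\<lambda>t. \<bar>g t - c\<bar>) + 2 * \<epsilon> n * \<bar>c\<bar>"
proof -
  let ?I = "{X n i..X n (Suc i)}"
  have const: "(\<lambda>t::real. c) absolutely_integrable_on {0..1}"
    by (rule absolutely_integrable_continuous_real[OF continuous_on_const])
  then have gc: "(\<lambda>t. g t - c) absolutely_integrable_on {0..1}"
    using g by (intro set_integral_diff(1))
  have "integral ?I (\<lambda>t. g t * W n t) = integral ?I (\<lambda>t. (g t - c) * W n t + c * W n t)"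
    by (simp add: algebra_simps)
  also have "\<dots> = integral ?I (\<lambda>t. (g t - c) * W n t) + c * integral ?I (W n)"
    using cell_integrable(3)[OF n i gc] cell_integrable(3)[OF n i const]
    by (subst Henstock_Kurzweil_Integration.integral_add) auto
  finally have eq: "coef n g i - c = p * real n * integral ?I (\<lambda>t. (g t - c) * W n t)
      + c * ((real n * (X n (Suc i) - X n i) - 1) - real n * (X n (Suc i) - X n i - p * integral ?I (W n)))"
    by (simp add: coef_def algebra_simps)
  have "\<bar>coef n g i - c\<bar> \<le> p * real n * \<bar>integral ?I (\<lambda>t. (g t - c) * W n t)\<bar> + \<bar>c\<bar> *
      \<bar>(real n * (X n (Suc i) - X n i) - 1) - real n * (X n (Suc i) - X n i - p * integral ?I (W n))\<bar>"
    unfolding eq using p by (intro order_trans[OF abs_triangle_ineq]) (simp add: abs_mult)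
  also have "\<dots> \<le> p * real n * integral ?I (\<lambda>t. \<bar>g t - c\<bar>) + \<bar>c\<bar> * (\<epsilon> n + \<epsilon> n)"
    using p cell_integral_bound[OF n i gc]
    by (intro add_mono mult_left_mono order_trans[OF abs_triangle_ineq4] mesh mass n i) auto
  finally show ?thesis by (simp add: algebra_simps)
qed

theorem avg_tendsto_ae:
  assumes g: "g absolutely_integrable_on {0..1}"
  obtains N where "negligible N" "\<And>x. x \<in> {0..1} - N \<Longrightarrow> (\<lambda>n. avg n g x) \<longlonglongrightarrow> g x"
proof -
  define g0 where "g0 x = (if x \<in> {0..1} then g x else 0)" for x
  have "g0 absolutely_integrable_on UNIV"
    using g unfolding g0_def by (rule absolutely_integrable_restrict_UNIV[THEN iffD2])
  then obtain N where N: "negligible N"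
    "\<And>x e. x \<notin> N \<Longrightarrow> e > 0 \<Longrightarrow> \<exists>d>0. \<forall>a b. a \<le> x \<and> x \<le> b \<and> b - a < d \<longrightarrow>
      integral {a..b} (\<lambda>t. \<bar>g0 t - g0 x\<bar>) \<le> e * (b - a)"
    using lebesgue_points by metis
  show ?thesis
  \<comment> \<open>The point 1 belongs to no half-open cell.\<close>
  proof (rule that[of "N \<union> {1}"])
    show "negligible (N \<union> {1})" using N(1) by simp
    fix x assume x: "x \<in> {0..1} - (N \<union> {1})"
    show "(\<lambda>n. avg n g x) \<longlonglongrightarrow> g x"
    proof (rule LIMSEQ_I)
      fix r :: real assume "r > 0"
      \<comment> \<open>Eventually \<open>n\<close> times a cell length is at most 2, so the first
        term of \<open>avg_error\<close> is at most \<open>2 * p * e = r / 2\<close>.\<close>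
      define e where "e = r / (4 * p)"
      have "e > 0" using \<open>r > 0\<close> p by (simp add: e_def)
      then obtain d where "d > 0" and d: "\<And>a b. a \<le> x \<Longrightarrow> x \<le> b \<Longrightarrow> b - a < d \<Longrightarrow>
          integral {a..b} (\<lambda>t. \<bar>g0 t - g0 x\<bar>) \<le> e * (b - a)"
        using N(2)[of x e] x by auto
      have "\<forall>\<^sub>F n in sequentially. \<epsilon> n < 1"
        using \<epsilon>_tendsto by (rule order_tendstoD) simp
      moreover have "(\<lambda>n. 2 * \<epsilon> n * \<bar>g x\<bar>) \<longlonglongrightarrow> 2 * 0 * \<bar>g x\<bar>"
        by (intro tendsto_intros \<epsilon>_tendsto)
      then have "\<forall>\<^sub>F n in sequentially. 2 * \<epsilon> n * \<bar>g x\<bar> < r / 2"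
        by (rule order_tendstoD) (use \<open>r > 0\<close> in simp)
      moreover have "(\<lambda>n. 2 / real n) \<longlonglongrightarrow> 0"
        by (rule lim_const_over_n)
      then have "\<forall>\<^sub>F n in sequentially. 2 / real n < d"
        by (rule order_tendstoD) (use \<open>d > 0\<close> in simp)
      moreover have "\<forall>\<^sub>F n in sequentially. n \<ge> n0" by (rule eventually_ge_at_top)
      ultimately have "\<forall>\<^sub>F n in sequentially. \<bar>avg n g x - g x\<bar> < r"
      proof eventually_elim
        case (elim n)
        note n = elim(4)
        obtain i where i: "i < n" "x \<in> {X n i..<X n (Suc i)}"
          using cell_exists[OF n, of x] x by blast
        have len: "real n * (X n (Suc i) - X n i) \<le> 2"
          using mesh[OF n i(1)] elim(1) by linarith
        then have "X n (Suc i) - X n i \<le> 2 / real n"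
          using n_pos[OF n] by (simp add: field_simps)
        then have small: "X n (Suc i) - X n i < d" using elim(3) by linarith
        have "integral {X n i..X n (Suc i)} (\<lambda>t. \<bar>g t - g x\<bar>) = integral {X n i..X n (Suc i)} (\<lambda>t. \<bar>g0 t - g0 x\<bar>)"
          using cell_subset[OF n i(1)] x by (intro integral_cong) (auto simp: g0_def)
        also have "\<dots> \<le> e * (X n (Suc i) - X n i)"
          using d[of "X n i" "X n (Suc i)"] i small by auto
        finally have "p * real n * integral {X n i..X n (Suc i)} (\<lambda>t. \<bar>g t - g x\<bar>) \<le> p * real n * (e * (X n (Suc i) - X n i))"
          using p by (intro mult_left_mono) auto
        also have "\<dots> = p * e * (real n * (X n (Suc i) - X n i))" by simp
        also have "\<dots> \<le> p * e * 2"
          using p \<open>e > 0\<close> len by (intro mult_left_mono) auto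
        also have "\<dots> = r / 2" using p by (simp add: e_def)
        finally show ?case
          using avg_error[OF n i(1) g, of "g x"] elim(2) unfolding avg_cell[OF n i] by linarith
      qed
      then show "\<exists>no. \<forall>n\<ge>no. norm (avg n g x - g x) < r"
        by (simp add: eventually_sequentially)
    qed
  qed
qed

text \<open>Bounded functions are handled by dominated convergence; the unbounded part is small in the mean
  after truncation, and the averaging operators are uniformly bounded on \<open>L\<^sup>1\<close>.\<close>

theorem avg_tendsto_L1:
  assumes g: "g absolutely_integrable_on {0..1}"
  shows "(\<lambda>n. integral {0..1} (\<lambda>x. \<bar>avg n g x - g x\<bar>)) \<longlonglongrightarrow> 0"
proof (rule LIMSEQ_I)
  fix r :: real assume "r > 0"
  define trunc where "trunc M t = max (- M) (min M (g t))" for M t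
  have trunc_int: "trunc (real M) absolutely_integrable_on {0..1}" for M :: nat
  proof (rule absolutely_integrable_integrable_bound[where g = "\<lambda>t. \<bar>g t\<bar>"])
    have const: "(\<lambda>_::real. c) absolutely_integrable_on {0..1}" for c :: real
      by (rule absolutely_integrable_continuous_real[OF continuous_on_const])
    show "trunc (real M) integrable_on {0..1}"
      unfolding trunc_def
      by (intro set_lebesgue_integral_eq_integral(1) absolutely_integrable_max_1 absolutely_integrable_min_1 const g)
  qed (use g in \<open>auto simp: trunc_def absolutely_integrable_on_def\<close>)
  have "(\<lambda>M. integral {0..1} (\<lambda>t. \<bar>g t - trunc (real M) t\<bar>)) \<longlonglongrightarrow> integral {0..1} (\<lambda>_::real. 0::real)"
  proof (rule dominated_convergence(2))
    show "(\<lambda>t. \<bar>g t - trunc (real M) t\<bar>) integrable_on {0..1}" for M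
      using set_integral_diff(1)[OF g trunc_int[of M]] by (simp add: absolutely_integrable_on_def)
    show "(\<lambda>t. \<bar>g t\<bar>) integrable_on {0..1}" using g by (simp add: absolutely_integrable_on_def)
    show "norm \<bar>g t - trunc (real M) t\<bar> \<le> \<bar>g t\<bar>" for M t by (auto simp: trunc_def)
    fix t :: real
    have "\<forall>\<^sub>F M in sequentially. \<bar>g t\<bar> \<le> real M"
      using filterlim_real_sequentially by (auto simp: filterlim_at_top)
    then have "\<forall>\<^sub>F M in sequentially. \<bar>g t - trunc (real M) t\<bar> = 0"
      by eventually_elim (auto simp: trunc_def)
    then show "(\<lambda>M. \<bar>g t - trunc (real M) t\<bar>) \<longlonglongrightarrow> 0" by (rule tendsto_eventually)
  qed
  \<comment> \<open>Once \<open>\<epsilon> n < 1\<close>, the remainder \<open>h\<close> costs at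
    most \<open>2 * p\<close> times its \<open>L^1\<close> norm through \<open>avg n h\<close>, and
    once more that norm by itself: together \<open>2 * p + 1\<close>.\<close>
  then have "\<forall>\<^sub>F M in sequentially. integral {0..1} (\<lambda>t. \<bar>g t - trunc (real M) t\<bar>) < r / (2 * (2 * p + 1))"
    by (rule order_tendstoD) (use \<open>r > 0\<close> p in \<open>simp add: add_pos_pos\<close>)
  then obtain M :: nat where M: "integral {0..1} (\<lambda>t. \<bar>g t - trunc (real M) t\<bar>) < r / (2 * (2 * p + 1))"
    by (auto simp: eventually_sequentially)
  define b where "b = trunc (real M)"
  define h where "h t = g t - b t" for t
  have b: "b absolutely_integrable_on {0..1}" using trunc_int by (simp add: b_def)
  have h: "h absolutely_integrable_on {0..1}"
    unfolding h_def using g b by (intro set_integral_diff(1))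
  have b_bound: "\<bar>b t\<bar> \<le> real M" for t by (auto simp: b_def trunc_def)
  have ev1: "\<forall>\<^sub>F n in sequentially. \<epsilon> n < 1"
    using \<epsilon>_tendsto by (rule order_tendstoD) simp
  then obtain n1 where n1: "\<And>n. n \<ge> n1 \<Longrightarrow> \<epsilon> n < 1" by (auto simp: eventually_sequentially)
  define n2 where "n2 = max n0 n1"
  obtain N where N: "negligible N" "\<And>x. x \<in> {0..1} - N \<Longrightarrow> (\<lambda>n. avg n b x) \<longlonglongrightarrow> b x"
    using avg_tendsto_ae[OF b] by metis
  have diff_int: "(\<lambda>x. \<bar>avg n f x - f x\<bar>) integrable_on {0..1}"
    if "n \<ge> n0" "f absolutely_integrable_on {0..1}" for n f
    using set_integral_diff(1)[OF avg_absolutely_integrable[OF that(1), of f] that(2)]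
    by (simp add: absolutely_integrable_on_def)
  \<comment> \<open>The shift by \<open>n2\<close> makes the uniform bound valid for every index, as
    dominated convergence requires.\<close>
  have "(\<lambda>k. integral {0..1} (\<lambda>x. \<bar>avg (k + n2) b x - b x\<bar>)) \<longlonglongrightarrow> 0"
  proof (rule dominated_convergence_const_ae[OF N(1)])
    show "(\<lambda>x. \<bar>avg (k + n2) b x - b x\<bar>) integrable_on {0..1}" for k
      by (rule diff_int[OF _ b]) (simp add: n2_def)
    show "\<bar>\<bar>avg (k + n2) b x - b x\<bar>\<bar> \<le> 2 * p * real M + real M" if x: "x \<in> {0..1}" for k x
    proof -
      define n where "n = k + n2"
      have n: "n \<ge> n0" "n \<ge> n1" by (auto simp: n_def n2_def)
      have "\<bar>avg n b x\<bar> \<le> 2 * p * real M"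
      proof (cases "x = 1")
        case True then show ?thesis using avg_at_1[OF n(1)] p by simp
      next
        case False
        obtain i where i: "i < n" "x \<in> {X n i..<X n (Suc i)}"
          using cell_exists[OF n(1) x False] by blast
        have "\<bar>integral {X n i..X n (Suc i)} (\<lambda>t. b t * W n t)\<bar> \<le> integral {X n i..X n (Suc i)} (\<lambda>t. real M)"
          using b_bound cell_integrable[OF n(1) i(1) b]
          by (intro order_trans[OF cell_integral_bound[OF n(1) i(1) b]] integral_le) (auto simp: integrable_on_const)
        also have "\<dots> = real M * (X n (Suc i) - X n i)"
          using cell_bounds[OF n(1) i(1)] by simp
        finally have "\<bar>coef n b i\<bar> \<le> p * real n * (real M * (X n (Suc i) - X n i))"
          using p unfolding coef_def abs_mult by (intro mult_mono) auto
        also have "\<dots> = (p * real M) * (real n * (X n (Suc i) - X n i))" by simp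
        also have "\<dots> \<le> (p * real M) * 2"
          using mesh[OF n(1) i(1)] n1[OF n(2)] p by (intro mult_left_mono) auto
        finally show ?thesis unfolding avg_cell[OF n(1) i] by simp
      qed
      with b_bound[of x] show ?thesis unfolding n_def by linarith
    qed
    fix x assume "x \<in> {0..1} - N"
    from LIMSEQ_ignore_initial_segment[OF N(2)[OF this], of n2]
    have "(\<lambda>k. \<bar>avg (k + n2) b x - b x\<bar>) \<longlonglongrightarrow> \<bar>b x - b x\<bar>"
      by (intro tendsto_intros)
    then show "(\<lambda>k. \<bar>avg (k + n2) b x - b x\<bar>) \<longlonglongrightarrow> 0" by simp
  qed
  then have "(\<lambda>n. integral {0..1} (\<lambda>x. \<bar>avg n b x - b x\<bar>)) \<longlonglongrightarrow> 0"
    by (rule LIMSEQ_offset)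
  then have "\<forall>\<^sub>F n in sequentially. integral {0..1} (\<lambda>x. \<bar>avg n b x - b x\<bar>) < r / 2"
    by (rule order_tendstoD) (use \<open>r > 0\<close> in simp)
  moreover have "\<forall>\<^sub>F n in sequentially. n \<ge> n0" by (rule eventually_ge_at_top)
  ultimately have "\<forall>\<^sub>F n in sequentially. norm (integral {0..1} (\<lambda>x. \<bar>avg n g x - g x\<bar>) - 0) < r"
    using ev1
  proof eventually_elim
    case (elim n)
    note n = elim(2)
    let ?H = "integral {0..1} (\<lambda>x. \<bar>h x\<bar>)"
    have h_abs: "(\<lambda>x. \<bar>h x\<bar>) integrable_on {0..1}" and a_abs: "(\<lambda>x. \<bar>avg n h x\<bar>) integrable_on {0..1}"
      using h avg_absolutely_integrable[OF n, of h] by (auto simp: absolutely_integrable_on_def)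
    have H: "?H \<ge> 0" using h_abs by (intro integral_nonneg) auto
    have "avg n g x = avg n b x + avg n h x" for x
      using avg_add[OF n b h] by (simp add: h_def)
    then have "\<bar>avg n g x - g x\<bar> \<le> \<bar>avg n b x - b x\<bar> + (\<bar>avg n h x\<bar> + \<bar>h x\<bar>)" for x
      by (simp add: h_def abs_le_iff) linarith
    then have "integral {0..1} (\<lambda>x. \<bar>avg n g x - g x\<bar>)
        \<le> integral {0..1} (\<lambda>x. \<bar>avg n b x - b x\<bar> + (\<bar>avg n h x\<bar> + \<bar>h x\<bar>))"
      using n g b h_abs a_abs by (intro integral_le diff_int integrable_add) auto
    also have "\<dots> = integral {0..1} (\<lambda>x. \<bar>avg n b x - b x\<bar>) + (integral {0..1} (\<lambda>x. \<bar>avg n h x\<bar>) + ?H)"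
      using n b h_abs a_abs diff_int[OF n b]
      by (simp add: Henstock_Kurzweil_Integration.integral_add integrable_add)
    also have "\<dots> \<le> integral {0..1} (\<lambda>x. \<bar>avg n b x - b x\<bar>) + (p * (1 + \<epsilon> n) * ?H + ?H)"
      using avg_contraction[OF n h] by simp
    also have "\<dots> \<le> integral {0..1} (\<lambda>x. \<bar>avg n b x - b x\<bar>) + (p * 2 * ?H + ?H)"
      using p H elim(3) by (intro add_left_mono add_right_mono mult_right_mono mult_left_mono) auto
    also have "p * 2 * ?H + ?H = (2 * p + 1) * ?H" by (simp add: algebra_simps)
    also have "\<dots> \<le> (2 * p + 1) * (r / (2 * (2 * p + 1)))"
      using M p by (intro mult_left_mono) (auto simp: h_def b_def)
    also have "\<dots> = r / 2" using p by (simp add: field_simps)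
    finally have "integral {0..1} (\<lambda>x. \<bar>avg n g x - g x\<bar>) < r" using elim(1) by linarith
    moreover have "integral {0..1} (\<lambda>x. \<bar>avg n g x - g x\<bar>) \<ge> 0"
      by (intro integral_nonneg diff_int n g) auto
    ultimately show ?case by simp
  qed
  then show "\<exists>no. \<forall>n\<ge>no. norm (integral {0..1} (\<lambda>x. \<bar>avg n g x - g x\<bar>) - 0) < r"
    by (simp add: eventually_sequentially)
qed

text \<open>\<open>L^1\<close> convergence gives convergence of the integrals of
  \<open>avg n g\<close>, and these differ from the weighted integrals by a multiple of
  \<open>\<epsilon> n\<close>. For \<open>g = q\<close> this yields the coefficient in the
  eigenvalue expansion.\<close>

corollary weighted_integral_tendsto:
  assumes g: "g absolutely_integrable_on {0..1}"
  shows "(\<lambda>n. p * integral {0..1} (\<lambda>t. g t * W n t)) \<longlonglongrightarrow> integral {0..1} g"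
proof -
  have g_int: "g integrable_on {0..1}" using g by (simp add: absolutely_integrable_on_def)
  have "(\<lambda>n. integral {0..1} (avg n g) - integral {0..1} g) \<longlonglongrightarrow> 0"
  proof (rule Lim_null_comparison[OF _ avg_tendsto_L1[OF g]])
    show "\<forall>\<^sub>F n in sequentially. norm (integral {0..1} (avg n g) - integral {0..1} g)
        \<le> integral {0..1} (\<lambda>x. \<bar>avg n g x - g x\<bar>)"
      using eventually_ge_at_top[of n0]
    proof eventually_elim
      case (elim n)
      have a: "avg n g absolutely_integrable_on {0..1}" using avg_absolutely_integrable[OF elim] .
      then have a_int: "avg n g integrable_on {0..1}" by (simp add: absolutely_integrable_on_def)
      have d: "(\<lambda>x. avg n g x - g x) absolutely_integrable_on {0..1}"
        using a g by (intro set_integral_diff(1))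
      have "integral {0..1} (avg n g) - integral {0..1} g = integral {0..1} (\<lambda>x. avg n g x - g x)"
        using a_int g_int by (subst Henstock_Kurzweil_Integration.integral_diff) auto
      also have "norm \<dots> \<le> integral {0..1} (\<lambda>x. norm (avg n g x - g x))"
        using d by (intro integral_norm_bound_integral) (auto simp: absolutely_integrable_on_def)
      finally show ?case by simp
    qed
  qed
  moreover have "(\<lambda>n. integral {0..1} (avg n g) - p * integral {0..1} (\<lambda>t. g t * W n t)) \<longlonglongrightarrow> 0"
  proof (rule Lim_null_comparison)
    show "\<forall>\<^sub>F n in sequentially. norm (integral {0..1} (avg n g) - p * integral {0..1} (\<lambda>t. g t * W n t))
        \<le> p * \<epsilon> n * integral {0..1} (\<lambda>x. \<bar>g x\<bar>)"
      using eventually_ge_at_top[of n0] by eventually_elim (use integral_avg_error[OF _ g] in simp)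
    have "(\<lambda>n. p * \<epsilon> n * integral {0..1} (\<lambda>x. \<bar>g x\<bar>)) \<longlonglongrightarrow> p * 0 * integral {0..1} (\<lambda>x. \<bar>g x\<bar>)"
      by (intro tendsto_intros \<epsilon>_tendsto)
    then show "(\<lambda>n. p * \<epsilon> n * integral {0..1} (\<lambda>x. \<bar>g x\<bar>)) \<longlonglongrightarrow> 0" by simp
  qed
  ultimately have "(\<lambda>n. (integral {0..1} (avg n g) - integral {0..1} g)
      - (integral {0..1} (avg n g) - p * integral {0..1} (\<lambda>t. g t * W n t)) + integral {0..1} g)
      \<longlonglongrightarrow> 0 - 0 + integral {0..1} g"
    by (intro tendsto_intros)
  then show ?thesis by simp
qed

end

section \<open>Nodes of eigenfunctions\<close>

context p_laplace_system
begin

context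
  assumes fin: "finite {x \<in> {0..1}. y x = 0}"
begin

text \<open>All zeros of \<open>y\<close> are simple, so \<open>y\<close> and \<open>w\<close> never
  vanish together.\<close>

lemma weight_denominator_pos:
  assumes "K > 0" "x \<in> {0..1}"
  shows "K powr p * \<bar>y x\<bar> powr p + \<bar>w x\<bar> powr conj_exp > 0"
proof (cases "y x = 0")
  case True
  then show ?thesis using simple_zero[OF assms(2) True fin] by simp
next
  case False
  then show ?thesis using assms by (intro add_pos_nonneg) auto
qed

lemma weight_continuous: "K > 0 \<Longrightarrow> continuous_on {0..1} (weight K)"
proof -
  assume K: "K > 0"
  have "continuous_on {0..1} (\<lambda>x. \<bar>y x\<bar> powr p)" "continuous_on {0..1} (\<lambda>x. \<bar>w x\<bar> powr conj_exp)"
    using p conj_exp_gt_1 by (intro continuous_on_powr' continuous_on_rabs continuous_on_const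
        y_continuous w_continuous; auto)+
  moreover have "K powr p * \<bar>y x\<bar> powr p + \<bar>w x\<bar> powr conj_exp \<noteq> 0" if "x \<in> {0..1}" for x
    using weight_denominator_pos[OF K that] by simp
  ultimately show ?thesis
    unfolding weight_def[abs_def]
    by (intro continuous_on_divide continuous_on_mult continuous_on_add continuous_on_const) auto
qed

lemma weight_bounds: "K > 0 \<Longrightarrow> x \<in> {0..1} \<Longrightarrow> 0 \<le> weight K x \<and> weight K x \<le> 1"
  using weight_denominator_pos[of K x] by (simp add: weight_def)

end

end

lemma AE_lebesgueE:
  assumes "AE x in lebesgue. P (x :: 'a::euclidean_space)"
  obtains N where "negligible N" "\<And>x. x \<notin> N \<Longrightarrow> P x"
proof -
  from assms obtain N where "{x \<in> space lebesgue. \<not> P x} \<subseteq> N" "N \<in> null_sets lebesgue"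
    by (auto simp: eventually_ae_filter)
  then show ?thesis using that[of N] by (auto simp: negligible_iff_null_sets)
qed

lemma p_laplace_solution_system:
  assumes p: "p > 1" and q: "q absolutely_integrable_on {0<..<1}" and sol: "p_laplace_solution p q \<mu> y"
  obtains w N where "p_laplace_system p q \<mu> y w N"
proof -
  from sol obtain v where v: "\<And>x. x \<in> {0..1} \<Longrightarrow> (y has_real_derivative v x) (at x within {0..1})"
    and ac: "abs_continuous_on 0 1 (\<lambda>x. signed_powr (v x) (p - 1))"
    and ode: "AE x in lebesgue. x \<in> {0<..<1} \<longrightarrow>
            (\<exists>d. ((\<lambda>t. signed_powr (v t) (p - 1)) has_real_derivative d) (at x) \<and>
                 - d = (p - 1) * (\<mu> - q x) * signed_powr (y x) (p - 1))"
    unfolding p_laplace_solution_def by blast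
  obtain N where N: "negligible N" "\<And>x. x \<notin> N \<Longrightarrow> x \<in> {0<..<1} \<Longrightarrow>
      (\<exists>d. ((\<lambda>t. signed_powr (v t) (p - 1)) has_real_derivative d) (at x) \<and>
                 - d = (p - 1) * (\<mu> - q x) * signed_powr (y x) (p - 1))"
    using AE_lebesgueE[OF ode] by metis
  \<comment> \<open>The end points join the exceptional set because the equation is given only in
    the open interval.\<close>
  have "p_laplace_system p q \<mu> y (\<lambda>x. signed_powr (v x) (p - 1)) (N \<union> {0, 1})"
  proof
    show "p > 1" by (rule p)
    show "q absolutely_integrable_on {0..1}" using q by (simp add: absolutely_integrable_on_Icc_iff_Ioo)
    show "abs_continuous_on 0 1 (\<lambda>x. signed_powr (v x) (p - 1))" by (rule ac)
    show "negligible (N \<union> {0, 1})" using N(1) by simp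
    show "(y has_real_derivative signed_powr (signed_powr (v x) (p - 1)) (1 / (p - 1))) (at x within {0..1})"
      if "x \<in> {0..1}" for x
      using v[OF that] p by (simp add: signed_powr_signed_powr_inverse)
    show "((\<lambda>x. signed_powr (v x) (p - 1)) has_real_derivative
        - ((p - 1) * (\<mu> - q x) * signed_powr (y x) (p - 1))) (at x within {0..1})"
      if x: "x \<in> {0..1} - (N \<union> {0, 1})" for x
    proof -
      obtain d where "((\<lambda>t. signed_powr (v t) (p - 1)) has_real_derivative d) (at x)"
        "- d = (p - 1) * (\<mu> - q x) * signed_powr (y x) (p - 1)"
        using N(2)[of x] x by auto
      then show ?thesis using has_field_derivative_at_within by (metis minus_minus)
    qed
  qed
  then show ?thesis by (rule that)
qed

context
  fixes p \<mu> :: real and q y :: "real \<Rightarrow> real" and n :: nat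
  assumes eig: "nth_eigenpair p q n \<mu> y" and n: "n \<ge> 1"
begin

lemma zeros_decomposition: "{x \<in> {0..1}. y x = 0} = insert 0 (insert 1 {x \<in> {0<..<1}. y x = 0})"
  using eig by (auto simp: nth_eigenpair_def dirichlet_eigenfunction_def le_less)

lemma finite_zeros: "finite {x \<in> {0..1}. y x = 0}"
  unfolding zeros_decomposition using eig by (simp add: nth_eigenpair_def)

lemma set_nodes: "set (nodes y) = {x \<in> {0..1}. y x = 0}"
  unfolding nodes_def using finite_zeros by simp

text \<open>The \<open>n - 1\<close> interior zeros plus the two end points;
  \<open>n \<ge> 1\<close> keeps the natural-number subtraction honest.\<close>

lemma length_nodes: "length (nodes y) = Suc n"
proof -
  have "length (nodes y) = card {x \<in> {0..1}. y x = 0}" by (simp add: nodes_def)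
  also have "\<dots> = Suc (Suc (card {x \<in> {0<..<1}. y x = 0}))"
    unfolding zeros_decomposition using eig by (subst card_insert_disjoint) (auto simp: nth_eigenpair_def)
  finally show ?thesis using eig n by (simp add: nth_eigenpair_def)
qed

lemma nodes_less: "i < j \<Longrightarrow> j \<le> n \<Longrightarrow> nodes y ! i < nodes y ! j"
  by (rule sorted_wrt_nth_less[of "(<)" "nodes y"]) (simp_all add: length_nodes, simp add: nodes_def)

lemma nodes_le_iff: "i \<le> n \<Longrightarrow> j \<le> n \<Longrightarrow> nodes y ! i \<le> nodes y ! j \<longleftrightarrow> i \<le> j"
  using nodes_less[of i j] nodes_less[of j i] by (cases i j rule: linorder_cases) auto

lemma node_zero: "i \<le> n \<Longrightarrow> nodes y ! i \<in> {0..1} \<and> y (nodes y ! i) = 0"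
  using nth_mem[of i "nodes y"] unfolding set_nodes by (simp add: length_nodes)

lemma zero_is_node: "x \<in> {0..1} \<Longrightarrow> y x = 0 \<Longrightarrow> \<exists>i\<le>n. x = nodes y ! i"
  using set_nodes length_nodes by (metis (mono_tags, lifting) in_set_conv_nth less_Suc_eq_le mem_Collect_eq)

lemma nodes_0: "nodes y ! 0 = 0"
proof -
  have "0 \<in> {x \<in> {0..1}. y x = 0}" unfolding zeros_decomposition by simp
  then have "y 0 = 0" by simp
  then obtain i where "i \<le> n" "0 = nodes y ! i" using zero_is_node[of 0] by auto
  moreover have "nodes y ! 0 \<in> {0..1}" using node_zero[of 0] by auto
  ultimately show ?thesis using nodes_le_iff[of 0 i] by auto
qed

lemma nodes_n: "nodes y ! n = 1"
proof -
  have "1 \<in> {x \<in> {0..1}. y x = 0}" unfolding zeros_decomposition by simp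
  then have "y 1 = 0" by simp
  then obtain i where "i \<le> n" "1 = nodes y ! i" using zero_is_node[of 1] by auto
  moreover have "nodes y ! n \<in> {0..1}" using node_zero[of n] by auto
  ultimately show ?thesis using nodes_le_iff[of i n] by auto
qed

lemma between_nodes:
  assumes "i < n" "x \<in> {nodes y ! i<..<nodes y ! Suc i}"
  shows "y x \<noteq> 0"
proof
  assume y: "y x = 0"
  have "0 \<le> nodes y ! i" "nodes y ! Suc i \<le> 1"
    using node_zero[of i] node_zero[of "Suc i"] assms by auto
  then have "x \<in> {0..1}" using assms(2) by auto
  from zero_is_node[OF this y] obtain j where j: "j \<le> n" "x = nodes y ! j" by blast
  with assms nodes_le_iff[of j i] nodes_le_iff[of "Suc i" j] show False by auto
qed

lemma nodal_index_eq:
  assumes "i < n" "x \<in> {nodes y ! i..<nodes y ! Suc i}"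
  shows "nodal_index y x = i"
proof -
  have "j < length (nodes y) \<and> nodes y ! j \<le> x \<longleftrightarrow> j \<le> i" for j
  proof (cases "j \<le> i")
    case True
    then show ?thesis using nodes_le_iff[of j i] assms length_nodes by auto
  next
    case False
    then show ?thesis using nodes_le_iff[of "Suc i" j] assms length_nodes by auto
  qed
  then have "{j. j < length (nodes y) \<and> nodes y ! j \<le> x} = {..i}" by auto
  then have "nodal_index y x = Max {..i}" by (simp add: nodal_index_def)
  also have "\<dots> = i" by (intro Max_eqI) auto
  finally show ?thesis .
qed

text \<open>Makes measurability and integrability of \<open>nodal_approx\<close> available, whose
  definition goes pointwise through \<open>Max\<close>.\<close>

lemma nodal_approx_eq_step:
  assumes "x \<in> {0<..<1}"
  shows "nodal_approx p q n y x = step_fun n ((!) (nodes y))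
    (\<lambda>i. p * (real n * pi_hat p) powr p * (real n * nodal_length y i - 1)
      + (LINT t:{0<..<1}|lebesgue. q t)) x"
proof -
  obtain i where i: "i < n" "x \<in> {nodes y ! i..<nodes y ! Suc i}"
    using partition_cell_exists[where X = "(!) (nodes y)" and n = n and x = x, OF nodes_0 nodes_n nodes_less] assms
    by auto
  show ?thesis
    unfolding nodal_approx_def nodal_index_eq[OF i]
    by (rule step_fun_eq[symmetric, where X = "(!) (nodes y)", OF nodes_0 nodes_n nodes_less i]) auto
qed

lemma nodal_approx_integrable: "nodal_approx p q n y absolutely_integrable_on {0<..<1}"
proof -
  let ?f = "step_fun n ((!) (nodes y)) (\<lambda>i. p * (real n * pi_hat p) powr p * (real n * nodal_length y i - 1)
      + (LINT t:{0<..<1}|lebesgue. q t))"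
  have "?f absolutely_integrable_on {0..1}"
    by (rule step_fun_absolutely_integrable[where X = "(!) (nodes y)", OF nodes_0 nodes_n nodes_less]) auto
  then have "?f absolutely_integrable_on {0<..<1}"
    by (simp add: absolutely_integrable_on_Icc_iff_Ioo)
  moreover have "nodal_approx p q n y absolutely_integrable_on {0<..<1} \<longleftrightarrow> ?f absolutely_integrable_on {0<..<1}"
    by (rule set_integrable_cong) (simp_all only: nodal_approx_eq_step)
  ultimately show ?thesis by blast
qed

text \<open>The scale \<open>K\<close> is left free: \<open>K = \<mu>^(1/p)\<close> gives the nodal lengths, whereas an arbitrary \<open>K\<close> gives
  the lower bound for the eigenvalues without knowing the sign of \<open>\<mu>\<close>.\<close>

lemma eigenpair_weight:
  assumes p: "p > 1" and q: "q absolutely_integrable_on {0<..<1}" and K: "K > 0"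
  obtains W where "continuous_on {0..1} W" "\<And>x. x \<in> {0..1} \<Longrightarrow> 0 \<le> W x" "\<And>x. x \<in> {0..1} \<Longrightarrow> W x \<le> 1"
    "\<And>i. i < n \<Longrightarrow> ((\<lambda>x. K * (1 - W x) + (\<mu> - q x) * K powr (1 - p) * W x) has_integral pi_hat p)
      {nodes y ! i..nodes y ! Suc i}"
    "\<And>i. i < n \<Longrightarrow> ((\<lambda>x. (p * W x - 1) * (K * (1 - W x) + (\<mu> - q x) * K powr (1 - p) * W x)) has_integral 0)
      {nodes y ! i..nodes y ! Suc i}"
proof -
  have "p_laplace_solution p q \<mu> y"
    using eig by (simp add: nth_eigenpair_def dirichlet_eigenfunction_def)
  then obtain w N where "p_laplace_system p q \<mu> y w N"
    using p_laplace_solution_system[OF p q] by blast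
  then interpret p_laplace_system p q \<mu> y w N .
  show ?thesis
  proof (rule that[of "weight K"])
    show "continuous_on {0..1} (weight K)" by (rule weight_continuous[OF finite_zeros K])
    show "0 \<le> weight K x" "weight K x \<le> 1" if "x \<in> {0..1}" for x
      using weight_bounds[OF finite_zeros K that] by auto
    fix i assume i: "i < n"
    have z: "nodes y ! i \<in> {0..1}" "y (nodes y ! i) = 0" "nodes y ! Suc i \<in> {0..1}" "y (nodes y ! Suc i) = 0"
      using node_zero[of i] node_zero[of "Suc i"] i by auto
    note nodal = nodal_integrals[OF _ nodes_less _ z(2,4) simple_zero[OF z(1,2) finite_zeros]
        simple_zero[OF z(3,4) finite_zeros] between_nodes[OF i] K]
    show "((\<lambda>x. K * (1 - weight K x) + (\<mu> - q x) * K powr (1 - p) * weight K x) has_integral pi_hat p)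
      {nodes y ! i..nodes y ! Suc i}"
      by (rule nodal(1)) (use z i in auto)
    show "((\<lambda>x. (p * weight K x - 1) * (K * (1 - weight K x) + (\<mu> - q x) * K powr (1 - p) * weight K x))
        has_integral 0) {nodes y ! i..nodes y ! Suc i}"
      by (rule nodal(2)) (use z i in auto)
  qed
qed

text \<open>When \<open>\<mu> \<le> K powr p\<close>, the integrand with integral
  \<open>pi_hat p\<close> on each nodal interval is at most
  \<open>K + K powr (1 - p) * \<bar>q x\<bar>\<close>; summing over the \<open>n\<close> intervals
  bounds \<open>n\<close>. Read contrapositively, it pushes the eigenvalues above
  \<open>K powr p\<close> for large \<open>n\<close>.\<close>

lemma eigenvalue_lower_bound:
  assumes p: "p > 1" and q: "q absolutely_integrable_on {0<..<1}" and K: "K > 0" and \<mu>: "\<mu> \<le> K powr p"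
  shows "real n * pi_hat p \<le> K + K powr (1 - p) * integral {0..1} (\<lambda>x. \<bar>q x\<bar>)"
proof -
  obtain W where W: "\<And>x. x \<in> {0..1} \<Longrightarrow> 0 \<le> W x" "\<And>x. x \<in> {0..1} \<Longrightarrow> W x \<le> 1"
    "\<And>i. i < n \<Longrightarrow> ((\<lambda>x. K * (1 - W x) + (\<mu> - q x) * K powr (1 - p) * W x) has_integral pi_hat p)
      {nodes y ! i..nodes y ! Suc i}"
    by (rule eigenpair_weight[OF p q K]) blast
  let ?f = "\<lambda>x. K + K powr (1 - p) * \<bar>q x\<bar>"
  have q_int: "(\<lambda>x. \<bar>q x\<bar>) integrable_on {0..1}"
    using q by (simp add: integrable_on_Icc_iff_Ioo absolutely_integrable_on_def)
  have f_int: "?f integrable_on {0..1}"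
    by (intro integrable_add integrable_on_mult_right q_int) (simp add: integrable_on_const)
  have KK: "K powr p * K powr (1 - p) = K" using K by (simp flip: powr_add)
  have "real n * pi_hat p = (\<Sum>i<n. pi_hat p)" by simp
  also have "\<dots> \<le> (\<Sum>i<n. integral {nodes y ! i..nodes y ! Suc i} ?f)"
  proof (rule sum_mono)
    fix i assume "i \<in> {..<n}"
    then have i: "i < n" by simp
    have sub: "{nodes y ! i..nodes y ! Suc i} \<subseteq> {0..1}"
      using node_zero[of i] node_zero[of "Suc i"] i by auto
    show "pi_hat p \<le> integral {nodes y ! i..nodes y ! Suc i} ?f"
    proof (rule has_integral_le[OF W(3)[OF i] integrable_integral])
      show "?f integrable_on {nodes y ! i..nodes y ! Suc i}"
        using integrable_on_subinterval[OF f_int] sub by blast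
      fix x assume "x \<in> {nodes y ! i..nodes y ! Suc i}"
      then have x: "0 \<le> W x" "W x \<le> 1" using W sub by auto
      have "(\<mu> - q x) * (K powr (1 - p) * W x) \<le> (K powr p + \<bar>q x\<bar>) * (K powr (1 - p) * W x)"
        using x \<mu> by (intro mult_right_mono) auto
      also have "\<dots> = (K powr p * K powr (1 - p)) * W x + K powr (1 - p) * \<bar>q x\<bar> * W x"
        by (simp only: algebra_simps)
      also have "K powr p * K powr (1 - p) = K" by (rule KK)
      also have "K powr (1 - p) * \<bar>q x\<bar> * W x \<le> K powr (1 - p) * \<bar>q x\<bar> * 1"
        using x by (intro mult_left_mono) auto
      finally show "K * (1 - W x) + (\<mu> - q x) * K powr (1 - p) * W x \<le> ?f x"
        by (simp add: algebra_simps)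
    qed
  qed
  also have "\<dots> = integral {0..1} ?f"
    by (rule integral_partition[where X = "(!) (nodes y)", OF nodes_0 nodes_n nodes_less f_int]) auto
  also have "\<dots> = K + K powr (1 - p) * integral {0..1} (\<lambda>x. \<bar>q x\<bar>)"
    using integrable_on_mult_right[OF q_int, of "K powr (1 - p)"]
    by (subst Henstock_Kurzweil_Integration.integral_add) (auto simp: integrable_on_const)
  finally show ?thesis .
qed

text \<open>For \<open>\<mu> = k powr p\<close> the terms \<open>k * (1 - W x)\<close> and
  \<open>k * W x\<close> recombine, so the integrand is \<open>k\<close> minus a multiple of
  \<open>q x * W x\<close>. The first identity then gives the length exactly; the second expresses
  the integral of \<open>p * W x - 1\<close> through \<open>q\<close> alone.\<close>

lemma nodal_length_asymptotics:
  assumes p: "p > 1" and q: "q absolutely_integrable_on {0<..<1}" and \<mu>: "\<mu> > 0"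
  defines "k \<equiv> \<mu> powr (1 / p)"
  obtains W where "continuous_on {0..1} W" "\<And>x. x \<in> {0..1} \<Longrightarrow> 0 \<le> W x" "\<And>x. x \<in> {0..1} \<Longrightarrow> W x \<le> 1"
    "\<And>i. i < n \<Longrightarrow> nodal_length y i = pi_hat p / k
        + k powr (- p) * integral {nodes y ! i..nodes y ! Suc i} (\<lambda>x. q x * W x)"
    "\<And>i. i < n \<Longrightarrow> \<bar>nodal_length y i - p * integral {nodes y ! i..nodes y ! Suc i} W\<bar>
        \<le> p * k powr (- p) * integral {0..1} (\<lambda>x. \<bar>q x\<bar>)"
proof -
  have k: "k > 0" using \<mu> by (simp add: k_def)
  have k_p: "\<mu> = k powr p" using \<mu> p by (simp add: k_def powr_powr)
  have kk: "k powr p * k powr (1 - p) = k" and kk': "k powr (1 - p) = k * k powr (- p)"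
    using k by (simp_all add: powr_diff powr_minus field_simps flip: powr_add)
  obtain W where W: "continuous_on {0..1} W" "\<And>x. x \<in> {0..1} \<Longrightarrow> 0 \<le> W x" "\<And>x. x \<in> {0..1} \<Longrightarrow> W x \<le> 1"
    and A: "\<And>i. i < n \<Longrightarrow> ((\<lambda>x. k * (1 - W x) + (\<mu> - q x) * k powr (1 - p) * W x) has_integral pi_hat p)
      {nodes y ! i..nodes y ! Suc i}"
    and B: "\<And>i. i < n \<Longrightarrow> ((\<lambda>x. (p * W x - 1) * (k * (1 - W x) + (\<mu> - q x) * k powr (1 - p) * W x)) has_integral 0)
      {nodes y ! i..nodes y ! Suc i}"
    by (rule eigenpair_weight[OF p q k]) blast
  have simp: "k * (1 - W x) + (\<mu> - q x) * k powr (1 - p) * W x = k * (1 - k powr (- p) * (q x * W x))" for x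
  proof -
    have "(\<mu> - q x) * k powr (1 - p) * W x = k * W x - q x * k powr (1 - p) * W x"
      unfolding k_p using kk by (simp add: left_diff_distrib)
    then show ?thesis unfolding kk' by (simp add: algebra_simps)
  qed
  have q01: "q absolutely_integrable_on {0..1}"
    using q by (simp add: absolutely_integrable_on_Icc_iff_Ioo)
  have prod_int: "(\<lambda>x. f x * g x) absolutely_integrable_on {0..1}"
    if "continuous_on {0..1} f" "g absolutely_integrable_on {0..1}" for f g :: "real \<Rightarrow> real"
    using that by (intro absolutely_integrable_bounded_measurable_product_real)
      (auto intro: continuous_imp_measurable_on_sets_lebesgue compact_imp_bounded compact_continuous_image)
  have qW: "(\<lambda>x. q x * W x) absolutely_integrable_on {0..1}"
    using prod_int[OF W(1) q01] by (simp add: mult.commute)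
  have sub: "{nodes y ! i..nodes y ! Suc i} \<subseteq> {0..1}" "nodes y ! i \<le> nodes y ! Suc i" if "i < n" for i
    using node_zero[of i] node_zero[of "Suc i"] nodes_le_iff[of i "Suc i"] that by auto
  have cell_int: "f integrable_on {nodes y ! i..nodes y ! Suc i}"
    if "f absolutely_integrable_on {0..1}" "i < n" for f :: "real \<Rightarrow> real" and i
    using set_integrable_subset[OF that(1) _ sub(1)[OF that(2)]] by (simp add: absolutely_integrable_on_def)
  show ?thesis
  proof (rule that[OF W])
    fix i assume i: "i < n"
    let ?I = "{nodes y ! i..nodes y ! Suc i}"
    have len: "integral ?I (\<lambda>_. c) = c * nodal_length y i" for c :: real
      using sub(2)[OF i] by (simp add: nodal_length_def)
    have "pi_hat p = integral ?I (\<lambda>x. k * (1 - k powr (- p) * (q x * W x)))"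
      using integral_unique[OF A[OF i]] unfolding simp by (rule sym)
    also have "\<dots> = k * (integral ?I (\<lambda>_. 1) - k powr (- p) * integral ?I (\<lambda>x. q x * W x))"
      using cell_int[OF qW i]
      by (simp add: Henstock_Kurzweil_Integration.integral_diff integrable_on_const integrable_on_mult_right)
    finally have "pi_hat p = k * (nodal_length y i - k powr (- p) * integral ?I (\<lambda>x. q x * W x))"
      unfolding len by simp
    then show "nodal_length y i = pi_hat p / k + k powr (- p) * integral ?I (\<lambda>x. q x * W x)"
      using k by (simp add: field_simps)
    have c: "continuous_on {0..1} (\<lambda>x. p * W x - 1)" by (intro continuous_intros W)
    have W_int: "W absolutely_integrable_on {0..1}" by (rule absolutely_integrable_continuous_real[OF W(1)])
    have R: "(\<lambda>x. (p * W x - 1) * (q x * W x)) absolutely_integrable_on {0..1}" by (rule prod_int[OF c qW])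
    have "0 = integral ?I (\<lambda>x. (p * W x - 1) * (k * (1 - k powr (- p) * (q x * W x))))"
      using integral_unique[OF B[OF i]] unfolding simp by (rule sym)
    also have "\<dots> = integral ?I (\<lambda>x. k * ((p * W x - 1) - k powr (- p) * ((p * W x - 1) * (q x * W x))))"
      by (intro integral_cong) (simp add: algebra_simps)
    also have "\<dots> = k * (p * integral ?I W - nodal_length y i - k powr (- p) * integral ?I (\<lambda>x. (p * W x - 1) * (q x * W x)))"
      using cell_int[OF R i] cell_int[OF W_int i] len[of 1]
      by (simp add: Henstock_Kurzweil_Integration.integral_diff integrable_on_const integrable_on_mult_right integrable_diff)
    finally have "nodal_length y i - p * integral ?I W = - (k powr (- p) * integral ?I (\<lambda>x. (p * W x - 1) * (q x * W x)))"
      using k by simp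
    then have "\<bar>nodal_length y i - p * integral ?I W\<bar> = k powr (- p) * \<bar>integral ?I (\<lambda>x. (p * W x - 1) * (q x * W x))\<bar>"
      by (simp add: abs_mult)
    also have "\<bar>integral ?I (\<lambda>x. (p * W x - 1) * (q x * W x))\<bar> \<le> integral ?I (\<lambda>x. p * \<bar>q x\<bar>)"
      unfolding real_norm_def[symmetric]
    proof (rule integral_norm_bound_integral)
      have "(\<lambda>x. norm (q x)) absolutely_integrable_on {0..1}" by (rule absolutely_integrable_norm[OF q01, unfolded o_def])
      then show "(\<lambda>x. p * norm (q x)) integrable_on ?I"
        by (intro integrable_on_mult_right cell_int i)
      fix x assume "x \<in> ?I"
      then have x: "0 \<le> W x" "W x \<le> 1" using W sub[OF i] by auto
      \<comment> \<open>Both \<open>p * W x\<close> and 1 lie between 0 and \<open>p\<close>, so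
        they differ by at most \<open>p\<close>.\<close>
      have "p * W x \<le> p" "0 \<le> p * W x" using p x by (auto simp: mult_left_le)
      then have "\<bar>p * W x - 1\<bar> \<le> p" using p by linarith
      moreover have "\<bar>q x * W x\<bar> \<le> \<bar>q x\<bar> * 1" using x unfolding abs_mult by (intro mult_left_mono) auto
      ultimately show "norm ((p * W x - 1) * (q x * W x)) \<le> p * norm (q x)"
        using p unfolding real_norm_def abs_mult[of "p * W x - 1"] by (intro mult_mono) auto
    qed (use cell_int[OF R i] in simp)
    also have "\<dots> \<le> p * integral {0..1} (\<lambda>x. \<bar>q x\<bar>)"
    proof -
      have "(\<lambda>x. \<bar>q x\<bar>) integrable_on {0..1}" using q01 by (simp add: absolutely_integrable_on_def)
      then have "integral ?I (\<lambda>x. \<bar>q x\<bar>) \<le> integral {0..1} (\<lambda>x. \<bar>q x\<bar>)"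
        using integrable_on_subinterval[OF _ sub(1)[OF i]] sub(1)[OF i] by (intro integral_subset_le) auto
      then show ?thesis using p by simp
    qed
    finally show "\<bar>nodal_length y i - p * integral ?I W\<bar> \<le> p * k powr (- p) * integral {0..1} (\<lambda>x. \<bar>q x\<bar>)"
      by (simp add: mult_ac mult_right_mono)
  qed
qed

end

section \<open>Eigenvalue and nodal asymptotics\<close>

lemma pi_hat_pos: "p > 1 \<Longrightarrow> pi_hat p > 0"
  unfolding pi_hat_def by (intro divide_pos_pos mult_pos_pos sin_gt_zero) (auto simp: field_simps)

lemma eigenvalues_at_top:
  assumes p: "p > 1" and q: "q absolutely_integrable_on {0<..<1}"
    and eig: "\<And>n. n \<ge> 1 \<Longrightarrow> nth_eigenpair p q n (lam n) (y n)"
  shows "filterlim (\<lambda>n. lam n powr (1 / p)) at_top sequentially"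
proof -
  have "\<forall>\<^sub>F n in sequentially. Z \<le> lam n powr (1 / p)" for Z
  proof -
    define K where "K = max 1 Z"
    have K: "K > 0" by (simp add: K_def)
    define C where "C = K + K powr (1 - p) * integral {0..1} (\<lambda>x. \<bar>q x\<bar>)"
    have "\<forall>\<^sub>F n in sequentially. C / pi_hat p < real n"
      using filterlim_real_sequentially by (simp add: filterlim_at_top_dense)
    moreover have "\<forall>\<^sub>F n in sequentially. n \<ge> 1" by (rule eventually_ge_at_top)
    ultimately show ?thesis
    proof eventually_elim
      case (elim n)
      then have "C < real n * pi_hat p"
        using pi_hat_pos[OF p] by (simp add: pos_divide_less_eq)
      then have "\<not> lam n \<le> K powr p"
        using eigenvalue_lower_bound[OF eig[OF elim(2)] elim(2) p q K] unfolding C_def by auto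
      then have "(K powr p) powr (1 / p) \<le> lam n powr (1 / p)"
        using p K by (intro powr_mono2) auto
      moreover have "(K powr p) powr (1 / p) = K" using p K by (simp add: powr_powr)
      ultimately show ?case by (simp add: K_def)
    qed
  qed
  then show ?thesis by (simp add: filterlim_at_top)
qed

theorem theorem3p3:
  fixes p :: real and q :: "real \<Rightarrow> real"
    and lam :: "nat \<Rightarrow> real" and y :: "nat \<Rightarrow> real \<Rightarrow> real"
  assumes "p > 1"
    and "q absolutely_integrable_on {0<..<1}"
    and "\<And>n. n \<ge> 1 \<Longrightarrow> nth_eigenpair p q n (lam n) (y n)"
  shows "(\<forall>\<^sub>F n in sequentially. lam n > 0) \<and>
    (\<lambda>n. lam n powr (1 / p)
        - (real n * pi_hat p
           + 1 / (p * (real n * pi_hat p) powr (p - 1)) * (LINT t:{0<..<1}|lebesgue. q t)))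
      \<in> o(\<lambda>n. 1 / real n powr (p - 1)) \<and>
    (AE x in lebesgue. x \<in> {0<..<1} \<longrightarrow> (\<lambda>n. nodal_approx p q n (y n) x) \<longlonglongrightarrow> q x) \<and>
    (\<forall>n\<ge>1. nodal_approx p q n (y n) absolutely_integrable_on {0<..<1}) \<and>
    (\<lambda>n. LINT x:{0<..<1}|lebesgue. \<bar>nodal_approx p q n (y n) x - q x\<bar>) \<longlonglongrightarrow> 0"
proof -
  note p = assms(1) and q = assms(2) and eig = assms(3)
  define k where "k n = lam n powr (1 / p)" for n
  define ph where "ph = pi_hat p"
  have ph: "ph > 0" using pi_hat_pos[OF p] by (simp add: ph_def)
  have q01: "q absolutely_integrable_on {0..1}"
    using q by (simp add: absolutely_integrable_on_Icc_iff_Ioo)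
  define Q where "Q = integral {0..1} (\<lambda>x. \<bar>q x\<bar>)"
  define I where "I = integral {0..1} q"
  have I: "(LINT t:{0<..<1}|lebesgue. q t) = I"
    unfolding I_def set_lebesgue_integral_eq_integral(2)[OF q] by (rule integral_open_interval_real[symmetric])
  have abs_q: "(\<lambda>x. \<bar>q x\<bar>) integrable_on {0..1}" using q01 by (simp add: absolutely_integrable_on_def)
  have Q: "Q \<ge> 0" unfolding Q_def by (intro integral_nonneg abs_q) auto
  have k_top: "filterlim k at_top sequentially"
    unfolding k_def[abs_def] by (rule eigenvalues_at_top[OF p q eig])

  \<comment> \<open>Positivity of the large eigenvalues\<close>
  have "\<forall>\<^sub>F n in sequentially. k n > 0"
    using k_top by (simp add: filterlim_at_top_dense)
  \<comment> \<open>This does not follow from \<open>k n > 0\<close>, since \<open>powr\<close> is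
    positive for every nonzero base; the lower bound is invoked again with
    \<open>K = 1\<close>.\<close>
  moreover have "\<forall>\<^sub>F n in sequentially. lam n > 0"
  proof -
    have "\<forall>\<^sub>F n in sequentially. C / ph < real n" for C
      using filterlim_real_sequentially by (simp add: filterlim_at_top_dense)
    from this[of "1 + Q"] eventually_ge_at_top[of 1] show ?thesis
    proof eventually_elim
      case (elim n)
      then have "1 + Q < real n * pi_hat p"
        using ph by (simp add: pos_divide_less_eq ph_def)
      then have "\<not> lam n \<le> 1"
        using eigenvalue_lower_bound[OF eig[OF elim(2)] elim(2) p q, of 1] by (auto simp: Q_def)
      then show ?case by simp
    qed
  qed
  ultimately have ev: "\<forall>\<^sub>F n in sequentially. n \<ge> 1 \<and> lam n > 0 \<and> k n > 0"
    using eventually_ge_at_top[of 1] by eventually_elim auto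
  then obtain n0 where n0: "\<And>n. n \<ge> n0 \<Longrightarrow> n \<ge> 1" "\<And>n. n \<ge> n0 \<Longrightarrow> lam n > 0" "\<And>n. n \<ge> n0 \<Longrightarrow> k n > 0"
    by (auto simp: eventually_sequentially)

  \<comment> \<open>Nodes and weights of the eigenfunctions\<close>
  define X where "X n i = nodes (y n) ! i" for n i
  define a where "a n = k n powr (- p)" for n
  define good where "good n W \<longleftrightarrow> continuous_on {0..1} W \<and> (\<forall>x\<in>{0..1}. 0 \<le> W x \<and> W x \<le> 1) \<and>
      (\<forall>i<n. nodal_length (y n) i = ph / k n + a n * integral {X n i..X n (Suc i)} (\<lambda>x. q x * W x) \<and>
        \<bar>nodal_length (y n) i - p * integral {X n i..X n (Suc i)} W\<bar> \<le> p * a n * Q)" for n and W :: "real \<Rightarrow> real"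
  have "\<exists>W. good n W" if n: "n \<ge> n0" for n
  proof (rule nodal_length_asymptotics[OF eig[OF n0(1)[OF n]] n0(1)[OF n] p q n0(2)[OF n]], goal_cases)
    case (1 W)
    then have "good n W" by (simp add: good_def X_def a_def k_def ph_def Q_def)
    then show ?case by (rule exI[of "good n" W])
  qed
  then have good_some: "good n (SOME W. good n W)" if "n \<ge> n0" for n
    using that by (intro someI_ex[of "good n"])
  define W where "W n = (SOME W. good n W)" for n
  have good: "good n (W n)" if "n \<ge> n0" for n
    unfolding W_def by (rule good_some[OF that])
  have W: "\<And>n. n \<ge> n0 \<Longrightarrow> continuous_on {0..1} (W n)"
    "\<And>n x. n \<ge> n0 \<Longrightarrow> x \<in> {0..1} \<Longrightarrow> 0 \<le> W n x \<and> W n x \<le> 1"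
    "\<And>n i. n \<ge> n0 \<Longrightarrow> i < n \<Longrightarrow> nodal_length (y n) i = ph / k n + a n * integral {X n i..X n (Suc i)} (\<lambda>x. q x * W n x)"
    "\<And>n i. n \<ge> n0 \<Longrightarrow> i < n \<Longrightarrow> \<bar>nodal_length (y n) i - p * integral {X n i..X n (Suc i)} (W n)\<bar> \<le> p * a n * Q"
    using good[unfolded good_def] by blast+
  define D where "D n = integral {0..1} (\<lambda>x. q x * W n x)" for n
  have X: "X n 0 = 0" "X n n = 1" "\<And>i. i < n \<Longrightarrow> X n i < X n (Suc i)" if "n \<ge> n0" for n
    unfolding X_def using nodes_0[OF eig n0(1)] nodes_n[OF eig n0(1)] nodes_less[OF eig n0(1)] n0(1)[OF that] that
    by auto
  have a_pos: "a n > 0" if "n \<ge> n0" for n using n0(3)[OF that] by (simp add: a_def)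
  have qW: "(\<lambda>x. q x * W n x) absolutely_integrable_on {0..1}" if "n \<ge> n0" for n
  proof -
    have "(\<lambda>x. W n x * q x) absolutely_integrable_on {0..1}"
      using W(1)[OF that] q01 by (intro absolutely_integrable_bounded_measurable_product_real)
        (auto intro: continuous_imp_measurable_on_sets_lebesgue compact_imp_bounded compact_continuous_image)
    then show ?thesis by (simp add: mult.commute)
  qed
  have qW_bound: "\<bar>integral {u..v} (\<lambda>x. q x * W n x)\<bar> \<le> Q" if n: "n \<ge> n0" and uv: "0 \<le> u" "v \<le> 1" for n u v
  proof -
    have sub: "{u..v} \<subseteq> {0..1}" using uv by auto
    have "norm (integral {u..v} (\<lambda>x. q x * W n x)) \<le> integral {u..v} (\<lambda>x. \<bar>q x\<bar>)"
    proof (rule integral_norm_bound_integral)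
      show "(\<lambda>x. q x * W n x) integrable_on {u..v}"
        by (rule integrable_on_subinterval[OF set_lebesgue_integral_eq_integral(1)[OF qW[OF n]] sub])
      show "(\<lambda>x. \<bar>q x\<bar>) integrable_on {u..v}" by (rule integrable_on_subinterval[OF abs_q sub])
      fix x assume "x \<in> {u..v}"
      then have "0 \<le> W n x" "W n x \<le> 1" using W(2)[OF n] sub by auto
      then show "norm (q x * W n x) \<le> \<bar>q x\<bar>" by (simp add: abs_mult mult_left_le)
    qed
    also have "\<dots> \<le> Q"
      unfolding Q_def using sub by (intro integral_subset_le integrable_on_subinterval[OF abs_q] abs_q) auto
    finally show ?thesis by simp
  qed

  \<comment> \<open>Exact relations between eigenvalue, nodal lengths and weights\<close>
  have total: "real n * ph / k n = 1 - a n * D n" if n: "n \<ge> n0" for n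
  proof -
    have "1 = (\<Sum>i<n. X n (Suc i) - X n i)"
      using X(1,2)[OF n] by (simp add: sum_lessThan_telescope)
    also have "\<dots> = (\<Sum>i<n. ph / k n + a n * integral {X n i..X n (Suc i)} (\<lambda>x. q x * W n x))"
      using W(3)[OF n] by (intro sum.cong) (auto simp: nodal_length_def X_def)
    also have "\<dots> = real n * ph / k n + a n * (\<Sum>i<n. integral {X n i..X n (Suc i)} (\<lambda>x. q x * W n x))"
      by (simp add: sum.distrib sum_distrib_left)
    also have "(\<Sum>i<n. integral {X n i..X n (Suc i)} (\<lambda>x. q x * W n x)) = D n"
      unfolding D_def using X[OF n] qW[OF n]
      by (intro integral_partition) (auto simp: absolutely_integrable_on_def)
    finally show ?thesis by simp
  qed
  \<comment> \<open>By \<open>total\<close>, \<open>n\<close> times the leading term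
    \<open>ph / k n\<close> of the length is \<open>1 - a n * D n\<close>, so the 1 cancels and a
    pure \<open>q\<close>-term of size \<open>a n\<close> remains.\<close>
  have defect: "real n * nodal_length (y n) i - 1 = a n * (real n * integral {X n i..X n (Suc i)} (\<lambda>x. q x * W n x) - D n)"
    if n: "n \<ge> n0" and i: "i < n" for n i
    using total[OF n] unfolding W(3)[OF n i] by (simp add: algebra_simps)
  \<comment> \<open>One bound for both locale conditions: the mesh error is at most
    \<open>a n * (real n * Q + Q)\<close> and the mass error at most
    \<open>real n * (p * a n * Q)\<close>.\<close>
  define e where "e n = p * Q * (a n + real n * a n)" for n

  \<comment> \<open>Vanishing of the error terms\<close>
  have a_tendsto: "a \<longlonglongrightarrow> 0"
    unfolding a_def[abs_def] using p by (intro tendsto_neg_powr k_top) auto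
  have aD: "(\<lambda>n. a n * D n) \<longlonglongrightarrow> 0"
  proof (rule Lim_null_comparison)
    show "\<forall>\<^sub>F n in sequentially. norm (a n * D n) \<le> a n * Q"
      using eventually_ge_at_top[of n0]
    proof eventually_elim
      case (elim n)
      then show ?case using qW_bound[OF elim, of 0 1] a_pos[OF elim] by (simp add: D_def abs_mult)
    qed
    show "(\<lambda>n. a n * Q) \<longlonglongrightarrow> 0" using tendsto_mult_right[OF a_tendsto, of Q] by simp
  qed
  define r where "r n = real n * ph / k n" for n
  have r: "r \<longlonglongrightarrow> 1"
  proof (rule Lim_transform_eventually)
    show "(\<lambda>n. 1 - a n * D n) \<longlonglongrightarrow> 1" using tendsto_diff[OF tendsto_const aD, of 1] by simp
    show "\<forall>\<^sub>F n in sequentially. 1 - a n * D n = r n"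
      using eventually_ge_at_top[of n0] by eventually_elim (simp add: total r_def)
  qed
  \<comment> \<open>\<open>n\<close> is of the order of \<open>k n\<close>, so this product is of
    the order of \<open>k n powr (1 - p)\<close>, which vanishes because
    \<open>p > 1\<close>.\<close>
  have na: "(\<lambda>n. real n * a n) \<longlonglongrightarrow> 0"
  proof (rule Lim_transform_eventually)
    have "(\<lambda>n. k n powr (1 - p)) \<longlonglongrightarrow> 0" using p by (intro tendsto_neg_powr k_top) auto
    then have "(\<lambda>n. r n / ph * k n powr (1 - p)) \<longlonglongrightarrow> 1 / ph * 0"
      using ph by (intro tendsto_intros r) auto
    then show "(\<lambda>n. r n / ph * k n powr (1 - p)) \<longlonglongrightarrow> 0" by simp
    show "\<forall>\<^sub>F n in sequentially. r n / ph * k n powr (1 - p) = real n * a n"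
      using eventually_ge_at_top[of n0]
    proof eventually_elim
      case (elim n)
      have "k n powr (1 - p) = k n * a n" using n0(3)[OF elim] by (simp add: a_def powr_diff powr_minus field_simps)
      then show ?case using n0(3)[OF elim] ph by (simp add: r_def)
    qed
  qed
  have e_tendsto: "e \<longlonglongrightarrow> 0"
  proof -
    have "e \<longlonglongrightarrow> p * Q * (0 + 0)"
      unfolding e_def[abs_def] by (intro tendsto_intros a_tendsto na)
    then show ?thesis by simp
  qed
  interpret weighted_partitions p X W e n0
  proof
    show "p > 0" using p by simp
    show "e \<longlonglongrightarrow> 0" by (rule e_tendsto)
    fix n i assume n: "n \<ge> n0"
    show "X n 0 = 0" "X n n = 1" using X[OF n] by auto
    show "continuous_on {0..1} (W n)" by (rule W(1)[OF n])
    show "0 \<le> W n x" "W n x \<le> 1" if "x \<in> {0..1}" for x using W(2)[OF n that] by auto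
    assume i: "i < n"
    show incr: "X n i < X n (Suc i)" by (rule X(3)[OF n i])
    have len: "X n (Suc i) - X n i = nodal_length (y n) i" by (simp add: nodal_length_def X_def)
    have bounds: "0 \<le> X n i" "X n (Suc i) \<le> 1"
      using node_zero[OF eig[OF n0(1)[OF n]] n0(1)[OF n], of i]
        node_zero[OF eig[OF n0(1)[OF n]] n0(1)[OF n], of "Suc i"] i by (auto simp: X_def)
    let ?J = "integral {X n i..X n (Suc i)} (\<lambda>x. q x * W n x)"
    have "\<bar>real n * ?J - D n\<bar> \<le> real n * \<bar>?J\<bar> + \<bar>D n\<bar>"
      using abs_triangle_ineq4[of "real n * ?J" "D n"] by (simp add: abs_mult)
    also have "\<dots> \<le> real n * Q + Q"
      unfolding D_def using qW_bound[OF n] bounds by (intro add_mono mult_left_mono) auto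
    finally have "\<bar>real n * (X n (Suc i) - X n i) - 1\<bar> \<le> a n * (real n * Q + Q)"
      unfolding len defect[OF n i] abs_mult using a_pos[OF n] by simp
    also have "\<dots> = 1 * (a n * (real n * Q + Q))" by simp
    also have "\<dots> \<le> p * (a n * (real n * Q + Q))"
      using p Q a_pos[OF n] by (intro mult_right_mono) auto
    also have "\<dots> = e n" by (simp add: e_def algebra_simps)
    finally show "\<bar>real n * (X n (Suc i) - X n i) - 1\<bar> \<le> e n" .
    have "\<bar>real n * (X n (Suc i) - X n i - p * integral {X n i..X n (Suc i)} (W n))\<bar> \<le> real n * (p * a n * Q)"
      unfolding len abs_mult using W(4)[OF n i] by (simp add: mult_left_mono)
    also have "\<dots> \<le> e n" using p Q a_pos[OF n] by (simp add: e_def algebra_simps)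
    finally show "\<bar>real n * (X n (Suc i) - X n i - p * integral {X n i..X n (Suc i)} (W n))\<bar> \<le> e n" .
  qed
  have D_tendsto: "(\<lambda>n. p * D n) \<longlonglongrightarrow> I"
    unfolding D_def I_def by (rule weighted_integral_tendsto[OF q01])

  \<comment> \<open>Eigenvalue expansion\<close>
  have little_o: "(\<lambda>n. k n - (real n * ph + 1 / (p * (real n * ph) powr (p - 1)) * I)) \<in> o(\<lambda>n. 1 / real n powr (p - 1))"
  proof (rule smalloI_tendsto)
    have "(\<lambda>n. ph powr (1 - p) * (r n powr (p - 1) * (p * D n) / p - I / p)) \<longlonglongrightarrow>
        ph powr (1 - p) * (1 powr (p - 1) * I / p - I / p)"
      using p by (intro tendsto_intros r D_tendsto) auto
    then have "(\<lambda>n. ph powr (1 - p) * (r n powr (p - 1) * (p * D n) / p - I / p)) \<longlonglongrightarrow> 0" by simp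
    moreover have "\<forall>\<^sub>F n in sequentially. ph powr (1 - p) * (r n powr (p - 1) * (p * D n) / p - I / p)
        = (k n - (real n * ph + 1 / (p * (real n * ph) powr (p - 1)) * I)) / (1 / real n powr (p - 1))"
      using eventually_ge_at_top[of n0]
    proof eventually_elim
      case (elim n)
      have k: "k n > 0" and n: "real n > 0" using n0[OF elim] by auto
      \<comment> \<open>The remainder is exact: it equals \<open>k n powr (1 - p) * D n\<close>.
        Only \<open>r n\<close> tending to 1 and \<open>p * D n\<close> tending to \<open>I\<close>
        are then needed.\<close>
      have E1: "k n - real n * ph = k n * a n * D n"
        using total[OF elim] k by (simp add: field_simps)
      have E2: "k n * a n = k n powr (1 - p)" using k by (simp add: a_def powr_diff powr_minus field_simps)
      have E3: "r n powr (p - 1) = real n powr (p - 1) * ph powr (p - 1) * k n powr (1 - p)"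
        using k ph n by (simp add: r_def powr_divide powr_mult powr_diff field_simps)
      have E4: "ph powr (1 - p) * ph powr (p - 1) = 1" using ph by (simp flip: powr_add)
      have E5: "1 / (p * (real n * ph) powr (p - 1)) * I * real n powr (p - 1) = ph powr (1 - p) * (I / p)"
        using ph n p by (simp add: powr_mult powr_diff field_simps)
      have "(k n - (real n * ph + 1 / (p * (real n * ph) powr (p - 1)) * I)) / (1 / real n powr (p - 1))
          = (k n - real n * ph) * real n powr (p - 1) - 1 / (p * (real n * ph) powr (p - 1)) * I * real n powr (p - 1)"
        by (simp add: algebra_simps)
      also have "\<dots> = k n powr (1 - p) * D n * real n powr (p - 1) - ph powr (1 - p) * (I / p)"
        unfolding E1 E2 E5 ..
      also have "k n powr (1 - p) * D n * real n powr (p - 1)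
          = (ph powr (1 - p) * ph powr (p - 1)) * (k n powr (1 - p) * D n * real n powr (p - 1))"
        unfolding E4 by simp
      also have "\<dots> = ph powr (1 - p) * (r n powr (p - 1) * (p * D n) / p)"
        unfolding E3 using p by (simp add: mult_ac)
      finally show ?case by (simp add: right_diff_distrib)
    qed
    ultimately show "(\<lambda>n. (k n - (real n * ph + 1 / (p * (real n * ph) powr (p - 1)) * I)) / (1 / real n powr (p - 1))) \<longlonglongrightarrow> 0"
      by (rule Lim_transform_eventually)
    show "\<forall>\<^sub>F n in sequentially. 1 / real n powr (p - 1) \<noteq> 0"
      using eventually_ge_at_top[of 1] by eventually_elim auto
  qed

  \<comment> \<open>Convergence of the nodal approximations to the potential\<close>
  define c where "c n = r n powr p" for n
  have c: "c \<longlonglongrightarrow> 1"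
  proof -
    have "c \<longlonglongrightarrow> 1 powr p" unfolding c_def[abs_def] by (intro tendsto_intros r) auto
    then show ?thesis by simp
  qed
  \<comment> \<open>An identity: the prefactor of \<open>nodal_approx\<close> times the size
    \<open>a n\<close> of the defect is \<open>p * c n\<close>. In the limit the two constants
    \<open>I\<close> cancel and \<open>q x\<close> is left.\<close>
  have F: "nodal_approx p q n (y n) x = c n * (avg n q x - p * D n) + I"
    if n: "n \<ge> n0" and x: "x \<in> {0<..<1}" for n x
  proof -
    obtain i where i: "i < n" "x \<in> {X n i..<X n (Suc i)}"
      using cell_exists[OF n, of x] x by auto
    have idx: "nodal_index (y n) x = i"
      by (rule nodal_index_eq[OF eig[OF n0(1)[OF n]] n0(1)[OF n] i[unfolded X_def]])
    have cn: "(real n * ph) powr p * a n = c n"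
      using n0(3)[OF n] ph by (simp add: c_def r_def a_def powr_divide powr_minus_divide)
    have "nodal_approx p q n (y n) x = p * ((real n * ph) powr p * a n)
        * (real n * integral {X n i..X n (Suc i)} (\<lambda>x. q x * W n x) - D n) + I"
      unfolding nodal_approx_def idx defect[OF n i(1)] I ph_def[symmetric] by simp
    then show ?thesis unfolding cn avg_cell[OF n i] coef_def by (simp add: algebra_simps)
  qed
  have ae: "AE x in lebesgue. x \<in> {0<..<1} \<longrightarrow> (\<lambda>n. nodal_approx p q n (y n) x) \<longlonglongrightarrow> q x"
  proof -
    obtain N where N: "negligible N" "\<And>x. x \<in> {0..1} - N \<Longrightarrow> (\<lambda>n. avg n q x) \<longlonglongrightarrow> q x"
      using avg_tendsto_ae[OF q01] by metis
    have "(\<lambda>n. nodal_approx p q n (y n) x) \<longlonglongrightarrow> q x" if x: "x \<in> {0<..<1}" "x \<notin> N" for x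
    proof (rule Lim_transform_eventually)
      have "(\<lambda>n. c n * (avg n q x - p * D n) + I) \<longlonglongrightarrow> 1 * (q x - I) + I"
        using x by (intro tendsto_intros c D_tendsto N(2)) auto
      then show "(\<lambda>n. c n * (avg n q x - p * D n) + I) \<longlonglongrightarrow> q x" by simp
      show "\<forall>\<^sub>F n in sequentially. c n * (avg n q x - p * D n) + I = nodal_approx p q n (y n) x"
        using eventually_ge_at_top[of n0] by eventually_elim (simp add: F[OF _ x(1)])
    qed
    moreover have "AE x in lebesgue. x \<notin> N"
      using N(1) by (intro AE_not_in) (simp add: negligible_iff_null_sets)
    ultimately show ?thesis by (auto elim: eventually_mono)
  qed
  have F_int: "nodal_approx p q n (y n) absolutely_integrable_on {0<..<1}" if "n \<ge> 1" for n
    by (rule nodal_approx_integrable[OF eig[OF that] that])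
  have L1: "(\<lambda>n. LINT x:{0<..<1}|lebesgue. \<bar>nodal_approx p q n (y n) x - q x\<bar>) \<longlonglongrightarrow> 0"
  proof (rule Lim_null_comparison)
    let ?A = "\<lambda>n. integral {0..1} (\<lambda>x. \<bar>avg n q x - q x\<bar>)"
    have "(\<lambda>n. \<bar>c n\<bar> * ?A n + (\<bar>c n - 1\<bar> * Q + \<bar>I - c n * (p * D n)\<bar>)) \<longlonglongrightarrow> \<bar>1\<bar> * 0 + (\<bar>1 - 1\<bar> * Q + \<bar>I - 1 * I\<bar>)"
      by (intro tendsto_intros c D_tendsto avg_tendsto_L1[OF q01])
    then show "(\<lambda>n. \<bar>c n\<bar> * ?A n + (\<bar>c n - 1\<bar> * Q + \<bar>I - c n * (p * D n)\<bar>)) \<longlonglongrightarrow> 0" by simp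
    show "\<forall>\<^sub>F n in sequentially. norm (LINT x:{0<..<1}|lebesgue. \<bar>nodal_approx p q n (y n) x - q x\<bar>)
        \<le> \<bar>c n\<bar> * ?A n + (\<bar>c n - 1\<bar> * Q + \<bar>I - c n * (p * D n)\<bar>)"
      using eventually_ge_at_top[of n0]
    proof eventually_elim
      case (elim n)
      let ?F = "nodal_approx p q n (y n)"
      let ?B = "\<lambda>x. \<bar>c n\<bar> * \<bar>avg n q x - q x\<bar> + (\<bar>c n - 1\<bar> * \<bar>q x\<bar> + \<bar>I - c n * (p * D n)\<bar>)"
      have d: "(\<lambda>x. \<bar>?F x - q x\<bar>) absolutely_integrable_on {0<..<1}"
        by (rule set_integrable_abs[OF set_integral_diff(1)[OF F_int[OF n0(1)[OF elim]] q]])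
      have A_int: "(\<lambda>x. \<bar>avg n q x - q x\<bar>) integrable_on {0..1}"
        using set_integral_diff(1)[OF avg_absolutely_integrable[OF elim] q01]
        by (simp add: absolutely_integrable_on_def)
      have B_int: "?B integrable_on {0..1}"
        by (intro integrable_add integrable_on_mult_right A_int abs_q) (simp add: integrable_on_const)
      have lint: "(LINT x:{0<..<1}|lebesgue. \<bar>?F x - q x\<bar>) = integral {0<..<1} (\<lambda>x. \<bar>?F x - q x\<bar>)"
        by (rule set_lebesgue_integral_eq_integral(2)[OF d])
      have "norm (LINT x:{0<..<1}|lebesgue. \<bar>?F x - q x\<bar>) \<le> integral {0<..<1} ?B"
        unfolding lint
      proof (rule integral_norm_bound_integral)
        show "(\<lambda>x. \<bar>?F x - q x\<bar>) integrable_on {0<..<1}"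
          by (rule set_lebesgue_integral_eq_integral(1)[OF d])
        show "?B integrable_on {0<..<1}" using B_int by (simp only: integrable_on_Icc_iff_Ioo)
        fix x :: real assume x: "x \<in> {0<..<1}"
        \<comment> \<open>Three separate errors: the averages against \<open>q\<close>, the factor
          \<open>c n\<close> against 1, and the constant \<open>c n * (p * D n)\<close> against
          \<open>I\<close>.\<close>
        have "?F x - q x = c n * (avg n q x - q x) + ((c n - 1) * q x + (I - c n * (p * D n)))"
          unfolding F[OF elim x] by (simp add: algebra_simps)
        also have "\<bar>\<dots>\<bar> \<le> \<bar>c n * (avg n q x - q x)\<bar> + (\<bar>(c n - 1) * q x\<bar> + \<bar>I - c n * (p * D n)\<bar>)"
          by linarith
        finally show "norm \<bar>?F x - q x\<bar> \<le> ?B x" by (simp add: abs_mult)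
      qed
      also have "\<dots> = integral {0..1} ?B" by (rule integral_open_interval_real[symmetric])
      also have "\<dots> = \<bar>c n\<bar> * ?A n + (\<bar>c n - 1\<bar> * Q + \<bar>I - c n * (p * D n)\<bar>)"
        unfolding Q_def using A_int abs_q
        by (simp add: Henstock_Kurzweil_Integration.integral_add integrable_add integrable_on_mult_right integrable_on_const)
      finally show ?case .
    qed
  qed
  have "\<forall>\<^sub>F n in sequentially. lam n > 0" using ev by eventually_elim auto
  with little_o ae F_int L1 show ?thesis
    unfolding I k_def ph_def by blast
qed

end
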